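(* Let $\mathscr{H}=\ell\boxtimes\mathcal{H}$ be a homogeneous pre-foliation of co-degree $1$ and degree $d\geq3$ on $\mathbb{P}^2_{\mathbb{C}}$. Assume that $\deg\mathcal{T}_{\mathcal{H}}=2$, or equivalently that the map $\underline{\mathcal{G}}_{\mathcal H}$ has exactly two critical points. For $d\geq4$ the web $\mathrm{Leg}\,\mathscr{H}$ is flat if and only if $\mathscr{H}$ is linearly conjugate to one of the ten following pre-foliations: 1. $\mathscr{H}_1^d=L_\infty\boxtimes\mathcal{H}_1^{d-1}$; 2. $\mathscr{H}_2^d=\{x=0\}\boxtimes\mathcal{H}_1^{d-1}$; 3. $\mathscr{H}_3^d=\{y-x=0\}\boxtimes\mathcal{H}_1^{d-1}$; 4. $\mathscr{H}_4^d=\{y-\xi x=0\}\boxtimes\mathcal{H}_1^{d-1}$, where $\xi=\exp\left(\frac{\mathrm{i}\pi}{d-2}\right)$; 5. $\mathscr{H}_5^d=\{x=0\}\boxtimes\mathcal{H}_2^{d-1}(0,0)$; 6. $\mathscr{H}_6^d=\{dy+3x=0\}\boxtimes\mathcal{H}_3^{d-1}(\lambda_0)$, where $\lambda_0=\frac{(-1)^d(d+3)d^{d-2}}{3^{d-1}}$; 7. $\mathscr{H}_7^d=\{dy+3x=0\}\boxtimes\mathcal{H}_3^{d-1}(\lambda_1)$, where $\lambda_1=\frac{(-1)^d(d-3)d^{d-2}}{3^{d-1}}$; 8. $\mathscr{H}_8^d=L_\infty\boxtimes\mathcal{H}_2^{d-1}(0,0)$; 9. $\mathscr{H}_9^d=\{y-x=0\}\boxtimes\mathcal{H}_2^{d-1}\left(\frac{3}{d},-\frac{3}{d}\right)$;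 10. $\mathscr{H}_{10}^d=\{y-\xi'x=0\}\boxtimes\mathcal{H}_2^{d-1}\left(\frac{3\xi'}{d},-\frac{3}{d\xi'}\right)$, where $\xi'=\exp\left(\frac{\mathrm{i}\pi}{d}\right)$. For $d=3$ the web $\mathrm{Leg}\,\mathscr{H}$ is flat if and only if, up to linear conjugation, either $\mathscr{H}$ is one of the six pre-foliations $\mathscr{H}_1^3,\mathscr{H}_2^3,\ldots,\mathscr{H}_6^3$ (items 1–6 with $d=3$), or $\mathscr{H}$ is of one of the following two types: 11. $\mathscr{H}_7^3(\lambda)=L_\infty\boxtimes\mathcal{H}_3^2(\lambda)$, where $\lambda\in\mathbb{C}^*$; 12. $\mathscr{H}_8^3(\lambda,\mu)=L_\infty\boxtimes\mathcal{H}_2^2(\lambda,\mu)$, where $\lambda,\mu\in\mathbb{C}$ with $\lambda\mu\neq-1$.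
   Context: Homogeneous pre-foliations. A pre-foliation of co-degree $1$ and degree $d$ on $\mathbb{P}^2_{\mathbb{C}}$ is a pair, written $\ell\boxtimes\mathcal H$, of a line $\ell$ and a holomorphic foliation $\mathcal H$ of degree $d-1$. It is homogeneous if in some affine chart $(x,y)$ it is invariant under all homotheties $(x,y)\mapsto\lambda(x,y)$; then $\ell$ passes through the origin or is the line at infinity $L_\infty$, and $\mathcal H$ is defined by $A\,dx+B\,dy$ with $A,B\in\mathbb{C}[x,y]_{d-1}$, $\gcd(A,B)=1$. Linear conjugation means conjugation by an automorphism of $\mathbb{P}^2_{\mathbb{C}}$. $\underline{\mathcal G}_{\mathcal H}:\mathbb{P}^1_{\mathbb{C}}\to\mathbb{P}^1_{\mathbb{C}}$ is the map $[y:x]\mapsto[-A(x,y):B(x,y)]$; the degree of type $\deg\mathcal T_{\mathcal H}$ is the number of its (distinct) critical points. Model foliations of degree $d-1$ (in the affine chart $(x,y)$): $\mathcal H_1^{d-1}$ is defined by $y^{d-1}dx-x^{d-1}dy$; $\mathcal H_2^{d-1}(\lambda,\mu)$ ($\lambda\mu\ne-1$) by $(x^{d-1}+\lambda y^{d-1})dx+(\mu x^{d-1}-y^{d-1})dy$; $\mathcal H_3^{d-1}(\lambda)$ ($\lambda\neq0$) by $(x^{d-1}+\lambda y^{d-1})dx+x^{d-1}dy$. Legendre transform. In the affine chart $(p,q)$ of $\check{\mathbb{P}}^2_{\mathbb{C}}$ associated to the line $\{y=px-q\}$, $\mathrm{Leg}\,\mathcal H$ is the $(d-1)$-web $A(x,px-q)+pB(x,px-q)=0$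 with $x=dq/dp$; $\mathrm{Leg}\,\ell$ is the foliation by lines through the point dual to $\ell$ (given by $f(x,px-q)=0$, $x=dq/dp$, if $\ell=(f(x,y)=0)$; by $dp=0$ if $\ell=L_\infty$); $\mathrm{Leg}(\ell\boxtimes\mathcal H)=\mathrm{Leg}\,\ell\boxtimes\mathrm{Leg}\,\mathcal H$ is their superposition. Curvature. At a generic point a $d$-web $\mathcal W$ is a superposition $\mathcal F_1\boxtimes\cdots\boxtimes\mathcal F_d$ of pairwise transverse foliations, $\mathcal F_i:\omega_i=0$. Put $\omega_i\wedge\omega_j=\delta_{ij}\,dx\wedge dy$. For $r<s<t$ let $\eta_{rst}$ be the unique meromorphic 1-form with $d(\delta_{st}\omega_r)=\eta_{rst}\wedge\delta_{st}\omega_r$, $d(\delta_{tr}\omega_s)=\eta_{rst}\wedge\delta_{tr}\omega_s$, $d(\delta_{rs}\omega_t)=\eta_{rst}\wedge\delta_{rs}\omega_t$. The curvature $K(\mathcal W)=d\big(\sum_{r<s<t}\eta_{rst}\big)$ is a well-defined global meromorphic 2-form; $\mathcal W$ is flat if $K(\mathcal W)\equiv0$. *)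

theory Defs
  imports "HOL-Analysis.Analysis"
begin

section \<open>Pre-foliations of co-degree 1 on the complex projective plane\<close>

text \<open>
  Points of the projective plane are nonzero vectors \<open>v = (X, Y, Z)\<close> up to scaling, and the standard
  affine chart is \<open>x = X/Z\<close>, \<open>y = Y/Z\<close>.  Homogeneous polynomials in \<open>X, Y, Z\<close> are identified with
  the functions they induce on \<open>complex ^ 3\<close> (the ground field being infinite).
\<close>

definition hom_poly :: "nat \<Rightarrow> (complex ^ 3 \<Rightarrow> complex) \<Rightarrow> bool" where
  "hom_poly n f \<longleftrightarrow>
     (\<exists>c :: nat \<Rightarrow> nat \<Rightarrow> complex. \<forall>v.
        f v = (\<Sum>i\<le>n. \<Sum>j\<le>n - i. c i j * v$1 ^ i * v$2 ^ j * v$3 ^ (n - i - j)))"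

text \<open>
  A foliation of degree \<open>m\<close> is given by a 1-form \<open>\<Omega> = a dX + b dY + c dZ\<close>, encoded as
  \<open>v \<mapsto> (a v, b v, c v)\<close>, where \<open>a, b, c\<close> are homogeneous of degree \<open>m + 1\<close> without common factor
  and \<open>\<Omega>\<close> is annihilated by the radial vector field.  A factor of a nonzero homogeneous polynomial
  being homogeneous, only homogeneous common factors \<open>h\<close> have to be excluded (this also excludes
  \<open>\<Omega> = 0\<close>).
\<close>

definition foliation :: "nat \<Rightarrow> (complex ^ 3 \<Rightarrow> complex ^ 3) \<Rightarrow> bool" where
  "foliation m \<Omega> \<longleftrightarrow>
     (\<forall>i. hom_poly (m + 1) (\<lambda>v. \<Omega> v $ i)) \<and>
     (\<forall>v. (\<Sum>i\<in>UNIV. v$i * \<Omega> v $ i) = 0) \<and>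
     \<not> (\<exists>k h Q. 1 \<le> k \<and> k \<le> m + 1 \<and> hom_poly k h \<and>
          (\<forall>i. hom_poly (m + 1 - k) (\<lambda>v. Q v $ i)) \<and> (\<forall>v. \<Omega> v = h v *s Q v))"

text \<open>
  The pair \<open>(l, \<Omega>)\<close> stands for the line \<open>l$1 X + l$2 Y + l$3 Z = 0\<close> together with the foliation
  defined by \<open>\<Omega>\<close>.  Both components matter only up to a nonzero constant.
\<close>

type_synonym prefoliation = "(complex ^ 3) \<times> (complex ^ 3 \<Rightarrow> complex ^ 3)"

definition prefoliation :: "nat \<Rightarrow> prefoliation \<Rightarrow> bool" where
  "prefoliation d P \<longleftrightarrow> fst P \<noteq> 0 \<and> foliation (d - 1) (snd P)"

definition same_prefoliation :: "prefoliation \<Rightarrow> prefoliation \<Rightarrow> bool" where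
  "same_prefoliation P P' \<longleftrightarrow>
     (\<exists>c. c \<noteq> 0 \<and> fst P' = c *s fst P) \<and> (\<exists>c. c \<noteq> 0 \<and> (\<forall>v. snd P' v = c *s snd P v))"

text \<open>
  Pull-back by the automorphism \<open>v \<mapsto> g v\<close>; it also describes \<open>P\<close> in the affine chart
  obtained from the standard one by the linear change of homogeneous coordinates \<open>g\<close>.
\<close>

definition pullback :: "complex ^ 3 ^ 3 \<Rightarrow> prefoliation \<Rightarrow> prefoliation" where
  "pullback g P = (transpose g *v fst P, \<lambda>v. transpose g *v snd P (g *v v))"

definition linearly_conjugate :: "prefoliation \<Rightarrow> prefoliation \<Rightarrow> bool" where
  "linearly_conjugate P P' \<longleftrightarrow> (\<exists>g. invertible g \<and> same_prefoliation (pullback g P) P')"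

definition homothety :: "complex \<Rightarrow> complex ^ 3 ^ 3" where
  "homothety t = vector [vector [t, 0, 0], vector [0, t, 0], vector [0, 0, 1]]"

definition homothety_invariant :: "prefoliation \<Rightarrow> bool" where
  "homothety_invariant P \<longleftrightarrow> (\<forall>t. t \<noteq> 0 \<longrightarrow> same_prefoliation (pullback (homothety t) P) P)"

text \<open>\<open>P\<close> is homogeneous, as witnessed by the affine chart given by \<open>g\<close>.\<close>

definition homogeneous_in_chart :: "complex ^ 3 ^ 3 \<Rightarrow> prefoliation \<Rightarrow> bool" where
  "homogeneous_in_chart g P \<longleftrightarrow> invertible g \<and> homothety_invariant (pullback g P)"

text \<open>In the affine chart \<open>(x, y)\<close> the foliation is defined by \<open>A dx + B dy\<close>.\<close>

definition affA :: "prefoliation \<Rightarrow> complex \<Rightarrow> complex \<Rightarrow> complex" where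
  "affA P x y = snd P (vector [x, y, 1]) $ 1"

definition affB :: "prefoliation \<Rightarrow> complex \<Rightarrow> complex \<Rightarrow> complex" where
  "affB P x y = snd P (vector [x, y, 1]) $ 2"


section \<open>The Gauss map and the degree of type\<close>

text \<open>
  For \<open>F1, F2\<close> homogeneous of the same degree in \<open>(x, y)\<close> without common zero, \<open>(x, y)\<close> represents a
  critical point of the self-map \<open>[x : y] \<mapsto> [F1 : F2]\<close> of the projective line iff the differential of
  the map vanishes there, i.e. iff in an affine chart of the target around the image (\<open>F1/F2\<close> or
  \<open>F2/F1\<close>) all directional derivatives vanish.  The lines \<open>s \<mapsto> (x + s h, y + s k)\<close> with \<open>(h, k)\<close>
  independent of \<open>(x, y)\<close> parametrize the source around \<open>[x : y]\<close>; along the remaining directions the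
  quotient is constant.
\<close>

definition critical_at ::
  "(complex \<Rightarrow> complex \<Rightarrow> complex) \<Rightarrow> (complex \<Rightarrow> complex \<Rightarrow> complex) \<Rightarrow> complex \<Rightarrow> complex \<Rightarrow> bool" where
  "critical_at F1 F2 x y \<longleftrightarrow>
     (\<forall>h k.
        (F2 x y \<noteq> 0 \<longrightarrow>
          ((\<lambda>s. F1 (x + s * h) (y + s * k) / F2 (x + s * h) (y + s * k)) has_field_derivative 0) (at 0)) \<and>
        (F1 x y \<noteq> 0 \<longrightarrow>
          ((\<lambda>s. F2 (x + s * h) (y + s * k) / F1 (x + s * h) (y + s * k)) has_field_derivative 0) (at 0)))"

definition proj_point :: "complex \<Rightarrow> complex \<Rightarrow> (complex \<times> complex) set" where
  "proj_point x y = {(c * x, c * y) | c. c \<noteq> 0}"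

definition gauss_critical_points :: "prefoliation \<Rightarrow> (complex \<times> complex) set set" where
  "gauss_critical_points P =
     {proj_point x y | x y. (x, y) \<noteq> (0, 0) \<and> critical_at (\<lambda>x y. - affA P x y) (affB P) x y}"

definition type_degree :: "prefoliation \<Rightarrow> nat" where
  "type_degree P = card (gauss_critical_points P)"


section \<open>Curvature of planar webs\<close>

text \<open>
  Local coordinates are \<open>(p, q)\<close>.  A 1-form \<open>a dp + b dq\<close> is a function \<open>z \<mapsto> (a z, b z)\<close>; 2-forms
  are represented by their coefficient with respect to \<open>dp \<and> dq\<close>.
\<close>

type_synonym one_form = "complex \<times> complex \<Rightarrow> complex \<times> complex"

definition wedge :: "complex \<times> complex \<Rightarrow> complex \<times> complex \<Rightarrow> complex" where
  "wedge u w = fst u * snd w - snd u * fst w"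

definition ext_d :: "one_form \<Rightarrow> complex \<times> complex \<Rightarrow> complex" where
  "ext_d \<omega> z = deriv (\<lambda>p. snd (\<omega> (p, snd z))) (fst z) - deriv (\<lambda>q. fst (\<omega> (fst z, q))) (snd z)"

definition scale_form :: "(complex \<times> complex \<Rightarrow> complex) \<Rightarrow> one_form \<Rightarrow> one_form" where
  "scale_form f \<omega> = (\<lambda>z. (f z * fst (\<omega> z), f z * snd (\<omega> z)))"

definition form_delta :: "one_form \<Rightarrow> one_form \<Rightarrow> complex \<times> complex \<Rightarrow> complex" where
  "form_delta \<alpha> \<beta> z = wedge (\<alpha> z) (\<beta> z)"

text \<open>
  The form \<open>\<eta>\<close> attached to three forms.  Where they are pairwise transverse, the three
  equations have exactly one solution at each point.
\<close>

definition web_eta :: "one_form \<Rightarrow> one_form \<Rightarrow> one_form \<Rightarrow> one_form" where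
  "web_eta \<omega>r \<omega>s \<omega>t z = (THE e.
     ext_d (scale_form (form_delta \<omega>s \<omega>t) \<omega>r) z = wedge e (scale_form (form_delta \<omega>s \<omega>t) \<omega>r z) \<and>
     ext_d (scale_form (form_delta \<omega>t \<omega>r) \<omega>s) z = wedge e (scale_form (form_delta \<omega>t \<omega>r) \<omega>s z) \<and>
     ext_d (scale_form (form_delta \<omega>r \<omega>s) \<omega>t) z = wedge e (scale_form (form_delta \<omega>r \<omega>s) \<omega>t z))"

definition web_curvature :: "nat \<Rightarrow> (nat \<Rightarrow> one_form) \<Rightarrow> complex \<times> complex \<Rightarrow> complex" where
  "web_curvature d \<omega> =
     ext_d (\<lambda>z. \<Sum>t<d. \<Sum>s<t. \<Sum>r<s. web_eta (\<omega> r) (\<omega> s) (\<omega> t) z)"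


section \<open>Legendre transform\<close>

definition holomorphic2_on :: "(complex \<times> complex \<Rightarrow> complex) \<Rightarrow> (complex \<times> complex) set \<Rightarrow> bool" where
  "holomorphic2_on f U \<longleftrightarrow>
     (\<forall>z\<in>U. \<exists>a b. (f has_derivative (\<lambda>(h, k). a * h + b * k)) (at z))"

text \<open>
  The pencil of lines dual to \<open>\<alpha> x + \<beta> y + \<gamma> = 0\<close>: substituting \<open>y = p x - q\<close>, \<open>x = dq/dp\<close> and
  clearing the denominator gives \<open>\<alpha> dq + \<beta> (p dq - q dp) + \<gamma> dp = 0\<close>, which is \<open>dp = 0\<close> for the
  line at infinity \<open>\<alpha> = \<beta> = 0\<close>.
\<close>

definition leg_line :: "complex ^ 3 \<Rightarrow> one_form" where
  "leg_line l = (\<lambda>(p, q). (l$3 - q * l$2, l$1 + p * l$2))"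

text \<open>
  On the open set \<open>U\<close> of the chart \<open>(p, q)\<close>, the \<open>d\<close>-web \<open>Leg (\<ell> \<boxtimes> \<H>)\<close> is the superposition of the
  pairwise transverse foliations \<open>\<omega> i = 0\<close>, \<open>i < d\<close>: index \<open>0\<close> is \<open>Leg \<ell>\<close>, and the other \<open>d - 1\<close>
  are \<open>dq = x dp\<close> for the \<open>d - 1\<close> branches \<open>x = X i (p, q)\<close> of \<open>A (x, p x - q) + p B (x, p x - q) = 0\<close>,
  an equation of degree at most \<open>d - 1\<close> in \<open>x\<close>.
\<close>

definition leg_web_on ::
  "nat \<Rightarrow> prefoliation \<Rightarrow> (complex \<times> complex) set \<Rightarrow> (nat \<Rightarrow> one_form) \<Rightarrow> bool" where
  "leg_web_on d P U \<omega> \<longleftrightarrow>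
     open U \<and>
     \<omega> 0 = leg_line (fst P) \<and>
     (\<exists>X. \<forall>i\<in>{1..<d}.
        holomorphic2_on (X i) U \<and>
        (\<forall>(p, q)\<in>U. affA P (X i (p, q)) (p * X i (p, q) - q)
                     + p * affB P (X i (p, q)) (p * X i (p, q) - q) = 0) \<and>
        \<omega> i = (\<lambda>z. (- X i z, 1))) \<and>
     (\<forall>i<d. \<forall>j<d. i \<noteq> j \<longrightarrow> (\<forall>z\<in>U. form_delta (\<omega> i) (\<omega> j) z \<noteq> 0))"

text \<open>
  The curvature, a global meromorphic 2-form, is identically zero iff it vanishes wherever the web
  is locally such a superposition.
\<close>

definition leg_flat :: "nat \<Rightarrow> prefoliation \<Rightarrow> bool" where
  "leg_flat d P \<longleftrightarrow> (\<forall>U \<omega>. leg_web_on d P U \<omega> \<longrightarrow> (\<forall>z\<in>U. web_curvature d \<omega> z = 0))"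


section \<open>The models\<close>

text \<open>
  The foliation \<open>A dx + B dy\<close> with \<open>A, B\<close> homogeneous of degree \<open>d - 1\<close> in \<open>(x, y)\<close>: substituting
  \<open>x = X/Z\<close>, \<open>y = Y/Z\<close> and multiplying by \<open>Z ^ (d + 1)\<close>.
\<close>

definition affine_form ::
  "(complex \<Rightarrow> complex \<Rightarrow> complex) \<Rightarrow> (complex \<Rightarrow> complex \<Rightarrow> complex) \<Rightarrow> complex ^ 3 \<Rightarrow> complex ^ 3" where
  "affine_form A B v = vector
     [v$3 * A (v$1) (v$2), v$3 * B (v$1) (v$2), - (v$1 * A (v$1) (v$2) + v$2 * B (v$1) (v$2))]"

text \<open>The superscript of the model foliations is the explicit argument \<open>n = d - 1\<close>.\<close>

definition H1 :: "nat \<Rightarrow> complex ^ 3 \<Rightarrow> complex ^ 3" where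
  "H1 n = affine_form (\<lambda>x y. y ^ n) (\<lambda>x y. - (x ^ n))"

definition H2 :: "nat \<Rightarrow> complex \<Rightarrow> complex \<Rightarrow> complex ^ 3 \<Rightarrow> complex ^ 3" where
  "H2 n lam mu = affine_form (\<lambda>x y. x ^ n + lam * y ^ n) (\<lambda>x y. mu * x ^ n - y ^ n)"

definition H3 :: "nat \<Rightarrow> complex \<Rightarrow> complex ^ 3 \<Rightarrow> complex ^ 3" where
  "H3 n lam = affine_form (\<lambda>x y. x ^ n + lam * y ^ n) (\<lambda>x y. x ^ n)"

definition line_inf :: "complex ^ 3" where
  "line_inf = vector [0, 0, 1]"

text \<open>The line \<open>a x + b y = 0\<close>.\<close>

definition line0 :: "complex \<Rightarrow> complex \<Rightarrow> complex ^ 3" where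
  "line0 a b = vector [a, b, 0]"

definition xi :: "nat \<Rightarrow> complex" where
  "xi d = exp (\<i> * of_real pi / (of_nat d - 2))"

definition xi' :: "nat \<Rightarrow> complex" where
  "xi' d = exp (\<i> * of_real pi / of_nat d)"

definition lambda0 :: "nat \<Rightarrow> complex" where
  "lambda0 d = (- 1) ^ d * (of_nat d + 3) * of_nat d ^ (d - 2) / 3 ^ (d - 1)"

definition lambda1 :: "nat \<Rightarrow> complex" where
  "lambda1 d = (- 1) ^ d * (of_nat d - 3) * of_nat d ^ (d - 2) / 3 ^ (d - 1)"

definition model1 :: "nat \<Rightarrow> prefoliation" where
  "model1 d = (line_inf, H1 (d - 1))"

definition model2 :: "nat \<Rightarrow> prefoliation" where
  "model2 d = (line0 1 0, H1 (d - 1))"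

definition model3 :: "nat \<Rightarrow> prefoliation" where
  "model3 d = (line0 (- 1) 1, H1 (d - 1))"

definition model4 :: "nat \<Rightarrow> prefoliation" where
  "model4 d = (line0 (- xi d) 1, H1 (d - 1))"

definition model5 :: "nat \<Rightarrow> prefoliation" where
  "model5 d = (line0 1 0, H2 (d - 1) 0 0)"

definition model6 :: "nat \<Rightarrow> prefoliation" where
  "model6 d = (line0 3 (of_nat d), H3 (d - 1) (lambda0 d))"

definition model7 :: "nat \<Rightarrow> prefoliation" where
  "model7 d = (line0 3 (of_nat d), H3 (d - 1) (lambda1 d))"

definition model8 :: "nat \<Rightarrow> prefoliation" where
  "model8 d = (line_inf, H2 (d - 1) 0 0)"

definition model9 :: "nat \<Rightarrow> prefoliation" where
  "model9 d = (line0 (- 1) 1, H2 (d - 1) (3 / of_nat d) (- 3 / of_nat d))"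

definition model10 :: "nat \<Rightarrow> prefoliation" where
  "model10 d = (line0 (- xi' d) 1, H2 (d - 1) (3 * xi' d / of_nat d) (- 3 / (of_nat d * xi' d)))"

definition cubic_model7 :: "complex \<Rightarrow> prefoliation" where
  "cubic_model7 lam = (line_inf, H3 2 lam)"

definition cubic_model8 :: "complex \<Rightarrow> complex \<Rightarrow> prefoliation" where
  "cubic_model8 lam mu = (line_inf, H2 2 lam mu)"

end

theory Submission
  imports Defs "HOL-Computational_Algebra.Fundamental_Theorem_Algebra"
begin

text \<open>
  If the Gauss map of \<open>\<H>\<close> has only two critical points, it is totally ramified at both, so in suitable linear
  coordinates \<open>\<H>\<close> is given by \<open>(c x\<^sup>n + a y\<^sup>n) dx + (d x\<^sup>n + b y\<^sup>n) dy\<close> with \<open>n = d - 1\<close> and \<open>a d - b c \<noteq> 0\<close>, and the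
  line is \<open>L\<^sub>\<infinity>\<close>, \<open>x = 0\<close> or \<open>x = y\<close>.  Put \<open>P = U / V\<close> for the ratio of the slopes of \<open>x\<close> and \<open>y\<close> along the dual line.  The
  foliations of the Legendre web are then \<open>\<alpha> = \<tau> \<beta>\<close> with \<open>\<alpha> = U dq - q dU\<close>, \<open>\<beta> = V dq - q dV\<close>, where \<open>\<tau>\<close> runs over the
  \<open>n\<close>-th roots of \<open>R = - (a P + b) / (c P + d)\<close> and, for a line through the origin, also over a constant \<open>\<tau>\<^sub>0\<close>.

  For such pencils the \<open>dq / q\<close>-component of \<open>\<eta>\<close> is a rational function of \<open>p\<close> and of the \<open>\<tau>\<close>; summing over triples
  is summing over roots of unity and leaves a rational function of \<open>P\<close> alone.  The web is flat iff
  this function is constant: \<open>(n - 2) P R' / R\<close> for \<open>L\<^sub>\<infinity>\<close>, \<open>(n + 1) P R' / R\<close> for \<open>x = 0\<close>, and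
  \<open>(R' / R) ((n - 2) P - 3 (P - 1) (P + R) / (1 - R))\<close> for \<open>x = y\<close>.  Comparing coefficients gives finitely many
  normal forms, which are the models up to diagonal scalings.

  Conversely, a conjugation between two homogeneous foliations of degree \<open>n \<ge> 2\<close> fixes the origin and the line at
  infinity, so the criterion in normal form decides flatness for every conjugate of a model.
\<close>

section \<open>The form \<open>\<eta>\<close> of three members of a pencil\<close>

text \<open>Homotheties of the plane act on the dual chart by scaling \<open>q\<close>. This is why
  the curvature collapses to one derivative: the parameters \<open>\<tau>\<close> depend on
  \<open>p\<close> alone, so the \<open>dp\<close>-component of the summed \<open>\<eta>\<close> is
  locally constant in \<open>q\<close>, the \<open>dq\<close>-component is
  \<open>(C + F p) / q\<close>, and the curvature is \<open>F' / q\<close>.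

  Flatness speaks of all local decompositions of the web in one fixed dual chart. One direction
  therefore needs an explicit web over a disc of slopes, on which constancy can be read off; the
  other needs nonvanishing facts valid under any web, and these are extracted from transversality.
  The fixed chart also forces two notions of conjugation: flatness is decided for conjugates that
  are linear in \<open>(x, y)\<close>, and every projective conjugation that occurs is shown to be
  of this kind.

  The constants of the models have two sources. The numbers \<open>3 / d\<close>,
  \<open>d + 3\<close> and \<open>d - 3\<close> solve the coefficient equations for the line
  \<open>x = y\<close>; the roots \<open>xi\<close>, \<open>xi'\<close> and the powers in
  \<open>lambda0\<close>, \<open>lambda1\<close> record the diagonal scalings that bring a solution
  into the shape of a model.\<close>

lemma wedge_scale_form: "wedge x (scale_form f \<omega> z) = f z * wedge x (\<omega> z)"
  by (simp add: wedge_def scale_form_def algebra_simps)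

text \<open>\<open>web_eta\<close> is a definite description, so uniqueness is part of the claim. It
  holds because the wedge products with the transverse forms \<open>\<omega>r z\<close> and
  \<open>\<omega>s z\<close> determine both coordinates of \<open>e\<close>.\<close>

lemma web_eta_eqI:
  assumes tr: "wedge (\<omega>r z) (\<omega>s z) \<noteq> 0" "wedge (\<omega>s z) (\<omega>t z) \<noteq> 0" "wedge (\<omega>t z) (\<omega>r z) \<noteq> 0"
    and eqs: "ext_d (scale_form (form_delta \<omega>s \<omega>t) \<omega>r) z = wedge e (scale_form (form_delta \<omega>s \<omega>t) \<omega>r z)"
      "ext_d (scale_form (form_delta \<omega>t \<omega>r) \<omega>s) z = wedge e (scale_form (form_delta \<omega>t \<omega>r) \<omega>s z)"
      "ext_d (scale_form (form_delta \<omega>r \<omega>s) \<omega>t) z = wedge e (scale_form (form_delta \<omega>r \<omega>s) \<omega>t z)"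
  shows "web_eta \<omega>r \<omega>s \<omega>t z = e"
  unfolding web_eta_def
proof (rule the_equality)
  show "ext_d (scale_form (form_delta \<omega>s \<omega>t) \<omega>r) z = wedge e (scale_form (form_delta \<omega>s \<omega>t) \<omega>r z) \<and>
     ext_d (scale_form (form_delta \<omega>t \<omega>r) \<omega>s) z = wedge e (scale_form (form_delta \<omega>t \<omega>r) \<omega>s z) \<and>
     ext_d (scale_form (form_delta \<omega>r \<omega>s) \<omega>t) z = wedge e (scale_form (form_delta \<omega>r \<omega>s) \<omega>t z)"
    using eqs by blast
next
  fix e'
  assume "ext_d (scale_form (form_delta \<omega>s \<omega>t) \<omega>r) z = wedge e' (scale_form (form_delta \<omega>s \<omega>t) \<omega>r z) \<and>
     ext_d (scale_form (form_delta \<omega>t \<omega>r) \<omega>s) z = wedge e' (scale_form (form_delta \<omega>t \<omega>r) \<omega>s z) \<and>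
     ext_d (scale_form (form_delta \<omega>r \<omega>s) \<omega>t) z = wedge e' (scale_form (form_delta \<omega>r \<omega>s) \<omega>t z)"
  then have "wedge e' (scale_form (form_delta \<omega>s \<omega>t) \<omega>r z) = wedge e (scale_form (form_delta \<omega>s \<omega>t) \<omega>r z)"
    "wedge e' (scale_form (form_delta \<omega>t \<omega>r) \<omega>s z) = wedge e (scale_form (form_delta \<omega>t \<omega>r) \<omega>s z)"
    using eqs by simp_all
  then have w: "wedge e' (\<omega>r z) = wedge e (\<omega>r z)" "wedge e' (\<omega>s z) = wedge e (\<omega>s z)"
    using tr by (simp_all add: form_delta_def wedge_scale_form)
  obtain a b where e: "e = (a, b)" by (cases e)
  obtain a' b' where e': "e' = (a', b')" by (cases e')
  obtain f g where r: "\<omega>r z = (f, g)" by (cases "\<omega>r z")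
  obtain h k where s: "\<omega>s z = (h, k)" by (cases "\<omega>s z")
  have "(a' - a) * (f * k - h * g) = 0" "(b' - b) * (f * k - h * g) = 0"
    using w unfolding e e' r s wedge_def fst_conv snd_conv by algebra+
  moreover have "f * k - h * g \<noteq> 0" using tr(1) by (simp add: r s wedge_def mult.commute)
  ultimately show "e' = e" by (simp add: e e' mult.commute)
qed

text \<open>\<open>f\<close> and \<open>g\<close> are the \<open>dp\<close>- and
  \<open>dq\<close>-coefficients, the last four arguments their partial derivatives. The equations
  for \<open>\<eta>\<close> see a form only through this one-jet.\<close>

definition jet :: "one_form \<Rightarrow> complex \<Rightarrow> complex \<Rightarrow> complex \<Rightarrow> complex \<Rightarrow> complex \<Rightarrow> complex \<Rightarrow> complex \<Rightarrow> complex \<Rightarrow> bool" where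
  "jet \<omega> p q f g fp fq gp gq \<longleftrightarrow> \<omega> (p, q) = (f, g) \<and>
     ((\<lambda>x. fst (\<omega> (x, q))) has_field_derivative fp) (at p) \<and>
     ((\<lambda>x. fst (\<omega> (p, x))) has_field_derivative fq) (at q) \<and>
     ((\<lambda>x. snd (\<omega> (x, q))) has_field_derivative gp) (at p) \<and>
     ((\<lambda>x. snd (\<omega> (p, x))) has_field_derivative gq) (at q)"

lemma ext_d_scaled_jet:
  assumes r: "jet \<omega>r p q fr gr frp frq grp grq"
    and s: "jet \<omega>s p q fs gs fsp fsq gsp gsq"
    and t: "jet \<omega>t p q ft gt ftp ftq gtp gtq"
  shows "ext_d (scale_form (form_delta \<omega>s \<omega>t) \<omega>r) (p, q) =
    (fsp * gt + fs * gtp - ftp * gs - ft * gsp) * gr + (fs * gt - ft * gs) * grp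
    - (fsq * gt + fs * gtq - ftq * gs - ft * gsq) * fr - (fs * gt - ft * gs) * frq"
proof -
  have 1: "((\<lambda>x. snd (scale_form (form_delta \<omega>s \<omega>t) \<omega>r (x, q))) has_field_derivative
    (fsp * gt + fs * gtp - ftp * gs - ft * gsp) * gr + (fs * gt - ft * gs) * grp) (at p)"
    using r s t unfolding jet_def scale_form_def form_delta_def wedge_def
    by (auto intro!: derivative_eq_intros simp: algebra_simps)
  have 2: "((\<lambda>x. fst (scale_form (form_delta \<omega>s \<omega>t) \<omega>r (p, x))) has_field_derivative
    (fsq * gt + fs * gtq - ftq * gs - ft * gsq) * fr + (fs * gt - ft * gs) * frq) (at q)"
    using r s t unfolding jet_def scale_form_def form_delta_def wedge_def
    by (auto intro!: derivative_eq_intros simp: algebra_simps)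
  show ?thesis
    unfolding ext_d_def fst_conv snd_conv DERIV_imp_deriv[OF 1] DERIV_imp_deriv[OF 2] by simp
qed

text \<open>\<open>pencil_jet\<close>: to first order in \<open>p\<close>, \<open>\<omega> = \<kappa> (\<alpha> - \<tau> \<beta>)\<close> with \<open>\<alpha> = U dq - q dU\<close>, \<open>\<beta> = V dq - q dV\<close>.\<close>

definition pencil_jet :: "one_form \<Rightarrow> complex \<Rightarrow> complex \<Rightarrow> complex \<Rightarrow> complex \<Rightarrow> complex \<Rightarrow> complex \<Rightarrow>
    complex \<Rightarrow> complex \<Rightarrow> complex \<Rightarrow> complex \<Rightarrow> bool" where
  "pencil_jet \<omega> p q U V u2 v2 \<kappa> \<kappa>' \<tau> \<tau>' \<longleftrightarrow>
     jet \<omega> p q (- q * (\<kappa> * (u2 - \<tau> * v2))) (\<kappa> * (U - \<tau> * V))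
       (- q * (\<kappa>' * (u2 - \<tau> * v2) - \<kappa> * \<tau>' * v2)) (- (\<kappa> * (u2 - \<tau> * v2)))
       (\<kappa>' * (U - \<tau> * V) + \<kappa> * (u2 - \<tau> * v2 - \<tau>' * V)) 0"

text \<open>\<open>eta1\<close> and \<open>eta2\<close> are the coefficients of \<open>\<tau>'\<close> in the \<open>dp\<close>- and \<open>dq / q\<close>-components of \<open>\<eta>\<close>, up to the
  factor \<open>1 / (v2 U - u2 V)\<close>.\<close>

definition eta2 :: "complex \<Rightarrow> complex \<Rightarrow> complex \<Rightarrow> complex \<Rightarrow> complex \<Rightarrow> complex" where
  "eta2 U V ti tj tk = (U - tj * V) * (U - tk * V) / ((ti - tj) * (ti - tk))"

definition eta1 :: "complex \<Rightarrow> complex \<Rightarrow> complex \<Rightarrow> complex \<Rightarrow> complex \<Rightarrow> complex \<Rightarrow> complex \<Rightarrow> complex" where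
  "eta1 U V u2 v2 ti tj tk =
     ((v2 * U - u2 * V) * ti - u2 * U + (tj + tk) * u2 * V - tj * tk * v2 * V) / ((ti - tj) * (ti - tk))"

lemma eta_coeff_sym: "eta1 U V u2 v2 ti tj tk = eta1 U V u2 v2 ti tk tj"
  "eta2 U V ti tj tk = eta2 U V ti tk tj"
  by (simp_all add: eta1_def eta2_def algebra_simps)

text \<open>The equation for \<open>\<eta>\<close> attached to \<open>\<omega>r\<close> is linear in
  the derivatives of the three parameters, so it can be checked coefficient by coefficient. This
  identity serves the derivative of \<open>ts\<close>; \<open>eta_coeff_self\<close> serves that of
  \<open>tr\<close>.\<close>

lemma eta_coeff_other:
  assumes "tr \<noteq> ts" "ts \<noteq> tt"
  shows "(ts - tt) * (eta1 U V u2 v2 ts tt tr * (U - tr * V) + eta2 U V ts tt tr * (u2 - tr * v2))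
     = (v2 * U - u2 * V) * (U - tr * V)"
proof -
  have "(v2 * U - u2 * V) * (U - tr * V) * (ts - tr) = (((v2 * U - u2 * V) * ts - u2 * U + (tt + tr) * u2 * V - tt * tr * v2 * V) * (U - tr * V)
     + (U - tt * V) * (U - tr * V) * (u2 - tr * v2))" by algebra
  with assms show ?thesis unfolding eta1_def eta2_def by (simp add: divide_simps)
qed

lemma eta_coeff_self:
  assumes "tr \<noteq> ts" "tr \<noteq> tt"
  shows "eta1 U V u2 v2 tr ts tt * (U - tr * V) + eta2 U V tr ts tt * (u2 - tr * v2)
     = - (v2 * U - u2 * V) * V"
  using assms unfolding eta1_def eta2_def by (simp add: divide_simps) (simp add: algebra_simps)

text \<open>This is \<open>ks * kt * (ts - tt)\<close> times the wedge product of
  \<open>\<alpha>\<close> and \<open>\<beta>\<close>, so transversality forces distinct parameters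
  and nonzero factors \<open>\<kappa>\<close>.\<close>

lemma pencil_wedge:
  assumes "pencil_jet \<omega>s p q U V u2 v2 ks ks' ts ts'" "pencil_jet \<omega>t p q U V u2 v2 kt kt' tt tt'"
  shows "wedge (\<omega>s (p, q)) (\<omega>t (p, q)) = q * ks * kt * (ts - tt) * (v2 * U - u2 * V)"
  using assms unfolding pencil_jet_def jet_def by (simp add: wedge_def algebra_simps)

text \<open>The 3 beside \<open>q * e2\<close> is the contribution of constant parameters: there
  \<open>d\<alpha> = 2 (dq / q) \<and> \<alpha>\<close>, likewise for \<open>\<beta>\<close>, and
  \<open>form_delta \<omega>s \<omega>t\<close> carries one more factor \<open>q\<close>. The
  logarithmic derivatives of the factors \<open>\<kappa>\<close> go into \<open>e1\<close>; what
  remains is linear in \<open>tr'\<close>, \<open>ts'\<close>, \<open>tt'\<close>.\<close>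

lemma pencil_eta_equation:
  assumes r: "pencil_jet \<omega>r p q U V u2 v2 kr kr' tr tr'"
    and s: "pencil_jet \<omega>s p q U V u2 v2 ks ks' ts ts'"
    and t: "pencil_jet \<omega>t p q U V u2 v2 kt kt' tt tt'"
    and nz: "kr \<noteq> 0" "ks \<noteq> 0" "kt \<noteq> 0" "q \<noteq> 0" "D \<noteq> 0"
    and dist: "tr \<noteq> ts" "ts \<noteq> tt" "tr \<noteq> tt"
    and D: "D = v2 * U - u2 * V"
    and e1: "D * e1 = D * (kr' / kr + ks' / ks + kt' / kt) +
        (tr' * eta1 U V u2 v2 tr ts tt + ts' * eta1 U V u2 v2 ts tt tr + tt' * eta1 U V u2 v2 tt tr ts)"
    and e2: "D * (q * e2 - 3) =
        tr' * eta2 U V tr ts tt + ts' * eta2 U V ts tt tr + tt' * eta2 U V tt tr ts"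
  shows "ext_d (scale_form (form_delta \<omega>s \<omega>t) \<omega>r) (p, q) =
     wedge (e1, e2) (scale_form (form_delta \<omega>s \<omega>t) \<omega>r (p, q))"
proof -
  \<comment> \<open>Up to the factor \<open>kr\<close>, the form \<open>\<omega>r\<close> is
    \<open>g dq - q y dp\<close>.\<close>
  define g where "g = U - tr * V"
  define y where "y = u2 - tr * v2"
  define l where "l = kr' / kr + ks' / ks + kt' / kt"
  define \<delta> where "\<delta> = ts - tt"
  have lk: "l * (kr * ks * kt) = kr' * ks * kt + kr * ks' * kt + kr * ks * kt'"
    unfolding l_def using nz by (simp add: field_simps)
  have "\<delta> * ((D * (e1 - l)) * g + (D * (q * e2 - 3)) * y)
    = tr' * \<delta> * (eta1 U V u2 v2 tr ts tt * g + eta2 U V tr ts tt * y)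
      + ts' * (\<delta> * (eta1 U V u2 v2 ts tt tr * g + eta2 U V ts tt tr * y))
      + tt' * (\<delta> * (eta1 U V u2 v2 tt tr ts * g + eta2 U V tt tr ts * y))"
    unfolding right_diff_distrib[of D e1] e1 e2 l_def by (simp add: algebra_simps)
  also have "\<dots> = tr' * \<delta> * (- D * V) + ts' * (D * g) - tt' * (D * g)"
  proof -
    have "eta1 U V u2 v2 tr ts tt * g + eta2 U V tr ts tt * y = - D * V"
      unfolding g_def y_def D using eta_coeff_self dist by blast
    moreover have "\<delta> * (eta1 U V u2 v2 ts tt tr * g + eta2 U V ts tt tr * y) = D * g"
      unfolding g_def y_def D \<delta>_def using eta_coeff_other dist by blast
    moreover have "\<delta> * (eta1 U V u2 v2 tt tr ts * g + eta2 U V tt tr ts * y) = - (D * g)"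
    proof -
      have "(tt - ts) * (eta1 U V u2 v2 tt ts tr * g + eta2 U V tt ts tr * y) = D * g"
        unfolding g_def y_def D using eta_coeff_other[of tr tt ts] dist by metis
      then show ?thesis unfolding \<delta>_def eta_coeff_sym(1)[of _ _ _ _ tt tr ts] eta_coeff_sym(2)[of _ _ tt tr ts]
        by (simp add: algebra_simps)
    qed
    ultimately show ?thesis by (simp add: mult.assoc)
  qed
  finally have "D * (\<delta> * ((e1 - l) * g + (q * e2 - 3) * y)) = D * ((ts' - tt') * g - \<delta> * tr' * V)"
    by (simp add: algebra_simps)
  then have main: "\<delta> * ((e1 - l) * g + (q * e2 - 3) * y) = (ts' - tt') * g - \<delta> * tr' * V"
    using nz by simp
  have w: "wedge (e1, e2) (scale_form (form_delta \<omega>s \<omega>t) \<omega>r (p, q)) =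
     q * ks * kt * \<delta> * D * kr * (e1 * g + q * e2 * y)"
  proof -
    have "wedge (e1, e2) (scale_form (form_delta \<omega>s \<omega>t) \<omega>r (p, q)) =
      wedge (\<omega>s (p, q)) (\<omega>t (p, q)) * wedge (e1, e2) (\<omega>r (p, q))"
      by (simp add: wedge_scale_form form_delta_def)
    also have "\<omega>r (p, q) = (- q * (kr * y), kr * g)"
      using r by (simp add: pencil_jet_def jet_def g_def y_def)
    finally show ?thesis unfolding pencil_wedge[OF s t] \<delta>_def D
      by (simp add: wedge_def algebra_simps)
  qed
  have x: "ext_d (scale_form (form_delta \<omega>s \<omega>t) \<omega>r) (p, q) =
    q * D * (\<delta> * (l * (kr * ks * kt)) * g + kr * ks * kt * ((ts' - tt') * g + \<delta> * (3 * y - tr' * V)))"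
    unfolding ext_d_scaled_jet[OF r[unfolded pencil_jet_def] s[unfolded pencil_jet_def] t[unfolded pencil_jet_def]] lk
      g_def y_def \<delta>_def D by algebra
  show ?thesis unfolding w x using main by algebra
qed

lemma pencil_eta:
  assumes r: "pencil_jet \<omega>r p q U V u2 v2 kr kr' tr tr'"
    and s: "pencil_jet \<omega>s p q U V u2 v2 ks ks' ts ts'"
    and t: "pencil_jet \<omega>t p q U V u2 v2 kt kt' tt tt'"
    and nz: "kr \<noteq> 0" "ks \<noteq> 0" "kt \<noteq> 0" "q \<noteq> 0" "D \<noteq> 0"
    and dist: "tr \<noteq> ts" "ts \<noteq> tt" "tr \<noteq> tt"
    and D: "D = v2 * U - u2 * V"
  shows "web_eta \<omega>r \<omega>s \<omega>t (p, q) =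
     (kr' / kr + ks' / ks + kt' / kt +
        (tr' * eta1 U V u2 v2 tr ts tt + ts' * eta1 U V u2 v2 ts tt tr + tt' * eta1 U V u2 v2 tt tr ts) / D,
      (3 + (tr' * eta2 U V tr ts tt + ts' * eta2 U V ts tt tr + tt' * eta2 U V tt tr ts) / D) / q)"
    (is "_ = (?e1, ?e2)")
proof (rule web_eta_eqI)
  have e1: "D * ?e1 = D * (kr' / kr + ks' / ks + kt' / kt) +
        (tr' * eta1 U V u2 v2 tr ts tt + ts' * eta1 U V u2 v2 ts tt tr + tt' * eta1 U V u2 v2 tt tr ts)"
  proof -
    have "D * (x + y / D) = D * x + y" for x y using nz by (simp add: field_simps)
    then show ?thesis .
  qed
  have e2: "D * (q * ?e2 - 3) =
        tr' * eta2 U V tr ts tt + ts' * eta2 U V ts tt tr + tt' * eta2 U V tt tr ts"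
    using nz by simp
  show "ext_d (scale_form (form_delta \<omega>s \<omega>t) \<omega>r) (p, q) =
     wedge (?e1, ?e2) (scale_form (form_delta \<omega>s \<omega>t) \<omega>r (p, q))"
    by (rule pencil_eta_equation[OF r s t nz dist D e1 e2])
  \<comment> \<open>The remaining two equations are the first one after a cyclic rotation of
    \<open>r\<close>, \<open>s\<close>, \<open>t\<close>.\<close>
  show "ext_d (scale_form (form_delta \<omega>t \<omega>r) \<omega>s) (p, q) =
     wedge (?e1, ?e2) (scale_form (form_delta \<omega>t \<omega>r) \<omega>s (p, q))"
    by (rule pencil_eta_equation[OF s t r nz(2,3,1,4,5) _ _ _ D]) (use dist e1 e2 in \<open>simp_all add: add_ac\<close>)
  show "ext_d (scale_form (form_delta \<omega>r \<omega>s) \<omega>t) (p, q) =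
     wedge (?e1, ?e2) (scale_form (form_delta \<omega>r \<omega>s) \<omega>t (p, q))"
    by (rule pencil_eta_equation[OF t r s nz(3,1,2,4,5) _ _ _ D]) (use dist e1 e2 in \<open>simp_all add: add_ac\<close>)
qed (use nz dist D pencil_wedge[OF r s] pencil_wedge[OF s t] pencil_wedge[OF t r] in auto)

text \<open>The line at infinity is dual to \<open>dp = 0\<close>, which lies in the pencil only
  with the variable parameter \<open>U / V\<close>, infinite where \<open>V\<close> vanishes; hence
  a separate computation. The branches are normalised so that their \<open>dq\<close>-coefficient is
  1 to first order, and then \<open>\<eta> = dq / q\<close> whatever the derivatives of the
  parameters are.\<close>

lemma pencil_eta_infinity:
  assumes r: "jet \<omega>r p q c 0 0 0 0 0"
    and s: "pencil_jet \<omega>s p q U V u2 v2 ks ks' ts ts'" "ks * (U - ts * V) = 1"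
      "ks' * (U - ts * V) + ks * (u2 - ts * v2 - ts' * V) = 0"
    and t: "pencil_jet \<omega>t p q U V u2 v2 kt kt' tt tt'" "kt * (U - tt * V) = 1"
      "kt' * (U - tt * V) + kt * (u2 - tt * v2 - tt' * V) = 0"
    and nz: "c \<noteq> 0" "q \<noteq> 0" "v2 * U - u2 * V \<noteq> 0" "ts \<noteq> tt" "ks \<noteq> 0" "kt \<noteq> 0"
  shows "web_eta \<omega>r \<omega>s \<omega>t (p, q) = (0, 1 / q)"
proof -
  define ys ys' yt yt' where "ys = ks * (u2 - ts * v2)" "ys' = ks' * (u2 - ts * v2) - ks * ts' * v2"
    "yt = kt * (u2 - tt * v2)" "yt' = kt' * (u2 - tt * v2) - kt * tt' * v2"
  have js: "jet \<omega>s p q (- q * ys) 1 (- q * ys') (- ys) 0 0"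
    using s unfolding pencil_jet_def ys_ys'_yt_yt'_def by (simp add: mult.assoc)
  have jt: "jet \<omega>t p q (- q * yt) 1 (- q * yt') (- yt) 0 0"
    using t unfolding pencil_jet_def ys_ys'_yt_yt'_def by (simp add: mult.assoc)
  have v: "\<omega>r (p, q) = (c, 0)" "\<omega>s (p, q) = (- q * ys, 1)" "\<omega>t (p, q) = (- q * yt, 1)"
    using r js jt by (simp_all add: jet_def)
  show ?thesis
  proof (rule web_eta_eqI)
    show "wedge (\<omega>s (p, q)) (\<omega>t (p, q)) \<noteq> 0" using pencil_wedge[OF s(1) t(1)] nz by simp
    show "wedge (\<omega>r (p, q)) (\<omega>s (p, q)) \<noteq> 0" "wedge (\<omega>t (p, q)) (\<omega>r (p, q)) \<noteq> 0"
      using nz by (simp_all add: v wedge_def)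
    show "ext_d (scale_form (form_delta \<omega>s \<omega>t) \<omega>r) (p, q) =
      wedge (0, 1 / q) (scale_form (form_delta \<omega>s \<omega>t) \<omega>r (p, q))"
      unfolding ext_d_scaled_jet[OF r js jt]
      using nz by (simp add: scale_form_def form_delta_def v wedge_def field_simps)
    show "ext_d (scale_form (form_delta \<omega>t \<omega>r) \<omega>s) (p, q) =
      wedge (0, 1 / q) (scale_form (form_delta \<omega>t \<omega>r) \<omega>s (p, q))"
      unfolding ext_d_scaled_jet[OF js jt r]
      using nz by (simp add: scale_form_def form_delta_def v wedge_def field_simps)
    show "ext_d (scale_form (form_delta \<omega>r \<omega>s) \<omega>t) (p, q) =
      wedge (0, 1 / q) (scale_form (form_delta \<omega>r \<omega>s) \<omega>t (p, q))"
      unfolding ext_d_scaled_jet[OF jt r js]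
      using nz by (simp add: scale_form_def form_delta_def v wedge_def field_simps)
  qed
qed

section \<open>Sums over roots of unity\<close>

lemma sum_pairs_off_diagonal:
  fixes f :: "nat \<Rightarrow> nat \<Rightarrow> 'a::comm_monoid_add"
  assumes "\<And>i. f i i = 0"
  shows "(\<Sum>s<N. \<Sum>r<s. f r s + f s r) = (\<Sum>i<N. \<Sum>j<N. f i j)"
proof (induction N)
  case (Suc N)
  have "(\<Sum>i<Suc N. \<Sum>j<Suc N. f i j) = (\<Sum>i<N. \<Sum>j<N. f i j) + (\<Sum>i<N. f i N) + (\<Sum>j<N. f N j)"
    by (simp add: sum.distrib assms add_ac)
  with Suc show ?case by (simp add: sum.distrib add_ac)
qed simp

lemma sum_pairs_product:
  fixes y :: "nat \<Rightarrow> 'a::comm_ring_1"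
  shows "2 * (\<Sum>s<N. \<Sum>r<s. y r * y s) = (\<Sum>s<N. y s)^2 - (\<Sum>s<N. (y s)^2)"
  by (induction N) (simp_all add: algebra_simps power2_eq_square sum_distrib_left sum_distrib_right)

text \<open>For a fixed index \<open>i\<close>, the unordered pairs of other indices contribute the
  second elementary symmetric function of the values \<open>x i j\<close>, which Newton's identity
  expresses by power sums; this accounts for the factor 2.\<close>

lemma sum_triples_product_aux:
  fixes w :: "nat \<Rightarrow> 'a::comm_ring_1"
  assumes x0: "\<And>i. x i i = 0"
  shows "2 * (\<Sum>t<N. \<Sum>s<t. \<Sum>r<s. w r * x r s * x r t + w s * x s r * x s t + w t * x t r * x t s)
    = (\<Sum>i<N. w i * ((\<Sum>j<N. x i j)^2 - (\<Sum>j<N. (x i j)^2)))"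
proof (induction N)
  case (Suc N)
  have "(\<Sum>i<Suc N. w i * ((\<Sum>j<Suc N. x i j)^2 - (\<Sum>j<Suc N. (x i j)^2)))
    = (\<Sum>i<N. w i * ((\<Sum>j<N. x i j)^2 - (\<Sum>j<N. (x i j)^2)))
      + 2 * (\<Sum>i<N. w i * x i N * (\<Sum>j<N. x i j)) + w N * ((\<Sum>j<N. x N j)^2 - (\<Sum>j<N. (x N j)^2))"
  proof -
    have "w i * ((\<Sum>j<Suc N. x i j)^2 - (\<Sum>j<Suc N. (x i j)^2)) =
      w i * ((\<Sum>j<N. x i j)^2 - (\<Sum>j<N. (x i j)^2)) + 2 * (w i * x i N * (\<Sum>j<N. x i j))" for i
      by (simp add: algebra_simps power2_eq_square)
    then show ?thesis by (simp add: sum.distrib sum_distrib_left x0)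
  qed
  moreover have "(\<Sum>s<N. \<Sum>r<s. w r * x r s * x r N + w s * x s r * x s N) = (\<Sum>i<N. w i * x i N * (\<Sum>j<N. x i j))"
    using sum_pairs_off_diagonal[where f = "\<lambda>i j. w i * x i j * x i N" and N = N] x0
    by (simp add: sum_distrib_left mult_ac)
  moreover have "2 * (\<Sum>s<N. \<Sum>r<s. w N * x N r * x N s) = w N * ((\<Sum>j<N. x N j)^2 - (\<Sum>j<N. (x N j)^2))"
    using arg_cong[OF sum_pairs_product[where y = "x N" and N = N], of "\<lambda>a. w N * a"]
    by (simp add: sum_distrib_left mult_ac)
  moreover have "(\<Sum>t<Suc N. \<Sum>s<t. \<Sum>r<s. w r * x r s * x r t + w s * x s r * x s t + w t * x t r * x t s)
    = (\<Sum>t<N. \<Sum>s<t. \<Sum>r<s. w r * x r s * x r t + w s * x s r * x s t + w t * x t r * x t s)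
      + ((\<Sum>s<N. \<Sum>r<s. w r * x r s * x r N + w s * x s r * x s N) + (\<Sum>s<N. \<Sum>r<s. w N * x N r * x N s))"
    by (simp add: sum.distrib)
  ultimately show ?case using Suc by (simp only: distrib_left) (simp add: add_ac)
qed simp

lemma sum_triples_product:
  fixes w :: "nat \<Rightarrow> 'a::comm_ring_1"
  shows "2 * (\<Sum>t<N. \<Sum>s<t. \<Sum>r<s. w r * x r s * x r t + w s * x s r * x s t + w t * x t r * x t s)
    = (\<Sum>i<N. w i * ((\<Sum>j\<in>{..<N} - {i}. x i j)^2 - (\<Sum>j\<in>{..<N} - {i}. (x i j)^2)))"
proof -
  define x' where "x' i j = (if i = j then 0 else x i j)" for i j
  have "(\<Sum>j<N. x' i j) = (\<Sum>j\<in>{..<N} - {i}. x i j)" "(\<Sum>j<N. (x' i j)^2) = (\<Sum>j\<in>{..<N} - {i}. (x i j)^2)" for i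
    unfolding x'_def by (auto intro!: sum.mono_neutral_cong_right split: if_splits)
  then have "(\<Sum>i<N. w i * ((\<Sum>j\<in>{..<N} - {i}. x i j)^2 - (\<Sum>j\<in>{..<N} - {i}. (x i j)^2)))
    = 2 * (\<Sum>t<N. \<Sum>s<t. \<Sum>r<s. w r * x' r s * x' r t + w s * x' s r * x' s t + w t * x' t r * x' t s)"
    using sum_triples_product_aux[where x = x' and w = w and N = N] by (simp add: x'_def)
  also have "(\<Sum>t<N. \<Sum>s<t. \<Sum>r<s. w r * x' r s * x' r t + w s * x' s r * x' s t + w t * x' t r * x' t s)
    = (\<Sum>t<N. \<Sum>s<t. \<Sum>r<s. w r * x r s * x r t + w s * x s r * x s t + w t * x t r * x t s)"
    by (intro sum.cong) (auto simp: x'_def)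
  finally show ?thesis ..
qed

section \<open>Products of linear factors and their derivatives\<close>

lemma pderiv_linear_mult: "pderiv ([:- z, 1:] * Q) = Q + [:- z, 1:] * pderiv Q" for Q :: "'a::field poly"
  unfolding pderiv_mult by (simp add: pderiv_pCons)

lemma pderiv2_linear_mult: "pderiv (pderiv ([:- z, 1:] * Q)) = 2 * pderiv Q + [:- z, 1:] * pderiv (pderiv Q)"
  for Q :: "'a::field poly"
  unfolding pderiv_linear_mult pderiv_add by (simp only: pderiv_linear_mult mult_2 add_ac)

lemma pderiv3_linear_mult: "pderiv (pderiv (pderiv ([:- z, 1:] * Q)))
    = 3 * pderiv (pderiv Q) + [:- z, 1:] * pderiv (pderiv (pderiv Q))"
  for Q :: "'a::field poly"
  unfolding pderiv2_linear_mult pderiv_add mult_2 pderiv_linear_mult by algebra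

text \<open>The logarithmic derivative of \<open>P\<close> is the sum of the
  \<open>1 / (c - z)\<close>, and \<open>P'' / P\<close> is its square plus its derivative.\<close>

lemma pderiv_prod_linear:
  fixes S :: "'a::field set"
  assumes "finite S" "c \<notin> S"
  defines "P \<equiv> \<Prod>z\<in>S. [:- z, 1:]"
  shows "poly (pderiv P) c = poly P c * (\<Sum>z\<in>S. 1 / (c - z))"
    and "poly (pderiv (pderiv P)) c = poly P c * ((\<Sum>z\<in>S. 1 / (c - z))^2 - (\<Sum>z\<in>S. (1 / (c - z))^2))"
proof -
  have "poly (pderiv (\<Prod>z\<in>S. [:- z, 1:])) c = poly (\<Prod>z\<in>S. [:- z, 1:]) c * (\<Sum>z\<in>S. 1 / (c - z)) \<and>
    poly (pderiv (pderiv (\<Prod>z\<in>S. [:- z, 1:]))) c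
      = poly (\<Prod>z\<in>S. [:- z, 1:]) c * ((\<Sum>z\<in>S. 1 / (c - z))^2 - (\<Sum>z\<in>S. (1 / (c - z))^2))"
    using assms(1,2)
  proof (induction S)
    case (insert z S)
    define Q where "Q = (\<Prod>z\<in>S. [:- z, 1:])"
    define A where "A = (\<Sum>z\<in>S. 1 / (c - z))"
    define B where "B = (\<Sum>z\<in>S. (1 / (c - z))^2)"
    have IH: "poly (pderiv Q) c = poly Q c * A" "poly (pderiv (pderiv Q)) c = poly Q c * (A^2 - B)"
      using insert unfolding Q_def A_def B_def by auto
    have e: "(\<Prod>z\<in>insert z S. [:- z, 1:]) = [:- z, 1:] * Q"
      "(\<Sum>z\<in>insert z S. 1 / (c - z)) = 1 / (c - z) + A"
      "(\<Sum>z\<in>insert z S. (1 / (c - z))^2) = (1 / (c - z))^2 + B"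
      using insert unfolding Q_def A_def B_def by simp_all
    have "c - z \<noteq> 0" using insert by auto
    then have r: "(c - z) * (1 / (c - z)) = 1" by simp
    have "poly (pderiv ([:- z, 1:] * Q)) c = poly Q c + (c - z) * (poly Q c * A)"
      unfolding pderiv_linear_mult poly_add poly_mult IH by simp
    moreover have "poly (pderiv (pderiv ([:- z, 1:] * Q))) c
      = 2 * (poly Q c * A) + (c - z) * (poly Q c * (A^2 - B))"
      unfolding pderiv2_linear_mult poly_add poly_mult IH by simp
    moreover have "poly ([:- z, 1:] * Q) c = (c - z) * poly Q c" unfolding poly_mult by simp
    ultimately show ?case unfolding e using r by algebra
  qed (simp add: pderiv_1)
  then show "poly (pderiv P) c = poly P c * (\<Sum>z\<in>S. 1 / (c - z))"
    "poly (pderiv (pderiv P)) c = poly P c * ((\<Sum>z\<in>S. 1 / (c - z))^2 - (\<Sum>z\<in>S. (1 / (c - z))^2))"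
    unfolding P_def by auto
qed

text \<open>Both sides are monic of degree \<open>n\<close>, so their difference has degree below
  \<open>n\<close>; it vanishes at \<open>n\<close> distinct points.\<close>

lemma nth_roots_factorization:
  fixes R :: complex
  assumes "n > 0" "R \<noteq> 0"
  shows "monom 1 n - [:R:] = (\<Prod>z\<in>{z. z ^ n = R}. [:- z, 1:])"
proof -
  define P where "P = (\<Prod>z\<in>{z::complex. z ^ n = R}. [:- z, 1:])"
  have fin: "finite {z. z ^ n = R}" using assms by (rule_tac finite_nth_roots) auto
  have card: "card {z. z ^ n = R} = n" using assms by (simp add: card_nth_roots)
  have dP: "degree P = n" "lead_coeff P = 1"
    using card by (simp add: P_def degree_prod_sum_eq) (simp add: P_def lead_coeff_prod del: coeff_pCons)
  define M where "M = monom 1 n - [:R:] - P"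
  have "M = 0"
  proof (rule ccontr)
    assume M: "M \<noteq> 0"
    have "degree (monom 1 n - [:R:]) \<le> n"
      by (intro degree_diff_le) (auto simp: degree_monom_le)
    then have "degree M \<le> n" unfolding M_def using dP by (rule_tac degree_diff_le) auto
    moreover have "coeff M n = 0" unfolding M_def using dP assms by (simp add: coeff_pCons split: nat.split)
    ultimately have "degree M < n" using M by (metis coeff_0_degree_minus_1 le_neq_implies_less leading_coeff_0_iff)
    moreover have "card {z. poly M z = 0} \<le> degree M" using M by (rule card_poly_roots_bound)
    moreover have "{z. z ^ n = R} \<subseteq> {z. poly M z = 0}"
      unfolding M_def P_def using fin by (auto simp: poly_monom poly_prod)
    then have "n \<le> card {z. poly M z = 0}"
      using card card_mono[OF poly_roots_finite[OF M]] by metis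
    ultimately show False by simp
  qed
  then show ?thesis unfolding M_def P_def by simp
qed

lemma nth_roots_sum_inverse_diff:
  fixes R :: complex
  assumes "n > 0" "R \<noteq> 0" "c ^ n \<noteq> R"
  shows "(\<Sum>z | z ^ n = R. 1 / (c - z)) = of_nat n * c ^ (n - 1) / (c ^ n - R)"
proof -
  have "finite {z. z ^ n = R}" using assms by (rule_tac finite_nth_roots) auto
  from pderiv_prod_linear(1)[OF this, of c] assms
  have "poly (pderiv (monom 1 n - [:R:])) c = poly (monom 1 n - [:R:]) c * (\<Sum>z | z ^ n = R. 1 / (c - z))"
    unfolding nth_roots_factorization[OF assms(1,2)] by simp
  then show ?thesis using assms(3)
    by (simp add: pderiv_diff pderiv_monom poly_monom pderiv_pCons field_simps)
qed

text \<open>With \<open>P\<close> the product over the other roots, differentiating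
  \<open>z^n - R = (z - c) P\<close> once, twice and three times at \<open>c\<close> yields
  \<open>P\<close>, \<open>2 P'\<close> and \<open>3 P''\<close> there. The quotients
  \<open>P' / P\<close> and \<open>P'' / P\<close> are the two sums.\<close>

lemma nth_roots_sum_inverse_diff_root:
  fixes R :: complex
  assumes n: "n > 0" and R: "R \<noteq> 0" "c ^ n = R"
  shows "(\<Sum>z\<in>{z. z ^ n = R} - {c}. 1 / (c - z)) = (of_nat n - 1) / (2 * c)" (is "?A = _")
    and "(\<Sum>z\<in>{z. z ^ n = R} - {c}. 1 / (c - z))^2 - (\<Sum>z\<in>{z. z ^ n = R} - {c}. (1 / (c - z))^2)
      = (of_nat n - 1) * (of_nat n - 2) / (3 * c^2)" (is "?B = _")
proof -
  define P where "P = (\<Prod>z\<in>{z. z ^ n = R} - {c}. [:- z, 1:])"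
  have fin: "finite {z. z ^ n = R}" using assms by (rule_tac finite_nth_roots) auto
  have c0: "c \<noteq> 0" using assms by auto
  have f: "monom 1 n - [:R:] = [:- c, 1:] * P"
    unfolding nth_roots_factorization[OF n R(1)] P_def using fin R by (simp add: prod.remove)
  have P: "poly (pderiv P) c = poly P c * ?A" "poly (pderiv (pderiv P)) c = poly P c * ?B"
    unfolding P_def using pderiv_prod_linear[of "{z. z ^ n = R} - {c}" c] fin by auto
  have 1: "of_nat n * c ^ (n - 1) = poly P c"
    using arg_cong[OF f, of "\<lambda>p. poly (pderiv p) c"] R
    unfolding pderiv_linear_mult by (simp add: pderiv_diff pderiv_monom poly_monom pderiv_pCons)
  have 2: "of_nat n * of_nat (n - 1) * c ^ (n - 1 - 1) = 2 * (poly P c * ?A)"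
    using arg_cong[OF f, of "\<lambda>p. poly (pderiv (pderiv p)) c"] R
    unfolding P(1)[symmetric] pderiv2_linear_mult
    by (simp add: mult_ac pderiv_diff pderiv_monom poly_monom pderiv_pCons)
  have 3: "of_nat n * of_nat (n - 1) * of_nat (n - 1 - 1) * c ^ (n - 1 - 1 - 1) = 3 * (poly P c * ?B)"
    using arg_cong[OF f, of "\<lambda>p. poly (pderiv (pderiv (pderiv p))) c"] R
    unfolding P(2)[symmetric] pderiv3_linear_mult
    by (simp add: mult_ac pderiv_diff pderiv_monom poly_monom pderiv_pCons)
  have n0: "of_nat n \<noteq> (0::complex)" using n by simp
  show "?A = (of_nat n - 1) / (2 * c)"
  \<comment> \<open>For \<open>n = 1\<close>, and for \<open>n = 2\<close> in the second claim, the
    monomial derivatives vanish and the exponents are truncated; both sides are then zero.\<close>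
  proof (cases "n = 1")
    case True
    then show ?thesis using 1 2 by simp
  next
    case False
    then obtain k where k: "n = Suc (Suc k)" using n by (metis One_nat_def gr0_implies_Suc not0_implies_Suc)
    have "of_nat n * c ^ k * (of_nat n - 1) = of_nat n * c ^ k * (2 * c * ?A)"
      using 2 unfolding 1[symmetric] by (simp add: k mult_ac)
    then have "of_nat n - 1 = 2 * c * ?A" using n0 c0 by (simp only: mult_cancel_left) simp
    then show ?thesis using c0 by (simp add: field_simps)
  qed
  show "?B = (of_nat n - 1) * (of_nat n - 2) / (3 * c^2)"
  proof (cases "n = 1 \<or> n = 2")
    case True
    then show ?thesis using 1 3 c0 by auto
  next
    case False
    then obtain k where k: "n = Suc (Suc (Suc k))" using n
      by (metis One_nat_def numeral_2_eq_2 gr0_implies_Suc not0_implies_Suc)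
    have "of_nat n * c ^ k * ((of_nat n - 1) * (of_nat n - 2)) = of_nat n * c ^ k * (3 * c^2 * ?B)"
      using 3 unfolding 1[symmetric] by (simp add: k power2_eq_square mult_ac)
    then have "(of_nat n - 1) * (of_nat n - 2) = 3 * c^2 * ?B" using n0 c0 by (simp only: mult_cancel_left) simp
    then show ?thesis using c0 by (simp add: field_simps)
  qed
qed

text \<open>Inversion carries the roots of \<open>R\<close> to those of \<open>1 / R\<close>, whose
  sum vanishes.\<close>

lemma nth_roots_sum_inverse:
  fixes R :: complex
  assumes "n \<ge> 2" "R \<noteq> 0"
  shows "(\<Sum>z | z ^ n = R. 1 / z) = 0"
proof -
  have "(\<Sum>z | z ^ n = R. 1 / z) = \<Sum>{z. z ^ n = 1 / R}"
    using assms by (intro sum.reindex_bij_witness[of _ "\<lambda>z. 1 / z" "\<lambda>z. 1 / z"])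
      (auto simp: power_one_over)
  also have "\<dots> = 0" using assms by (intro sum_nth_roots) auto
  finally show ?thesis .
qed

lemma nth_roots_enumeration:
  fixes T :: "nat \<Rightarrow> complex"
  assumes "n > 0" "R \<noteq> 0" "\<And>i. i \<in> {1..n} \<Longrightarrow> T i ^ n = R" "inj_on T {1..n}"
  shows "T ` {1..n} = {z. z ^ n = R}"
proof (rule card_subset_eq)
  show "finite {z. z ^ n = R}" using assms by (rule_tac finite_nth_roots) auto
  show "T ` {1..n} \<subseteq> {z. z ^ n = R}" using assms by auto
  show "card (T ` {1..n}) = card {z. z ^ n = R}"
    using assms by (simp add: card_image card_nth_roots)
qed

text \<open>Since \<open>x j = V + (U - T i * V) / (T i - T j)\<close>, only the sums of the inverse
  differences and of their squares are involved.\<close>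

lemma branch_sum:
  fixes T :: "nat \<Rightarrow> complex" and U V :: complex
  assumes n: "n \<ge> 2" and R: "R \<noteq> 0" and T: "\<And>i. i \<in> {1..n} \<Longrightarrow> T i ^ n = R" and inj: "inj_on T {1..n}"
    and i: "i \<in> {1..n}"
  defines "x \<equiv> \<lambda>j. (U - T j * V) / (T i - T j)"
  shows "(\<Sum>j\<in>{1..n} - {i}. x j) = (of_nat n - 1) / 2 * (V + U / T i)"
    and "(\<Sum>j\<in>{1..n} - {i}. x j)^2 - (\<Sum>j\<in>{1..n} - {i}. (x j)^2)
      = (of_nat n - 1) * (of_nat n - 2) / 3 * (V^2 + U * V / T i + U^2 / (T i)^2)"
proof -
  have n0: "n > 0" using n by simp
  define S where "S = {z. z ^ n = R} - {T i}"
  have S: "S = T ` ({1..n} - {i})"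
  proof -
    have "T ` {1..n} = {z. z ^ n = R}" by (rule nth_roots_enumeration[OF n0 R T inj])
    then show ?thesis unfolding S_def using inj_on_image_set_diff[OF inj, of "{1..n}" "{i}"] i by simp
  qed
  have re: "(\<Sum>j\<in>{1..n} - {i}. f (T j)) = (\<Sum>z\<in>S. f z)" for f :: "complex \<Rightarrow> complex"
    unfolding S using sum.reindex[OF inj_on_subset[OF inj], of "{1..n} - {i}" f] by auto
  have t: "T i ^ n = R" using T i by blast
  have t0: "T i \<noteq> 0" using t R n by auto
  define A B where "A = (\<Sum>z\<in>S. 1 / (T i - z))" and "B = (\<Sum>z\<in>S. (1 / (T i - z))^2)"
  note root = nth_roots_sum_inverse_diff_root[OF n0 R t, folded S_def, folded A_def B_def]
  have cS: "of_nat (card S) = (of_nat n - 1 :: complex)"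
  proof -
    have "card S = card ({1..n} - {i})" unfolding S using inj by (intro card_image) (auto intro: inj_on_subset)
    also have "\<dots> = n - 1" using i by simp
    finally show ?thesis using n by (simp only: of_nat_diff) simp
  qed
  define c where "c = U - T i * V"
  have xe: "x j = V + c * (1 / (T i - T j))" if "j \<in> {1..n} - {i}" for j
  proof -
    have "T i - T j \<noteq> 0" using that i inj_onD[OF inj, of i j] by auto
    then show ?thesis unfolding x_def c_def by (simp add: field_simps)
  qed
  have s1: "(\<Sum>j\<in>{1..n} - {i}. x j) = (of_nat n - 1) * V + c * A"
  proof -
    have "(\<Sum>j\<in>{1..n} - {i}. x j) = (\<Sum>j\<in>{1..n} - {i}. V + c * (1 / (T i - T j)))"
      using xe by (intro sum.cong) auto
    also have "\<dots> = (\<Sum>z\<in>S. V + c * (1 / (T i - z)))" by (rule re)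
    finally show ?thesis unfolding sum.distrib sum_distrib_left[symmetric] A_def by (simp add: cS)
  qed
  have s2: "(\<Sum>j\<in>{1..n} - {i}. (x j)^2) = (of_nat n - 1) * V^2 + 2 * V * c * A + c^2 * B"
  proof -
    have "(\<Sum>j\<in>{1..n} - {i}. (x j)^2) = (\<Sum>j\<in>{1..n} - {i}. V^2 + 2 * V * c * (1 / (T i - T j)) + c^2 * (1 / (T i - T j))^2)"
      using xe by (intro sum.cong) (auto simp: power2_eq_square algebra_simps)
    also have "\<dots> = (\<Sum>z\<in>S. V^2 + 2 * V * c * (1 / (T i - z)) + c^2 * (1 / (T i - z))^2)" by (rule re)
    finally show ?thesis unfolding sum.distrib sum_distrib_left[symmetric] A_def B_def by (simp add: cS)
  qed
  show "(\<Sum>j\<in>{1..n} - {i}. x j) = (of_nat n - 1) / 2 * (V + U / T i)"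
    unfolding s1 root(1) c_def using t0 by (simp add: field_simps)
  have "(\<Sum>j\<in>{1..n} - {i}. x j)^2 - (\<Sum>j\<in>{1..n} - {i}. (x j)^2)
    = (of_nat n - 1) * (of_nat n - 2) * V^2 + 2 * (of_nat n - 2) * V * c * A + c^2 * (A^2 - B)"
    unfolding s1 s2 by (simp add: power2_eq_square algebra_simps)
  also have "\<dots> = (of_nat n - 1) * (of_nat n - 2) * (V^2 + V * c / T i + c^2 / (3 * (T i)^2))"
    unfolding root(2) unfolding root(1) using t0 by (simp add: field_simps power2_eq_square)
  also have "\<dots> = (of_nat n - 1) * (of_nat n - 2) / 3 * (V^2 + U * V / T i + U^2 / (T i)^2)"
    unfolding c_def using t0 by (simp add: field_simps power2_eq_square)
  finally show "(\<Sum>j\<in>{1..n} - {i}. x j)^2 - (\<Sum>j\<in>{1..n} - {i}. (x j)^2)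
      = (of_nat n - 1) * (of_nat n - 2) / 3 * (V^2 + U * V / T i + U^2 / (T i)^2)" .
qed

text \<open>Index 0 is the line and has weight 0 because its parameter is constant. The weight
  \<open>L * T i\<close> is the derivative of a branch parameter: all \<open>n\<close>-th roots of
  \<open>R\<close> share one logarithmic derivative \<open>L\<close>. The sums of the
  \<open>T i\<close> and of their inverses vanish, which leaves the \<open>U V\<close> term and the
  interaction \<open>x i 0\<close> with the line.\<close>

lemma branch_triple_sum:
  fixes T :: "nat \<Rightarrow> complex"
  assumes n: "n \<ge> 2" and R: "R \<noteq> 0" and T: "\<And>i. i \<in> {1..n} \<Longrightarrow> T i ^ n = R" and inj: "inj_on T {1..n}"
    and w: "w 0 = 0" "\<And>i. i \<in> {1..n} \<Longrightarrow> w i = L * T i"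
    and x: "\<And>i j. i \<in> {1..n} \<Longrightarrow> j \<in> {1..n} \<Longrightarrow> i \<noteq> j \<Longrightarrow> x i j = (U - T j * V) / (T i - T j)"
  shows "2 * (\<Sum>t<n + 1. \<Sum>s<t. \<Sum>r<s. w r * x r s * x r t + w s * x s r * x s t + w t * x t r * x t s)
    = L * (of_nat n - 1) * (of_nat n * (of_nat n - 2) / 3 * U * V + (\<Sum>i\<in>{1..n}. (V * T i + U) * x i 0))"
proof -
  have n0: "n > 0" using n by simp
  have t0: "T i \<noteq> 0" if "i \<in> {1..n}" for i using T[OF that] R n by auto
  have re: "(\<Sum>i\<in>{1..n}. f (T i)) = (\<Sum>z | z ^ n = R. f z)" for f :: "complex \<Rightarrow> complex"
  proof -
    have im: "T ` {1..n} = {z. z ^ n = R}" by (rule nth_roots_enumeration[OF n0 R T inj])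
    show ?thesis using sum.reindex[OF inj, of f] unfolding im by simp
  qed
  have ins: "{..<n + 1} = insert 0 {1..n}" by auto
  have summand: "w i * ((\<Sum>j\<in>{..<n + 1} - {i}. x i j)^2 - (\<Sum>j\<in>{..<n + 1} - {i}. (x i j)^2))
    = L * (of_nat n - 1) * ((of_nat n - 2) / 3 * (V^2 * T i + U * V + U^2 * (1 / T i)) + (V * T i + U) * x i 0)"
    if i: "i \<in> {1..n}" for i
  proof -
    define E F where "E = (\<Sum>j\<in>{1..n} - {i}. x i j)" and "F = (\<Sum>j\<in>{1..n} - {i}. (x i j)^2)"
    have e: "{..<n + 1} - {i} = insert 0 ({1..n} - {i})" using i by auto
    have E: "E = (of_nat n - 1) / 2 * (V + U / T i)"
    proof -
      have "E = (\<Sum>j\<in>{1..n} - {i}. (U - T j * V) / (T i - T j))"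
        unfolding E_def using x i by (intro sum.cong) auto
      also have "\<dots> = (of_nat n - 1) / 2 * (V + U / T i)" by (rule branch_sum(1)[OF n R T inj i])
      finally show ?thesis .
    qed
    have EF: "E^2 - F = (of_nat n - 1) * (of_nat n - 2) / 3 * (V^2 + U * V / T i + U^2 / (T i)^2)"
    proof -
      have "E = (\<Sum>j\<in>{1..n} - {i}. (U - T j * V) / (T i - T j))"
        unfolding E_def using x i by (intro sum.cong) auto
      moreover have "F = (\<Sum>j\<in>{1..n} - {i}. ((U - T j * V) / (T i - T j))^2)"
        unfolding F_def using x i by (intro sum.cong) auto
      moreover have "(\<Sum>j\<in>{1..n} - {i}. (U - T j * V) / (T i - T j))^2
        - (\<Sum>j\<in>{1..n} - {i}. ((U - T j * V) / (T i - T j))^2)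
        = (of_nat n - 1) * (of_nat n - 2) / 3 * (V^2 + U * V / T i + U^2 / (T i)^2)"
        by (rule branch_sum(2)[OF n R T inj i])
      ultimately show ?thesis by simp
    qed
    have "(\<Sum>j\<in>{..<n + 1} - {i}. x i j) = x i 0 + E" "(\<Sum>j\<in>{..<n + 1} - {i}. (x i j)^2) = (x i 0)^2 + F"
      unfolding e E_def F_def by simp_all
    then have "w i * ((\<Sum>j\<in>{..<n + 1} - {i}. x i j)^2 - (\<Sum>j\<in>{..<n + 1} - {i}. (x i j)^2))
      = L * T i * ((E^2 - F) + 2 * E * x i 0)"
      using w(2)[OF i] by (simp add: power2_eq_square algebra_simps)
    also have "\<dots> = L * (of_nat n - 1) * ((of_nat n - 2) / 3 * (V^2 * T i + U * V + U^2 * (1 / T i)) + (V * T i + U) * x i 0)"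
      unfolding EF unfolding E using t0[OF i] by (simp add: field_simps power2_eq_square)
    finally show ?thesis .
  qed
  have "2 * (\<Sum>t<n + 1. \<Sum>s<t. \<Sum>r<s. w r * x r s * x r t + w s * x s r * x s t + w t * x t r * x t s)
    = (\<Sum>i<n + 1. w i * ((\<Sum>j\<in>{..<n + 1} - {i}. x i j)^2 - (\<Sum>j\<in>{..<n + 1} - {i}. (x i j)^2)))"
    by (rule sum_triples_product)
  also have "\<dots> = (\<Sum>i\<in>{1..n}. w i * ((\<Sum>j\<in>{..<n + 1} - {i}. x i j)^2 - (\<Sum>j\<in>{..<n + 1} - {i}. (x i j)^2)))"
    unfolding ins by (subst sum.insert) (auto simp: w)
  also have "\<dots> = (\<Sum>i\<in>{1..n}. L * (of_nat n - 1) * ((of_nat n - 2) / 3 * (V^2 * T i + U * V + U^2 * (1 / T i)) + (V * T i + U) * x i 0))"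
    using summand by (intro sum.cong) auto
  also have "\<dots> = L * (of_nat n - 1) * ((of_nat n - 2) / 3 * (V^2 * (\<Sum>i\<in>{1..n}. T i) + of_nat n * (U * V) + U^2 * (\<Sum>i\<in>{1..n}. 1 / T i))
      + (\<Sum>i\<in>{1..n}. (V * T i + U) * x i 0))"
    by (simp only: sum_distrib_left[symmetric] sum.distrib) simp
  also have "(\<Sum>i\<in>{1..n}. T i) = 0" using re[of "\<lambda>z. z"] sum_nth_roots[of n R] n by simp
  also have "(\<Sum>i\<in>{1..n}. 1 / T i) = 0" using re[of "\<lambda>z. 1 / z"] nth_roots_sum_inverse[OF n R] by simp
  finally show ?thesis by (simp add: mult_ac)
qed

text \<open>The interaction of the branches with a line of constant parameter 1 (the line
  \<open>x = y\<close>) or 0 (the line \<open>x = 0\<close>). In the first case division by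
  \<open>T i - 1\<close> leaves the sum of the \<open>1 / (1 - T i)\<close>, in the second the
  vanishing sum of inverses.\<close>

lemma branch_line_sum:
  fixes T :: "nat \<Rightarrow> complex"
  assumes n: "n \<ge> 2" and R: "R \<noteq> 0" and T: "\<And>i. i \<in> {1..n} \<Longrightarrow> T i ^ n = R" and inj: "inj_on T {1..n}"
  shows "R \<noteq> 1 \<Longrightarrow> (\<Sum>i\<in>{1..n}. (V * T i + U) / (T i - 1)) = - of_nat n * (U + R * V) / (1 - R)"
    and "(\<Sum>i\<in>{1..n}. (V * T i + U) / T i) = of_nat n * V"
proof -
  have n0: "n > 0" using n by simp
  have re: "(\<Sum>i\<in>{1..n}. f (T i)) = (\<Sum>z | z ^ n = R. f z)" for f :: "complex \<Rightarrow> complex"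
  proof -
    have im: "T ` {1..n} = {z. z ^ n = R}" by (rule nth_roots_enumeration[OF n0 R T inj])
    show ?thesis using sum.reindex[OF inj, of f] unfolding im by simp
  qed
  have t0: "T i \<noteq> 0" if "i \<in> {1..n}" for i using T[OF that] R n by auto
  show "(\<Sum>i\<in>{1..n}. (V * T i + U) / (T i - 1)) = - of_nat n * (U + R * V) / (1 - R)" if R1: "R \<noteq> 1"
  proof -
    have t1: "T i \<noteq> 1" if "i \<in> {1..n}" for i using T[OF that] R1 by auto
    have "(\<Sum>i\<in>{1..n}. (V * T i + U) / (T i - 1)) = (\<Sum>i\<in>{1..n}. V - (U + V) * (1 / (1 - T i)))"
      using t1 by (intro sum.cong) (auto simp: field_simps)
    also have "\<dots> = of_nat n * V - (U + V) * (\<Sum>i\<in>{1..n}. 1 / (1 - T i))"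
      by (simp only: sum_subtractf sum_distrib_left[symmetric]) simp
    also have "(\<Sum>i\<in>{1..n}. 1 / (1 - T i)) = of_nat n / (1 - R)"
      using re[of "\<lambda>z. 1 / (1 - z)"] nth_roots_sum_inverse_diff[OF n0 R, of 1] R1 by simp
    also have "of_nat n * V - (U + V) * (of_nat n / (1 - R)) = - of_nat n * (U + R * V) / (1 - R)"
      using R1 by (simp add: field_simps)
    finally show ?thesis .
  qed
  have "(\<Sum>i\<in>{1..n}. (V * T i + U) / T i) = (\<Sum>i\<in>{1..n}. V + U * (1 / T i))"
    using t0 by (intro sum.cong) (auto simp: field_simps)
  also have "\<dots> = of_nat n * V + U * (\<Sum>i\<in>{1..n}. 1 / T i)"
    by (simp only: sum.distrib sum_distrib_left[symmetric]) simp
  also have "(\<Sum>i\<in>{1..n}. 1 / T i) = 0" using re[of "\<lambda>z. 1 / z"] nth_roots_sum_inverse[OF n R] by simp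
  finally show "(\<Sum>i\<in>{1..n}. (V * T i + U) / T i) = of_nat n * V" by simp
qed

section \<open>Branches of the Legendre web\<close>

text \<open>The foliation is \<open>u\<^sup>n \<phi> + v\<^sup>n \<psi>\<close> with linear forms \<open>u, v\<close> and constant 1-forms \<open>\<phi> = c du + d dv\<close>,
  \<open>\<psi> = a du + b dv\<close>.  On the line dual to \<open>(p, q)\<close> the forms \<open>u, v, \<phi>, \<psi>\<close> have slopes \<open>U, V, Q1, Q2\<close>, and the
  branches of the Legendre web are the solutions of \<open>(u / v)\<^sup>n = R = - Q2 / Q1\<close>.\<close>

locale bipower_form =
  fixes n :: nat and P :: prefoliation and u1 u2 v1 v2 a b c d :: complex
  assumes n: "n \<ge> 2" and D: "u1 * v2 - u2 * v1 \<noteq> 0" and \<Delta>: "a * d - b * c \<noteq> 0"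
    and affA: "\<And>x y. affA P x y = (c * u1 + d * v1) * (u1 * x + u2 * y) ^ n + (a * u1 + b * v1) * (v1 * x + v2 * y) ^ n"
    and affB: "\<And>x y. affB P x y = (c * u2 + d * v2) * (u1 * x + u2 * y) ^ n + (a * u2 + b * v2) * (v1 * x + v2 * y) ^ n"
begin

definition U where "U p = u1 + p * u2"
definition V where "V p = v1 + p * v2"
definition Q1 where "Q1 p = c * U p + d * V p"
definition Q2 where "Q2 p = a * U p + b * V p"

lemma U_deriv: "(U has_field_derivative u2) (at p)"
  and V_deriv: "(V has_field_derivative v2) (at p)"
  unfolding U_def V_def by (auto intro!: derivative_eq_intros)

lemma UV_det: "v2 * U p - u2 * V p = u1 * v2 - u2 * v1"
  unfolding U_def V_def by algebra

lemma UV_det_nz: "v2 * U p - u2 * V p \<noteq> 0"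
  unfolding UV_det by (rule D)

lemma leg_equation: "affA P x (p * x - q) + p * affB P x (p * x - q)
    = Q1 p * (U p * x - u2 * q) ^ n + Q2 p * (V p * x - v2 * q) ^ n"
proof -
  have "u1 * x + u2 * (p * x - q) = U p * x - u2 * q" "v1 * x + v2 * (p * x - q) = V p * x - v2 * q"
    unfolding U_def V_def by algebra+
  then show ?thesis unfolding affA affB Q1_def Q2_def by (simp add: U_def V_def algebra_simps)
qed

section \<open>Exceptional slopes\<close>

lemma finite_V_zero: "finite {p. V p = 0}"
proof -
  have "v1 \<noteq> 0 \<or> v2 \<noteq> 0" using D by auto
  then have "p = - v1 / v2" if "V p = 0" for p
  proof -
    have *: "v1 + p * v2 = 0" using that unfolding V_def by simp
    then have "v2 \<noteq> 0" using \<open>v1 \<noteq> 0 \<or> v2 \<noteq> 0\<close> by auto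
    then show ?thesis using * by (subst nonzero_eq_divide_eq) (auto simp: eq_neg_iff_add_eq_0 add.commute)
  qed
  then have "{p. V p = 0} \<subseteq> {- v1 / v2}" by blast
  then show ?thesis by (rule finite_subset) simp
qed

text \<open>\<open>U / V\<close> is a Moebius function of the slope, injective because its
  determinant is nonzero by \<open>D\<close>.\<close>

lemma finite_ratio_zero:
  assumes "f \<noteq> 0"
  shows "finite {p. V p = 0 \<or> poly f (U p / V p) = 0}"
proof -
  have "finite ((\<lambda>p. U p / V p) -` {x. poly f x = 0} \<inter> {p. V p \<noteq> 0})"
  proof (rule finite_vimage_IntI)
    show "finite {x. poly f x = 0}" using assms by (rule poly_roots_finite)
    show "inj_on (\<lambda>p. U p / V p) {p. V p \<noteq> 0}"
    proof (rule inj_onI)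
      fix p p' assume "p \<in> {p. V p \<noteq> 0}" "p' \<in> {p. V p \<noteq> 0}" "U p / V p = U p' / V p'"
      then have "U p * V p' = U p' * V p" by (simp add: field_simps)
      then have "(u1 * v2 - u2 * v1) * (p - p') = 0" unfolding U_def V_def by algebra
      then show "p = p'" using D by simp
    qed
  qed
  with finite_V_zero have "finite ({p. V p = 0} \<union> ((\<lambda>p. U p / V p) -` {x. poly f x = 0} \<inter> {p. V p \<noteq> 0}))" by simp
  then show ?thesis by (rule finite_subset[rotated]) auto
qed

text \<open>\<open>Q1 U^n + Q2 V^n\<close> is the coefficient of \<open>x^n\<close> in the Legendre
  equation; where it vanishes, a branch escapes to infinity. Divided by \<open>V^(n + 1)\<close> it
  is this polynomial in \<open>U / V\<close>, and \<open>n \<ge> 2\<close> keeps its two high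
  monomials apart from its two low ones.\<close>

lemma leading_poly_nz: "monom c (n + 1) + monom d n + [:b, a:] \<noteq> 0"
proof
  assume *: "monom c (n + 1) + monom d n + [:b, a:] = 0"
  have "coeff (monom c (n + 1) + monom d n + [:b, a:]) k = 0" for k using * by simp
  from this[of 0] this[of 1] this[of n] this[of "n + 1"] n have "a = 0" "b = 0"
    by (auto simp: coeff_pCons split: nat.splits)
  then show False using \<Delta> by simp
qed

lemma leading_coeff_eq:
  assumes "V p \<noteq> 0"
  shows "Q1 p * U p ^ n + Q2 p * V p ^ n = V p ^ (n + 1) * poly (monom c (n + 1) + monom d n + [:b, a:]) (U p / V p)"
proof -
  define x where "x = U p / V p"
  have u: "U p = x * V p" using assms unfolding x_def by simp
  show ?thesis unfolding Q1_def Q2_def x_def[symmetric] u by (simp add: poly_monom power_mult_distrib algebra_simps)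
qed

lemma finite_leading_zero: "finite {p. Q1 p * U p ^ n + Q2 p * V p ^ n = 0}"
proof (rule finite_subset[OF _ finite_ratio_zero[OF leading_poly_nz]], rule subsetI)
  fix p assume "p \<in> {p. Q1 p * U p ^ n + Q2 p * V p ^ n = 0}"
  then show "p \<in> {p. V p = 0 \<or> poly (monom c (n + 1) + monom d n + [:b, a:]) (U p / V p) = 0}"
    using leading_coeff_eq[of p] by (cases "V p = 0") (simp_all del: poly_add)
qed

lemma Q_not_both_zero: "Q1 p \<noteq> 0 \<or> Q2 p \<noteq> 0"
proof (rule ccontr)
  assume "\<not> ?thesis"
  then have q: "Q1 p = 0" "Q2 p = 0" by auto
  have "(a * d - b * c) * U p = d * Q2 p - b * Q1 p" "(a * d - b * c) * V p = a * Q1 p - c * Q2 p"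
    unfolding Q1_def Q2_def by algebra+
  with q \<Delta> have "U p = 0" "V p = 0" by auto
  then show False using UV_det_nz[of p] by simp
qed

definition R where "R p = - Q2 p / Q1 p"

text \<open>One \<open>n\<close>-th of the logarithmic derivative of \<open>R\<close>, hence the
  logarithmic derivative of every branch parameter.\<close>

definition L where "L p = - (a * d - b * c) * (u1 * v2 - u2 * v1) / (of_nat n * (Q1 p * Q2 p))"

lemma R_deriv:
  assumes "Q1 p \<noteq> 0" "Q2 p \<noteq> 0"
  shows "(R has_field_derivative of_nat n * L p * R p) (at p)"
proof -
  have "((\<lambda>p. - Q2 p / Q1 p) has_field_derivative (a * d - b * c) * (u1 * v2 - u2 * v1) / Q1 p ^ 2) (at p)"
    using assms(1) unfolding Q1_def Q2_def U_def V_def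
    by (auto intro!: derivative_eq_intros simp: field_simps power2_eq_square)
  moreover have "(a * d - b * c) * (u1 * v2 - u2 * v1) / Q1 p ^ 2 = of_nat n * L p * R p"
    using assms n unfolding L_def R_def by (simp add: field_simps power2_eq_square)
  ultimately show ?thesis unfolding R_def by simp
qed

end

text \<open>The content of \<open>leg_web_on\<close> with the branches \<open>X\<close> chosen once
  and for all.\<close>

locale bipower_web = bipower_form +
  fixes W :: "(complex \<times> complex) set" and \<omega> :: "nat \<Rightarrow> one_form" and X :: "nat \<Rightarrow> complex \<times> complex \<Rightarrow> complex"
  assumes W: "open W" and \<omega>0: "\<omega> 0 = leg_line (fst P)"
    and holo: "\<And>i. i \<in> {1..n} \<Longrightarrow> holomorphic2_on (X i) W"
    and eqn: "\<And>i p q. i \<in> {1..n} \<Longrightarrow> (p, q) \<in> W \<Longrightarrow> affA P (X i (p, q)) (p * X i (p, q) - q)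
                     + p * affB P (X i (p, q)) (p * X i (p, q) - q) = 0"
    and \<omega>i: "\<And>i. i \<in> {1..n} \<Longrightarrow> \<omega> i = (\<lambda>z. (- X i z, 1))"
    and transverse: "\<And>i j z. i \<le> n \<Longrightarrow> j \<le> n \<Longrightarrow> i \<noteq> j \<Longrightarrow> z \<in> W \<Longrightarrow> form_delta (\<omega> i) (\<omega> j) z \<noteq> 0"
begin

lemma open_slices:
  assumes "(p, q) \<in> W"
  shows "\<exists>e>0. (\<forall>p'\<in>ball p e. (p', q) \<in> W) \<and> (\<forall>q'\<in>ball q e. (p, q') \<in> W)"
proof -
  obtain e where e: "e > 0" "ball (p, q) e \<subseteq> W" using W assms open_contains_ball by blast
  have "dist (p, q) (p', q) = dist p p'" "dist (p, q) (p, q') = dist q q'" for p' q'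
    by (simp_all add: dist_Pair_Pair)
  then show ?thesis using e by (intro exI[of _ e]) (auto simp: subset_iff)
qed

lemma X_distinct:
  assumes "i \<in> {1..n}" "j \<in> {1..n}" "i \<noteq> j" "z \<in> W"
  shows "X i z \<noteq> X j z"
  using transverse[of i j z] assms by (auto simp: \<omega>i form_delta_def wedge_def)

lemma branch_equation:
  assumes "i \<in> {1..n}" "(p, q) \<in> W"
  shows "Q1 p * (U p * X i (p, q) - u2 * q) ^ n + Q2 p * (V p * X i (p, q) - v2 * q) ^ n = 0"
  using eqn[OF assms] leg_equation by simp

lemma two_branches:
  assumes "z \<in> W"
  shows "X 1 z \<noteq> X 2 z"
  using X_distinct[of 1 2 z] n assms by auto

text \<open>For \<open>q = 0\<close> the Legendre equation is \<open>x^n\<close> times its leading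
  coefficient. Two distinct branches cannot both be zero, so the leading coefficient vanishes; as
  \<open>W\<close> is open this happens for infinitely many slopes, which is impossible.\<close>

lemma q_nz:
  assumes "(p, q) \<in> W"
  shows "q \<noteq> 0"
proof
  assume q: "q = 0"
  obtain e where e: "e > 0" "\<And>p'. p' \<in> ball p e \<Longrightarrow> (p', q) \<in> W" using open_slices[OF assms] by blast
  have "Q1 p' * U p' ^ n + Q2 p' * V p' ^ n = 0" if "p' \<in> ball p e" for p'
  proof -
    have w: "(p', 0) \<in> W" using e(2)[OF that] q by simp
    have "Q1 p' * (U p' * X i (p', 0)) ^ n + Q2 p' * (V p' * X i (p', 0)) ^ n = 0" if "i \<in> {1..n}" for i
      using branch_equation[OF that w] by simp
    then have *: "X i (p', 0) ^ n * (Q1 p' * U p' ^ n + Q2 p' * V p' ^ n) = 0" if "i \<in> {1..n}" for i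
      using that by (simp add: power_mult_distrib algebra_simps)
    have "X 1 (p', 0) \<noteq> 0 \<or> X 2 (p', 0) \<noteq> 0" using two_branches[OF w] by auto
    moreover have "X 1 (p', 0) = 0 \<or> ?thesis" "X 2 (p', 0) = 0 \<or> ?thesis" using *[of 1] *[of 2] n by simp_all
    ultimately show ?thesis by blast
  qed
  then have "ball p e \<subseteq> {p. Q1 p * U p ^ n + Q2 p * V p ^ n = 0}" by auto
  then have "finite (ball p e)" using finite_leading_zero finite_subset by blast
  then show False using e(1) uncountable_ball[of e p] countable_finite by blast
qed

text \<open>If \<open>Q1 p = 0\<close>, the Legendre equation is the power of a polynomial of degree
  at most 1 in \<open>x\<close>. Two distinct solutions would make that polynomial identically zero,
  contrary to \<open>q_nz\<close> and \<open>UV_det_nz\<close>.\<close>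

lemma Q1_nz:
  assumes "(p, q) \<in> W"
  shows "Q1 p \<noteq> 0"
proof
  assume "Q1 p = 0"
  then have "V p * X i (p, q) - v2 * q = 0" if "i \<in> {1..n}" for i
    using branch_equation[OF that assms] Q_not_both_zero[of p] n by auto
  from this[of 1] this[of 2] n have *: "V p * X 1 (p, q) = v2 * q" "V p * X 2 (p, q) = v2 * q" by auto
  then have "V p * (X 1 (p, q) - X 2 (p, q)) = 0" by (simp add: right_diff_distrib)
  then have "V p = 0" using two_branches[OF assms] by simp
  then show False using * q_nz[OF assms] UV_det_nz[of p] by auto
qed

lemma Q2_nz:
  assumes "(p, q) \<in> W"
  shows "Q2 p \<noteq> 0"
proof
  assume "Q2 p = 0"
  then have "U p * X i (p, q) - u2 * q = 0" if "i \<in> {1..n}" for i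
    using branch_equation[OF that assms] Q_not_both_zero[of p] n by auto
  from this[of 1] this[of 2] n have *: "U p * X 1 (p, q) = u2 * q" "U p * X 2 (p, q) = u2 * q" by auto
  then have "U p * (X 1 (p, q) - X 2 (p, q)) = 0" by (simp add: right_diff_distrib)
  then have "U p = 0" using two_branches[OF assms] by simp
  then show False using * q_nz[OF assms] UV_det_nz[of p] by auto
qed

lemma R_nz:
  assumes "(p, q) \<in> W"
  shows "R p \<noteq> 0"
  using Q1_nz[OF assms] Q2_nz[OF assms] unfolding R_def by simp

lemma v_nz:
  assumes "i \<in> {1..n}" "(p, q) \<in> W"
  shows "V p * X i (p, q) - v2 * q \<noteq> 0"
proof
  assume v: "V p * X i (p, q) - v2 * q = 0"
  then have "U p * X i (p, q) - u2 * q = 0"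
    using branch_equation[OF assms] Q1_nz[OF assms(2)] n by (auto simp: power_0_left)
  then have "q * (v2 * U p - u2 * V p) = 0" using v by algebra
  then show False using q_nz[OF assms(2)] UV_det_nz[of p] by simp
qed

text \<open>The value of \<open>u / v\<close> at the point of the dual line with abscissa
  \<open>X i\<close>. Substituting \<open>X i = dq / dp\<close> shows that the branch is
  \<open>\<alpha> = T i \<beta>\<close>.\<close>

definition T where "T i z = (U (fst z) * X i z - u2 * snd z) / (V (fst z) * X i z - v2 * snd z)"

lemma T_pow:
  assumes "i \<in> {1..n}" "(p, q) \<in> W"
  shows "T i (p, q) ^ n = R p"
  using branch_equation[OF assms] v_nz[OF assms] Q1_nz[OF assms(2)]
  unfolding T_def R_def by (simp add: field_simps add_eq_0_iff)

lemma T_nz: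
  assumes "i \<in> {1..n}" "(p, q) \<in> W"
  shows "T i (p, q) \<noteq> 0"
  using T_pow[OF assms] R_nz[OF assms(2)] n by (auto simp: power_0_left)

lemma UTV_nz:
  assumes "i \<in> {1..n}" "(p, q) \<in> W"
  shows "U p - T i (p, q) * V p \<noteq> 0"
proof -
  have "(U p - T i (p, q) * V p) * (V p * X i (p, q) - v2 * q) = - q * (v2 * U p - u2 * V p)"
    using v_nz[OF assms] unfolding T_def by (simp add: field_simps)
  then show ?thesis using q_nz[OF assms(2)] UV_det_nz[of p] by auto
qed

lemma X_eq:
  assumes "i \<in> {1..n}" "(p, q) \<in> W"
  shows "X i (p, q) = q * (u2 - T i (p, q) * v2) / (U p - T i (p, q) * V p)"
proof -
  have "X i (p, q) * (U p - T i (p, q) * V p) = q * (u2 - T i (p, q) * v2)"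
    using v_nz[OF assms] unfolding T_def by (simp add: field_simps)
  then show ?thesis using UTV_nz[OF assms] by (simp add: field_simps)
qed

lemma T_inj:
  assumes "(p, q) \<in> W"
  shows "inj_on (\<lambda>i. T i (p, q)) {1..n}"
proof (rule inj_onI)
  fix i j assume ij: "i \<in> {1..n}" "j \<in> {1..n}" "T i (p, q) = T j (p, q)"
  then have "X i (p, q) = X j (p, q)" using X_eq assms by simp
  then show "i = j" using X_distinct ij assms by blast
qed

lemma X_partial:
  assumes "i \<in> {1..n}" "(p, q) \<in> W"
  obtains \<alpha> \<beta> where "((\<lambda>x. X i (x, q)) has_field_derivative \<alpha>) (at p)" "((\<lambda>x. X i (p, x)) has_field_derivative \<beta>) (at q)"
proof -
  obtain \<alpha> \<beta> where d: "(X i has_derivative (\<lambda>(h, k). \<alpha> * h + \<beta> * k)) (at (p, q))"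
    using holo[OF assms(1)] assms(2) unfolding holomorphic2_on_def by blast
  have 1: "((\<lambda>x. (x, q)) has_derivative (\<lambda>h. (h, 0))) (at p)" by (auto intro!: derivative_eq_intros)
  have 2: "((\<lambda>x. (p, x)) has_derivative (\<lambda>h. (0, h))) (at q)" by (auto intro!: derivative_eq_intros)
  have "((\<lambda>x. X i (x, q)) has_derivative (\<lambda>h. \<alpha> * h)) (at p)"
    using diff_chain_at[OF 1 d] by (simp add: o_def)
  moreover have "((\<lambda>x. X i (p, x)) has_derivative (\<lambda>h. \<beta> * h)) (at q)"
    using diff_chain_at[OF 2 d] by (simp add: o_def)
  ultimately show ?thesis by (intro that[of \<alpha> \<beta>]) (simp_all add: has_field_derivative_def)
qed

lemma T_deriv_p:
  assumes "i \<in> {1..n}" "(p, q) \<in> W"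
  shows "((\<lambda>x. T i (x, q)) has_field_derivative T i (p, q) * L p) (at p)"
proof -
  obtain \<alpha> where X: "((\<lambda>x. X i (x, q)) has_field_derivative \<alpha>) (at p)" using X_partial[OF assms] by blast
  \<comment> \<open>The quotient rule is used only for the existence of the derivative; its value
    comes from differentiating \<open>T i ^ n = R\<close>.\<close>
  obtain t where t: "((\<lambda>x. T i (x, q)) has_field_derivative t) (at p)"
  proof -
    note DERIV_divide[OF DERIV_diff[OF DERIV_mult[OF U_deriv X] DERIV_const]
        DERIV_diff[OF DERIV_mult[OF V_deriv X] DERIV_const] v_nz[OF assms]]
    then show ?thesis using that unfolding T_def fst_conv snd_conv by blast
  qed
  obtain e where e: "e > 0" "\<And>p'. p' \<in> ball p e \<Longrightarrow> (p', q) \<in> W" using open_slices[OF assms(2)] by blast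
  have "((\<lambda>x. T i (x, q) ^ n) has_field_derivative of_nat n * (t * T i (p, q) ^ (n - 1))) (at p)"
    using DERIV_power[OF t, of n] by simp
  then have "(R has_field_derivative of_nat n * (t * T i (p, q) ^ (n - 1))) (at p)"
    by (rule has_field_derivative_transform_within[OF _ e(1)]) (use e T_pow[OF assms(1)] in \<open>auto simp: dist_commute\<close>)
  then have "of_nat n * (t * T i (p, q) ^ (n - 1)) = of_nat n * L p * R p"
    using R_deriv[OF Q1_nz[OF assms(2)] Q2_nz[OF assms(2)]] DERIV_unique by blast
  also have "R p = T i (p, q) * T i (p, q) ^ (n - 1)"
    using T_pow[OF assms] n by (metis One_nat_def Suc_1 Suc_le_D diff_Suc_1 power_Suc)
  finally have "t = T i (p, q) * L p" using T_nz[OF assms] n by (simp add: algebra_simps)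
  then show ?thesis using t by simp
qed

lemma T_deriv_q:
  assumes "i \<in> {1..n}" "(p, q) \<in> W"
  shows "((\<lambda>x. T i (p, x)) has_field_derivative 0) (at q)"
proof -
  obtain \<beta> where X: "((\<lambda>x. X i (p, x)) has_field_derivative \<beta>) (at q)" using X_partial[OF assms] by blast
  obtain t where t: "((\<lambda>x. T i (p, x)) has_field_derivative t) (at q)"
  proof -
    note DERIV_divide[OF DERIV_diff[OF DERIV_cmult[OF X] DERIV_cmult[OF DERIV_ident]]
        DERIV_diff[OF DERIV_cmult[OF X] DERIV_cmult[OF DERIV_ident]] v_nz[OF assms]]
    then show ?thesis using that unfolding T_def fst_conv snd_conv by blast
  qed
  obtain e where e: "e > 0" "\<And>q'. q' \<in> ball q e \<Longrightarrow> (p, q') \<in> W" using open_slices[OF assms(2)] by blast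
  have "((\<lambda>x. T i (p, x) ^ n) has_field_derivative of_nat n * (t * T i (p, q) ^ (n - 1))) (at q)"
    using DERIV_power[OF t, of n] by simp
  then have "((\<lambda>x. R p) has_field_derivative of_nat n * (t * T i (p, q) ^ (n - 1))) (at q)"
    by (rule has_field_derivative_transform_within[OF _ e(1)]) (use e T_pow[OF assms(1)] in \<open>auto simp: dist_commute\<close>)
  then have "of_nat n * (t * T i (p, q) ^ (n - 1)) = 0" using DERIV_unique DERIV_const by blast
  then show ?thesis using t T_nz[OF assms] n by auto
qed

text \<open>Along a vertical disc \<open>T i\<close> has derivative zero. This is what removes the
  \<open>dp\<close>-component of \<open>\<eta>\<close> from the curvature.\<close>

lemma T_locally_constant:
  assumes "(p, q) \<in> W"
  shows "\<exists>e>0. \<forall>q'\<in>ball q e. (p, q') \<in> W \<and> (\<forall>i\<in>{1..n}. T i (p, q') = T i (p, q))"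
proof -
  obtain e where e: "e > 0" "\<And>q'. q' \<in> ball q e \<Longrightarrow> (p, q') \<in> W" using open_slices[OF assms] by blast
  have "T i (p, q') = T i (p, q)" if "q' \<in> ball q e" and i: "i \<in> {1..n}" for q' i
  proof -
    have "\<exists>k. \<forall>x\<in>ball q e. T i (p, x) = k"
      using T_deriv_q[OF i] e by (intro has_field_derivative_zero_constant convex_ball)
        (auto intro: has_field_derivative_at_within)
    then obtain k where "\<forall>x\<in>ball q e. T i (p, x) = k" by blast
    then show ?thesis using that(1) e(1) by simp
  qed
  then show ?thesis using e by blast
qed

text \<open>The branch form is \<open>dq - X i dp = k i (\<alpha> - T i \<beta>)\<close>;
  \<open>k\<close> is the factor that makes the \<open>dq\<close>-coefficient 1, and
  \<open>k'\<close> is its derivative with respect to \<open>p\<close>.\<close>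

definition k where "k i z = 1 / (U (fst z) - T i z * V (fst z))"
definition k' where "k' i z = - ((k i z)^2) * (u2 - T i z * v2 - T i z * L (fst z) * V (fst z))"

lemma branch_pencil_jet:
  assumes "i \<in> {1..n}" "(p, q) \<in> W"
  shows "pencil_jet (\<omega> i) p q (U p) (V p) u2 v2 (k i (p, q)) (k' i (p, q)) (T i (p, q)) (T i (p, q) * L p)"
proof -
  define t where "t = T i (p, q)"
  define g where "g = U p - t * V p"
  have g0: "g \<noteq> 0" using UTV_nz[OF assms] unfolding g_def t_def by simp
  have k: "k i (p, q) = 1 / g" "k' i (p, q) = - ((1 / g)^2) * (u2 - t * v2 - t * L p * V p)"
    unfolding k_def k'_def g_def t_def by simp_all
  obtain e where e: "e > 0" "\<And>p'. p' \<in> ball p e \<Longrightarrow> (p', q) \<in> W" "\<And>q'. q' \<in> ball q e \<Longrightarrow> (p, q') \<in> W"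
    using open_slices[OF assms(2)] by blast
  note Tp = T_deriv_p[OF assms] and Tq = T_deriv_q[OF assms]
  have "((\<lambda>x. - (q * (u2 - T i (x, q) * v2) / (U x - T i (x, q) * V x))) has_field_derivative
     - q * (k' i (p, q) * (u2 - t * v2) - k i (p, q) * (t * L p) * v2)) (at p)"
  proof (rule DERIV_cong)
    show "((\<lambda>x. - (q * (u2 - T i (x, q) * v2) / (U x - T i (x, q) * V x))) has_field_derivative
      - ((q * (0 - t * L p * v2) * g - q * (u2 - t * v2) * (u2 - (t * L p * V p + v2 * t))) / (g * g))) (at p)"
      unfolding g_def t_def
      by (rule DERIV_minus[OF DERIV_divide[OF DERIV_cmult[OF DERIV_diff[OF DERIV_const DERIV_cmult_right[OF Tp]]]
          DERIV_diff[OF U_deriv DERIV_mult[OF Tp V_deriv]] UTV_nz[OF assms]]])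
    show "- ((q * (0 - t * L p * v2) * g - q * (u2 - t * v2) * (u2 - (t * L p * V p + v2 * t))) / (g * g))
      = - q * (k' i (p, q) * (u2 - t * v2) - k i (p, q) * (t * L p) * v2)"
      using g0 unfolding k by (simp add: field_simps power2_eq_square)
  qed
  then have 1: "((\<lambda>x. fst (\<omega> i (x, q))) has_field_derivative
     - q * (k' i (p, q) * (u2 - t * v2) - k i (p, q) * (t * L p) * v2)) (at p)"
    by (rule has_field_derivative_transform_within[OF _ e(1)]) (use e X_eq[OF assms(1)] \<omega>i[OF assms(1)] in \<open>auto simp: dist_commute\<close>)
  have "((\<lambda>x. - (x * (u2 - T i (p, x) * v2) / (U p - T i (p, x) * V p))) has_field_derivative
     - (k i (p, q) * (u2 - t * v2))) (at q)"
  proof (rule DERIV_cong)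
    show "((\<lambda>x. - (x * (u2 - T i (p, x) * v2) / (U p - T i (p, x) * V p))) has_field_derivative
      - (((1 * (u2 - t * v2) + (0 - 0 * v2) * q) * g - q * (u2 - t * v2) * (0 - 0 * V p)) / (g * g))) (at q)"
      unfolding g_def t_def
      by (rule DERIV_minus[OF DERIV_divide[OF DERIV_mult[OF DERIV_ident DERIV_diff[OF DERIV_const DERIV_cmult_right[OF Tq]]]
          DERIV_diff[OF DERIV_const DERIV_cmult_right[OF Tq]] UTV_nz[OF assms]]])
    show "- (((1 * (u2 - t * v2) + (0 - 0 * v2) * q) * g - q * (u2 - t * v2) * (0 - 0 * V p)) / (g * g))
      = - (k i (p, q) * (u2 - t * v2))"
      using g0 unfolding k by (simp add: field_simps)
  qed
  then have 2: "((\<lambda>x. fst (\<omega> i (p, x))) has_field_derivative - (k i (p, q) * (u2 - t * v2))) (at q)"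
    by (rule has_field_derivative_transform_within[OF _ e(1)]) (use e X_eq[OF assms(1)] \<omega>i[OF assms(1)] in \<open>auto simp: dist_commute\<close>)
  have 3: "\<omega> i (p, q) = (- q * (k i (p, q) * (u2 - t * v2)), k i (p, q) * (U p - t * V p))"
    using g0 X_eq[OF assms] \<omega>i[OF assms(1)] unfolding k by (simp add: t_def g_def)
  \<comment> \<open>The \<open>dq\<close>-coefficient of a branch is constantly 1, so the derivative
    prescribed by \<open>pencil_jet\<close> has to be zero.\<close>
  have 4: "k' i (p, q) * (U p - t * V p) + k i (p, q) * (u2 - t * v2 - (t * L p) * V p) = 0"
    using g0 unfolding k g_def[symmetric] by (simp add: field_simps power2_eq_square)
  show ?thesis
    unfolding pencil_jet_def jet_def t_def[symmetric] 4
    using 1 2 3 \<omega>i[OF assms(1)] by simp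
qed

end

section \<open>Curvature of the Legendre web\<close>

context bipower_web begin

definition eta_sum :: "complex \<times> complex \<Rightarrow> complex \<times> complex" where
  "eta_sum z = (\<Sum>t<n + 1. \<Sum>s<t. \<Sum>r<s. web_eta (\<omega> r) (\<omega> s) (\<omega> t) z)"

text \<open>The \<open>dp\<close>-component depends on \<open>q\<close> only through the branch
  parameters, which are locally constant in \<open>q\<close>. Hence only the
  \<open>p\<close>-derivative of the \<open>dq\<close>-component survives, and the constant
  \<open>C\<close> drops out.\<close>

lemma curvature_eq_deriv:
  assumes z: "(p, q) \<in> W"
    and snd: "\<And>p q. (p, q) \<in> W \<Longrightarrow> snd (eta_sum (p, q)) = (C + F p) / q"
    and fst: "\<And>p q q'. (p, q) \<in> W \<Longrightarrow> (p, q') \<in> W \<Longrightarrow> (\<And>i. i \<in> {1..n} \<Longrightarrow> T i (p, q') = T i (p, q)) \<Longrightarrow>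
      fst (eta_sum (p, q')) = fst (eta_sum (p, q))"
    and F: "(F has_field_derivative F') (at p)"
  shows "web_curvature (n + 1) \<omega> (p, q) = F' / q"
proof -
  obtain e where e: "e > 0" "\<forall>p'\<in>ball p e. (p', q) \<in> W" using open_slices[OF z] by blast
  obtain e' where e': "e' > 0" "\<forall>q'\<in>ball q e'. (p, q') \<in> W \<and> (\<forall>i\<in>{1..n}. T i (p, q') = T i (p, q))"
    using T_locally_constant[OF z] by blast
  have "((\<lambda>x. (C + F x) / q) has_field_derivative F' / q) (at p)"
    using DERIV_cdivide[OF DERIV_add[OF DERIV_const[of C] F], of q] by simp
  then have 1: "((\<lambda>x. snd (eta_sum (x, q))) has_field_derivative F' / q) (at p)"
    by (rule has_field_derivative_transform_within[OF _ e(1)]) (use e(2) snd in \<open>auto simp: dist_commute\<close>)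
  have "((\<lambda>x. fst (eta_sum (p, q))) has_field_derivative 0) (at q)" by (rule DERIV_const)
  then have 2: "((\<lambda>x. fst (eta_sum (p, x))) has_field_derivative 0) (at q)"
  proof (rule has_field_derivative_transform_within[OF _ e'(1)])
    fix x assume "dist x q < e'"
    then have "x \<in> ball q e'" by (simp add: dist_commute)
    then show "fst (eta_sum (p, q)) = fst (eta_sum (p, x))" using e'(2) by (intro fst[OF z, symmetric]) auto
  qed simp
  have "web_curvature (n + 1) \<omega> (p, q) = ext_d eta_sum (p, q)"
    unfolding web_curvature_def eta_sum_def ..
  then show ?thesis unfolding ext_d_def fst_conv snd_conv DERIV_imp_deriv[OF 1] DERIV_imp_deriv[OF 2] by simp
qed

text \<open>Common notation for all members of the web. Index 0 is the line, with constant parameter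
  \<open>t0\<close> and constant factor \<open>s0\<close>, so its primed data vanish.\<close>

definition \<tau> where "\<tau> t0 z i = (if i = 0 then t0 else T i z)"
definition \<tau>' where "\<tau>' z i = (if i = 0 then 0 else T i z * L (fst z))"
definition \<kappa> where "\<kappa> s0 z i = (if i = 0 then s0 else k i z)"
definition \<kappa>' where "\<kappa>' z i = (if i = 0 then 0 else k' i z)"
text \<open>\<open>eta2\<close> at three parameters is a product of two such quotients; this makes
  \<open>sum_triples_product\<close> applicable.\<close>

definition \<xi> where "\<xi> t0 z i j = (U (fst z) - \<tau> t0 z j * V (fst z)) / (\<tau> t0 z i - \<tau> t0 z j)"

definition \<eta>1 where "\<eta>1 s0 t0 z r s t =
     \<kappa>' z r / \<kappa> s0 z r + \<kappa>' z s / \<kappa> s0 z s + \<kappa>' z t / \<kappa> s0 z t +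
        (\<tau>' z r * eta1 (U (fst z)) (V (fst z)) u2 v2 (\<tau> t0 z r) (\<tau> t0 z s) (\<tau> t0 z t)
        + \<tau>' z s * eta1 (U (fst z)) (V (fst z)) u2 v2 (\<tau> t0 z s) (\<tau> t0 z t) (\<tau> t0 z r)
        + \<tau>' z t * eta1 (U (fst z)) (V (fst z)) u2 v2 (\<tau> t0 z t) (\<tau> t0 z r) (\<tau> t0 z s)) / (u1 * v2 - u2 * v1)"

lemma \<eta>1_cong:
  assumes "\<And>i. i \<in> {1..n} \<Longrightarrow> T i (p, q') = T i (p, q)" "r \<le> n" "s \<le> n" "t \<le> n"
  shows "\<eta>1 s0 t0 (p, q') r s t = \<eta>1 s0 t0 (p, q) r s t"
proof -
  have "T i (p, q') = T i (p, q)" if "i \<in> {r, s, t}" "i \<noteq> 0" for i using assms that by auto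
  then have "\<tau> t0 (p, q') i = \<tau> t0 (p, q) i" "\<tau>' (p, q') i = \<tau>' (p, q) i"
    "\<kappa> s0 (p, q') i = \<kappa> s0 (p, q) i" "\<kappa>' (p, q') i = \<kappa>' (p, q) i" if "i \<in> {r, s, t}" for i
    using that unfolding \<tau>_def \<tau>'_def \<kappa>_def \<kappa>'_def k_def k'_def by (cases "i = 0"; force)+
  then show ?thesis unfolding \<eta>1_def by simp
qed

lemma eta_triple:
  assumes z: "(p, q) \<in> W" and rst: "r \<le> n" "s \<le> n" "t \<le> n" "r \<noteq> s" "s \<noteq> t" "r \<noteq> t"
    and jet: "\<And>i. i \<in> {r, s, t} \<Longrightarrow>
      pencil_jet (\<omega> i) p q (U p) (V p) u2 v2 (\<kappa> s0 (p, q) i) (\<kappa>' (p, q) i) (\<tau> t0 (p, q) i) (\<tau>' (p, q) i)"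
  shows "web_eta (\<omega> r) (\<omega> s) (\<omega> t) (p, q) = (\<eta>1 s0 t0 (p, q) r s t,
      (3 + (\<tau>' (p, q) r * \<xi> t0 (p, q) r s * \<xi> t0 (p, q) r t + \<tau>' (p, q) s * \<xi> t0 (p, q) s r * \<xi> t0 (p, q) s t
        + \<tau>' (p, q) t * \<xi> t0 (p, q) t r * \<xi> t0 (p, q) t s) / (u1 * v2 - u2 * v1)) / q)"
proof -
  \<comment> \<open>Nonvanishing of the factors and distinctness of the parameters are both read off
    from transversality.\<close>
  have nz: "\<kappa> s0 (p, q) i \<noteq> 0 \<and> \<tau> t0 (p, q) i \<noteq> \<tau> t0 (p, q) j"
    if "i \<in> {r, s, t}" "j \<in> {r, s, t}" "i \<noteq> j" for i j
    using transverse[of i j "(p, q)"] pencil_wedge[OF jet[OF that(1)] jet[OF that(2)]] that rst z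
    unfolding form_delta_def by auto
  have "web_eta (\<omega> r) (\<omega> s) (\<omega> t) (p, q) = (\<eta>1 s0 t0 (p, q) r s t,
    (3 + (\<tau>' (p, q) r * eta2 (U p) (V p) (\<tau> t0 (p, q) r) (\<tau> t0 (p, q) s) (\<tau> t0 (p, q) t)
      + \<tau>' (p, q) s * eta2 (U p) (V p) (\<tau> t0 (p, q) s) (\<tau> t0 (p, q) t) (\<tau> t0 (p, q) r)
      + \<tau>' (p, q) t * eta2 (U p) (V p) (\<tau> t0 (p, q) t) (\<tau> t0 (p, q) r) (\<tau> t0 (p, q) s)) / (u1 * v2 - u2 * v1)) / q)"
    unfolding \<eta>1_def fst_conv UV_det[symmetric, of p]
    by (rule pencil_eta[OF jet jet jet]) (use nz[of r s] nz[of s t] nz[of t r] nz[of r t] rst q_nz[OF z] UV_det_nz in auto)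
  moreover have "w * \<xi> t0 (p, q) i j * \<xi> t0 (p, q) i l
    = w * eta2 (U p) (V p) (\<tau> t0 (p, q) i) (\<tau> t0 (p, q) j) (\<tau> t0 (p, q) l)" for w i j l
    by (simp add: eta2_def \<xi>_def)
  ultimately show ?thesis
    by (simp only: eta_coeff_sym(2)[of _ _ "\<tau> t0 (p, q) s" "\<tau> t0 (p, q) t" "\<tau> t0 (p, q) r"])
qed

text \<open>\<open>Cf r\<close> is the constant that a triple contributes to the
  \<open>dq / q\<close>-component. It may depend on the smallest index, because the line has index
  0. Outside the branch pairs \<open>x\<close> is left free, so that the line at infinity can be
  treated by setting \<open>x i 0\<close> to zero.\<close>

lemma eta_sum_snd:
  assumes z: "(p, q) \<in> W"
    and x: "\<And>i j. i \<in> {1..n} \<Longrightarrow> j \<in> {1..n} \<Longrightarrow> i \<noteq> j \<Longrightarrow> x i j = \<xi> t0 (p, q) i j"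
    and trip: "\<And>r s t. r < s \<Longrightarrow> s < t \<Longrightarrow> t \<le> n \<Longrightarrow> snd (web_eta (\<omega> r) (\<omega> s) (\<omega> t) (p, q)) =
      (Cf r + (\<tau>' (p, q) r * x r s * x r t + \<tau>' (p, q) s * x s r * x s t + \<tau>' (p, q) t * x t r * x t s) / (u1 * v2 - u2 * v1)) / q"
  shows "snd (eta_sum (p, q)) = ((\<Sum>t<n + 1. \<Sum>s<t. \<Sum>r<s. Cf r) +
    - (a * d - b * c) * (of_nat n - 1) / 2 * ((of_nat n - 2) / 3 * U p * V p
      + (\<Sum>i\<in>{1..n}. (V p * T i (p, q) + U p) * x i 0) / of_nat n) / (Q1 p * Q2 p)) / q"
proof -
  let ?h = "\<lambda>r s t. \<tau>' (p, q) r * x r s * x r t + \<tau>' (p, q) s * x s r * x s t + \<tau>' (p, q) t * x t r * x t s"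
  let ?D = "u1 * v2 - u2 * v1"
  have "snd (eta_sum (p, q)) = (\<Sum>t<n + 1. \<Sum>s<t. \<Sum>r<s. snd (web_eta (\<omega> r) (\<omega> s) (\<omega> t) (p, q)))"
    unfolding eta_sum_def by (simp only: snd_sum)
  also have "\<dots> = (\<Sum>t<n + 1. \<Sum>s<t. \<Sum>r<s. (Cf r + ?h r s t / ?D) / q)"
    using trip by (intro sum.cong) auto
  also have "\<dots> = ((\<Sum>t<n + 1. \<Sum>s<t. \<Sum>r<s. Cf r) + (\<Sum>t<n + 1. \<Sum>s<t. \<Sum>r<s. ?h r s t) / ?D) / q"
    by (simp only: sum_divide_distrib[symmetric] sum.distrib)
  also have "(\<Sum>t<n + 1. \<Sum>s<t. \<Sum>r<s. ?h r s t) / ?D = - (a * d - b * c) * (of_nat n - 1) / 2 * ((of_nat n - 2) / 3 * U p * V p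
      + (\<Sum>i\<in>{1..n}. (V p * T i (p, q) + U p) * x i 0) / of_nat n) / (Q1 p * Q2 p)"
  proof -
    have half: "x = y / 2" if "2 * x = y" for x y :: complex using that by auto
    have "2 * (\<Sum>t<n + 1. \<Sum>s<t. \<Sum>r<s. ?h r s t) = L p * (of_nat n - 1) * (of_nat n * (of_nat n - 2) / 3 * U p * V p
      + (\<Sum>i\<in>{1..n}. (V p * T i (p, q) + U p) * x i 0))"
      by (rule branch_triple_sum[OF n R_nz[OF z] T_pow[OF _ z] T_inj[OF z]])
        (use x in \<open>auto simp: \<tau>'_def \<xi>_def \<tau>_def mult.commute\<close>)
    then have e: "(\<Sum>t<n + 1. \<Sum>s<t. \<Sum>r<s. ?h r s t) = L p * (of_nat n - 1) * (of_nat n * (of_nat n - 2) / 3 * U p * V p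
      + (\<Sum>i\<in>{1..n}. (V p * T i (p, q) + U p) * x i 0)) / 2" by (rule half)
    show ?thesis unfolding e L_def using D n Q1_nz[OF z] Q2_nz[OF z] by (simp add: field_simps)
  qed
  finally show ?thesis .
qed

lemma eta_sum_fst_cong:
  assumes "(p, q) \<in> W" "(p, q') \<in> W" and T: "\<And>i. i \<in> {1..n} \<Longrightarrow> T i (p, q') = T i (p, q)"
    and trip: "\<And>r s t q. r < s \<Longrightarrow> s < t \<Longrightarrow> t \<le> n \<Longrightarrow> (p, q) \<in> W \<Longrightarrow>
      fst (web_eta (\<omega> r) (\<omega> s) (\<omega> t) (p, q)) = Cf r * \<eta>1 s0 t0 (p, q) r s t"
  shows "fst (eta_sum (p, q')) = fst (eta_sum (p, q))"
  unfolding eta_sum_def fst_sum using assms \<eta>1_cong[of p q' q] by (intro sum.cong) auto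

text \<open>The line \<open>u = t0 v\<close> through the origin is dual to the member
  \<open>\<alpha> - t0 \<beta>\<close> of the pencil.\<close>

lemma line_pencil_jet:
  assumes "fst P = vector [s0 * (u1 - t0 * v1), s0 * (u2 - t0 * v2), 0]"
  shows "pencil_jet (\<omega> 0) p q (U p) (V p) u2 v2 s0 0 t0 0"
  unfolding pencil_jet_def jet_def \<omega>0 leg_line_def assms U_def V_def
  by (auto intro!: derivative_eq_intros simp: algebra_simps)

text \<open>\<open>Q1 + Q2 = 0\<close> means \<open>R = 1\<close>; then 1 is among the branch
  parameters and that branch is tangent to the pencil of the line.\<close>

lemma line_Q_sum_nz:
  assumes l: "fst P = vector [s0 * (u1 - t0 * v1), s0 * (u2 - t0 * v2), 0]" and t0: "t0 = 1"
    and z: "(p, q) \<in> W"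
  shows "Q1 p + Q2 p \<noteq> 0"
proof
  assume "Q1 p + Q2 p = 0"
  then have "R p = 1" using Q1_nz[OF z] unfolding R_def by (simp add: add_eq_0_iff)
  moreover have "(\<lambda>i. T i (p, q)) ` {1..n} = {z. z ^ n = R p}"
    by (rule nth_roots_enumeration[OF _ R_nz[OF z] T_pow[OF _ z] T_inj[OF z]]) (use n in simp)
  ultimately have "1 \<in> (\<lambda>i. T i (p, q)) ` {1..n}" by simp
  then obtain i where i: "i \<in> {1..n}" "T i (p, q) = 1" by force
  show False
    using transverse[of 0 i "(p, q)"] pencil_wedge[OF line_pencil_jet[OF l] branch_pencil_jet[OF i(1) z]] i z t0
    unfolding form_delta_def by auto
qed

text \<open>\<open>J\<close> is the function of the overview divided by \<open>a d - b c\<close> and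
  written homogeneously in \<open>U\<close> and \<open>V\<close>, so that slopes with
  \<open>V p = 0\<close> need no separate treatment. For \<open>t0 = 0\<close> the two terms combine
  to \<open>(n + 1) U V\<close>.\<close>

lemma curvature_line:
  assumes l: "fst P = vector [s0 * (u1 - t0 * v1), s0 * (u2 - t0 * v2), 0]" and t0: "t0 = 0 \<or> t0 = 1"
    and z: "(p, q) \<in> W"
    and J: "\<And>p. J p = ((of_nat n - 2) * U p * V p
      + (if t0 = 0 then 3 * U p * V p else - 3 * (U p - V p) * (Q1 p * U p - Q2 p * V p) / (Q1 p + Q2 p))) / (Q1 p * Q2 p)"
    and der: "(J has_field_derivative J') (at p)"
  shows "web_curvature (n + 1) \<omega> (p, q) = - (a * d - b * c) * (of_nat n - 1) / 6 * J' / q"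
proof (rule curvature_eq_deriv[OF z])
  have jet: "pencil_jet (\<omega> i) p q (U p) (V p) u2 v2 (\<kappa> s0 (p, q) i) (\<kappa>' (p, q) i) (\<tau> t0 (p, q) i) (\<tau>' (p, q) i)"
    if "i \<le> n" "(p, q) \<in> W" for i p q
    using branch_pencil_jet[of i p q] line_pencil_jet[OF l] that unfolding \<kappa>_def \<kappa>'_def \<tau>_def \<tau>'_def by auto
  show "fst (eta_sum (p, q')) = fst (eta_sum (p, q))"
    if "(p, q) \<in> W" "(p, q') \<in> W" "\<And>i. i \<in> {1..n} \<Longrightarrow> T i (p, q') = T i (p, q)" for p q q'
  proof (rule eta_sum_fst_cong[OF that, of "\<lambda>_. 1" s0 t0])
    show "fst (web_eta (\<omega> r) (\<omega> s) (\<omega> t) (p, q)) = 1 * \<eta>1 s0 t0 (p, q) r s t"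
      if "r < s" "s < t" "t \<le> n" "(p, q) \<in> W" for r s t q
      by (subst eta_triple[of p q r s t s0 t0]) (use that jet in auto)
  qed
  show "snd (eta_sum (p, q)) = ((\<Sum>t<n + 1. \<Sum>s<t. \<Sum>r<s. 3) + - (a * d - b * c) * (of_nat n - 1) / 6 * J p) / q"
    if pq: "(p, q) \<in> W" for p q
  proof -
    have sm: "snd (eta_sum (p, q)) = ((\<Sum>t<n + 1. \<Sum>s<t. \<Sum>r<s. 3) +
      - (a * d - b * c) * (of_nat n - 1) / 2 * ((of_nat n - 2) / 3 * U p * V p
      + (\<Sum>i\<in>{1..n}. (V p * T i (p, q) + U p) * \<xi> t0 (p, q) i 0) / of_nat n) / (Q1 p * Q2 p)) / q"
    proof (rule eta_sum_snd[OF pq, of _ t0])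
      show "snd (web_eta (\<omega> r) (\<omega> s) (\<omega> t) (p, q)) = (3 + (\<tau>' (p, q) r * \<xi> t0 (p, q) r s * \<xi> t0 (p, q) r t
        + \<tau>' (p, q) s * \<xi> t0 (p, q) s r * \<xi> t0 (p, q) s t + \<tau>' (p, q) t * \<xi> t0 (p, q) t r * \<xi> t0 (p, q) t s)
        / (u1 * v2 - u2 * v1)) / q"
        if "r < s" "s < t" "t \<le> n" for r s t
        by (subst eta_triple[of p q r s t s0 t0]) (use that jet pq in auto)
    qed auto
    have *: "(\<Sum>i\<in>{1..n}. (V p * T i (p, q) + U p) * \<xi> t0 (p, q) i 0)
      = (U p - t0 * V p) * (\<Sum>i\<in>{1..n}. (V p * T i (p, q) + U p) / (T i (p, q) - t0))"
      unfolding sum_distrib_left by (intro sum.cong) (auto simp: \<xi>_def \<tau>_def)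
    note nz = Q1_nz[OF pq] Q2_nz[OF pq] R_nz[OF pq]
    have Y: "(\<Sum>i\<in>{1..n}. (V p * T i (p, q) + U p) * \<xi> t0 (p, q) i 0) / of_nat n
      = (if t0 = 0 then U p * V p else - (U p - V p) * (Q1 p * U p - Q2 p * V p) / (Q1 p + Q2 p))"
    proof (cases "t0 = 0")
      case True
      have "(\<Sum>i\<in>{1..n}. (V p * T i (p, q) + U p) / (T i (p, q) - t0)) = of_nat n * V p"
        unfolding True diff_zero by (rule branch_line_sum(2)[OF n R_nz[OF pq] T_pow[OF _ pq] T_inj[OF pq]])
      then show ?thesis unfolding * using True n by simp
    next
      case False
      then have t1: "t0 = 1" using t0 by simp
      have Q12: "Q1 p + Q2 p \<noteq> 0" using line_Q_sum_nz[OF l t1 pq] .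
      have R1: "R p \<noteq> 1"
      proof
        assume "R p = 1"
        then have "- Q2 p = Q1 p" using nz by (simp add: R_def field_simps)
        then show False using Q12 by (metis add.left_inverse)
      qed
      have "(\<Sum>i\<in>{1..n}. (V p * T i (p, q) + U p) / (T i (p, q) - t0)) = - of_nat n * (U p + R p * V p) / (1 - R p)"
        unfolding t1 by (rule branch_line_sum(1)[OF n R_nz[OF pq] T_pow[OF _ pq] T_inj[OF pq] R1])
      also have "\<dots> = - of_nat n * ((Q1 p * U p - Q2 p * V p) / (Q1 p + Q2 p))"
        using Q12 nz R1 unfolding R_def by (simp add: divide_simps)
      finally have sm1: "(\<Sum>i\<in>{1..n}. (V p * T i (p, q) + U p) / (T i (p, q) - t0))
        = - of_nat n * ((Q1 p * U p - Q2 p * V p) / (Q1 p + Q2 p))" .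
      have "y * (- of_nat n * (w / x)) / of_nat n = - y * w / x" for w x y :: complex using n by simp
      then show ?thesis unfolding * sm1 by (simp only: t1 one_neq_zero if_False mult_1)
    qed
    show ?thesis unfolding sm Y J using t0 by (auto simp: field_simps)
  qed
  show "((\<lambda>p. - (a * d - b * c) * (of_nat n - 1) / 6 * J p) has_field_derivative
    - (a * d - b * c) * (of_nat n - 1) / 6 * J') (at p)"
    by (rule DERIV_cmult[OF der])
qed

text \<open>A triple containing the line contributes \<open>dq / q\<close>, hence the constant 1
  instead of 3 and no variable part; the other triples contribute as before.\<close>

lemma curvature_infinity:
  assumes l: "fst P = vector [0, 0, s0]" and s0: "s0 \<noteq> 0"
    and z: "(p, q) \<in> W"
    and J: "\<And>p. J p = (of_nat n - 2) * U p * V p / (Q1 p * Q2 p)"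
    and der: "(J has_field_derivative J') (at p)"
  shows "web_curvature (n + 1) \<omega> (p, q) = - (a * d - b * c) * (of_nat n - 1) / 6 * J' / q"
proof (rule curvature_eq_deriv[OF z])
  have jet: "pencil_jet (\<omega> i) p q (U p) (V p) u2 v2 (\<kappa> 1 (p, q) i) (\<kappa>' (p, q) i) (\<tau> 0 (p, q) i) (\<tau>' (p, q) i)"
    if "i \<in> {1..n}" "(p, q) \<in> W" for i p q
    using branch_pencil_jet[of i p q] that unfolding \<kappa>_def \<kappa>'_def \<tau>_def \<tau>'_def by auto
  have jet0: "jet (\<omega> 0) p q s0 0 0 0 0 0" for p q
    unfolding jet_def \<omega>0 leg_line_def l by (auto intro!: derivative_eq_intros)
  have trip0: "web_eta (\<omega> 0) (\<omega> s) (\<omega> t) (p, q) = (0, 1 / q)" if st: "0 < s" "s < t" "t \<le> n" and pq: "(p, q) \<in> W" for s t p q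
  proof (rule pencil_eta_infinity[OF jet0 branch_pencil_jet[OF _ pq] _ _ branch_pencil_jet[OF _ pq]])
    have i: "s \<in> {1..n}" "t \<in> {1..n}" using st by auto
    then show "s \<in> {1..n}" "t \<in> {1..n}" by auto
    have norm: "k i (p, q) * (U p - T i (p, q) * V p) = 1"
      "k' i (p, q) * (U p - T i (p, q) * V p) + k i (p, q) * (u2 - T i (p, q) * v2 - T i (p, q) * L p * V p) = 0"
      "k i (p, q) \<noteq> 0"
      if "i \<in> {1..n}" for i
      using UTV_nz[OF that pq] unfolding k_def k'_def fst_conv by (simp_all add: power2_eq_square)
    show "k s (p, q) * (U p - T s (p, q) * V p) = 1" "k t (p, q) * (U p - T t (p, q) * V p) = 1"
      "k s (p, q) \<noteq> 0" "k t (p, q) \<noteq> 0"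
      "k' s (p, q) * (U p - T s (p, q) * V p) + k s (p, q) * (u2 - T s (p, q) * v2 - T s (p, q) * L p * V p) = 0"
      "k' t (p, q) * (U p - T t (p, q) * V p) + k t (p, q) * (u2 - T t (p, q) * v2 - T t (p, q) * L p * V p) = 0"
      using norm i by auto
    show "s0 \<noteq> 0" "q \<noteq> 0" "v2 * U p - u2 * V p \<noteq> 0" using s0 q_nz[OF pq] UV_det_nz by auto
    show "T s (p, q) \<noteq> T t (p, q)" using inj_onD[OF T_inj[OF pq], of s t] i st by auto
  qed
  show "fst (eta_sum (p, q')) = fst (eta_sum (p, q))"
    if "(p, q) \<in> W" "(p, q') \<in> W" "\<And>i. i \<in> {1..n} \<Longrightarrow> T i (p, q') = T i (p, q)" for p q q'
  proof (rule eta_sum_fst_cong[OF that, of "\<lambda>r. if r = 0 then 0 else 1" 1 0])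
    show "fst (web_eta (\<omega> r) (\<omega> s) (\<omega> t) (p, q)) = (if r = 0 then 0 else 1) * \<eta>1 1 0 (p, q) r s t"
      if "r < s" "s < t" "t \<le> n" "(p, q) \<in> W" for r s t q
    proof (cases "r = 0")
      case False
      then show ?thesis by (subst eta_triple[of p q r s t 1 0]) (use that jet in auto)
    qed (use that trip0 in auto)
  qed
  show "snd (eta_sum (p, q)) = ((\<Sum>t<n + 1. \<Sum>s<t. \<Sum>r<s. if r = 0 then 1 else 3)
     + - (a * d - b * c) * (of_nat n - 1) / 6 * J p) / q"
    if pq: "(p, q) \<in> W" for p q
  proof -
    \<comment> \<open>The zero column switches off the interaction with the line in the general
      summation.\<close>
    define x where "x i j = (if j = 0 then 0 else \<xi> 0 (p, q) i j)" for i j :: nat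
    have "snd (eta_sum (p, q)) = ((\<Sum>t<n + 1. \<Sum>s<t. \<Sum>r<s. if r = 0 then 1 else 3) +
      - (a * d - b * c) * (of_nat n - 1) / 2 * ((of_nat n - 2) / 3 * U p * V p
      + (\<Sum>i\<in>{1..n}. (V p * T i (p, q) + U p) * x i 0) / of_nat n) / (Q1 p * Q2 p)) / q"
    proof (rule eta_sum_snd[OF pq, of _ 0])
      show "snd (web_eta (\<omega> r) (\<omega> s) (\<omega> t) (p, q)) =
        ((if r = 0 then 1 else 3) + (\<tau>' (p, q) r * x r s * x r t + \<tau>' (p, q) s * x s r * x s t + \<tau>' (p, q) t * x t r * x t s) / (u1 * v2 - u2 * v1)) / q"
        if "r < s" "s < t" "t \<le> n" for r s t
      proof (cases "r = 0")
        case False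
        then show ?thesis by (subst eta_triple[of p q r s t 1 0]) (use that jet pq in \<open>auto simp: x_def\<close>)
      qed (use that trip0[of s t p q] pq in \<open>auto simp: x_def \<tau>'_def\<close>)
    qed (auto simp: x_def)
    then show ?thesis unfolding J by (simp add: x_def)
  qed
  show "((\<lambda>p. - (a * d - b * c) * (of_nat n - 1) / 6 * J p) has_field_derivative
    - (a * d - b * c) * (of_nat n - 1) / 6 * J') (at p)"
    by (rule DERIV_cmult[OF der])
qed

end

section \<open>Flatness as a polynomial identity\<close>

lemma (in bipower_form) leg_web_on_imp_bipower_web:
  assumes "leg_web_on (n + 1) P W \<omega>"
  obtains X where "bipower_web n P u1 u2 v1 v2 a b c d W \<omega> X"
proof -
  from assms obtain X where o: "open W" "\<omega> 0 = leg_line (fst P)"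
    and X: "\<And>i. i \<in> {1..<n + 1} \<Longrightarrow> holomorphic2_on (X i) W \<and>
        (\<forall>(p, q)\<in>W. affA P (X i (p, q)) (p * X i (p, q) - q) + p * affB P (X i (p, q)) (p * X i (p, q) - q) = 0) \<and>
        \<omega> i = (\<lambda>z. (- X i z, 1))"
    and tr: "\<forall>i<n + 1. \<forall>j<n + 1. i \<noteq> j \<longrightarrow> (\<forall>z\<in>W. form_delta (\<omega> i) (\<omega> j) z \<noteq> 0)"
    unfolding leg_web_on_def by blast
  have m: "i \<in> {1..<n + 1}" if "i \<in> {1..n}" for i using that by auto
  have "bipower_web n P u1 u2 v1 v2 a b c d W \<omega> X"
    by unfold_locales (use o X[OF m] tr in \<open>auto simp: less_Suc_eq_le\<close>)
  then show ?thesis by (rule that)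
qed

context bipower_form begin

lemma finite_linear_zero:
  assumes "(\<alpha>, \<beta>) \<noteq> (0, 0)"
  shows "finite {p. \<alpha> * U p + \<beta> * V p = 0}"
proof (rule finite_subset)
  show "finite {p. V p = 0 \<or> poly [:\<beta>, \<alpha>:] (U p / V p) = 0}"
    by (rule finite_ratio_zero) (use assms in auto)
  show "{p. \<alpha> * U p + \<beta> * V p = 0} \<subseteq> {p. V p = 0 \<or> poly [:\<beta>, \<alpha>:] (U p / V p) = 0}"
  proof (rule subsetI)
    fix p assume *: "p \<in> {p. \<alpha> * U p + \<beta> * V p = 0}"
    have "\<beta> + \<alpha> * U p / V p = (\<alpha> * U p + \<beta> * V p) / V p" if "V p \<noteq> 0"
      using that by (simp add: field_simps)
    then show "p \<in> {p. V p = 0 \<or> poly [:\<beta>, \<alpha>:] (U p / V p) = 0}" using * by (auto simp: mult.commute)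
  qed
qed

text \<open>The slopes \<open>p\<close> over which all branches are finite, distinct and transverse to the line.\<close>

definition good where
  "good p \<longleftrightarrow> Q1 p \<noteq> 0 \<and> Q2 p \<noteq> 0 \<and> Q1 p + Q2 p \<noteq> 0 \<and> Q1 p * U p ^ n + Q2 p * V p ^ n \<noteq> 0"

lemma finite_not_good: "finite {p. \<not> good p}"
proof -
  have "a + c \<noteq> 0 \<or> b + d \<noteq> 0"
  proof (rule ccontr)
    assume "\<not> ?thesis"
    then have "c = - a" "d = - b" by (auto simp: eq_neg_iff_add_eq_0 add.commute)
    then show False using \<Delta> by simp
  qed
  moreover have "c \<noteq> 0 \<or> d \<noteq> 0" "a \<noteq> 0 \<or> b \<noteq> 0" using \<Delta> by auto
  ultimately have "finite {p. c * U p + d * V p = 0}" "finite {p. a * U p + b * V p = 0}"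
    "finite {p. (a + c) * U p + (b + d) * V p = 0}"
    using finite_linear_zero[of c d] finite_linear_zero[of a b] finite_linear_zero[of "a + c" "b + d"] by auto
  moreover have "(a + c) * U p + (b + d) * V p = Q1 p + Q2 p" for p
    unfolding Q1_def Q2_def by algebra
  ultimately have "finite ({p. Q1 p = 0} \<union> {p. Q2 p = 0} \<union> {p. Q1 p + Q2 p = 0} \<union> {p. Q1 p * U p ^ n + Q2 p * V p ^ n = 0})"
    using finite_leading_zero by (simp add: Q1_def Q2_def)
  then show ?thesis by (rule finite_subset[rotated]) (auto simp: good_def)
qed

lemma Q1_deriv: "(Q1 has_field_derivative c * u2 + d * v2) (at p)"
  and Q2_deriv: "(Q2 has_field_derivative a * u2 + b * v2) (at p)"
  unfolding Q1_def Q2_def by (auto intro!: derivative_eq_intros U_deriv V_deriv)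

text \<open>On a disc where \<open>R p / R p0\<close> has positive real part, the principal
  logarithm gives a holomorphic \<open>n\<close>-th root of this quotient; a root \<open>w0\<close>
  of \<open>R p0\<close> turns it into a root of \<open>R\<close>.\<close>

lemma root_branch_exists:
  "\<exists>p0 r w w'. r > 0 \<and> (\<forall>p\<in>ball p0 r. good p \<and> w p ^ n = R p \<and> (w has_field_derivative w' p) (at p))"
proof -
  have op: "open {p. good p}"
    using finite_imp_closed[OF finite_not_good] by (simp add: closed_def Collect_neg_eq)
  have "infinite (UNIV :: complex set)" using uncountable_UNIV_complex countable_finite by blast
  then obtain p0 where g0: "good p0" using finite_not_good by (metis (mono_tags, lifting) UNIV_eq_I mem_Collect_eq)
  have gR: "Q1 p \<noteq> 0" "Q2 p \<noteq> 0" "R p \<noteq> 0" if "good p" for p using that unfolding good_def R_def by auto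
  define \<rho> where "\<rho> p = R p / R p0" for p
  have d\<rho>: "(\<rho> has_field_derivative of_nat n * L p * R p / R p0) (at p)" if "good p" for p
    unfolding \<rho>_def using DERIV_cdivide[OF R_deriv[OF gR(1,2)[OF that]]] .
  have "continuous_on {p. good p} (\<lambda>p. Re (\<rho> p))"
    using d\<rho> by (intro continuous_on_Re DERIV_continuous_on[where D = "\<lambda>p. of_nat n * L p * R p / R p0"])
      (auto intro: has_field_derivative_at_within)
  then have "open ({p. good p} \<inter> (\<lambda>p. Re (\<rho> p)) -` {0<..})"
    using op by (intro continuous_open_preimage) auto
  moreover have "p0 \<in> {p. good p} \<inter> (\<lambda>p. Re (\<rho> p)) -` {0<..}"
    using g0 gR(3)[OF g0] by (simp add: \<rho>_def)
  ultimately obtain r where r: "r > 0" "ball p0 r \<subseteq> {p. good p} \<inter> (\<lambda>p. Re (\<rho> p)) -` {0<..}"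
    using open_contains_ball by blast
  obtain w0 where w0: "w0 ^ n = R p0"
  proof -
    have "card {z. z ^ n = R p0} = n" using n gR(3)[OF g0] by (simp add: card_nth_roots)
    then have "{z. z ^ n = R p0} \<noteq> {}" using n by (metis card.empty not_numeral_le_zero)
    then show ?thesis using that by blast
  qed
  define w where "w p = w0 * exp (Ln (\<rho> p) / of_nat n)" for p
  have nn: "\<rho> p \<notin> \<real>\<^sub>\<le>\<^sub>0" if "p \<in> ball p0 r" for p
    using r(2) that by (auto simp: complex_nonpos_Reals_iff)
  have "w p ^ n = R p" if "p \<in> ball p0 r" for p
  proof -
    have "\<rho> p \<noteq> 0" using nn[OF that] by auto
    then have "w p ^ n = w0 ^ n * \<rho> p"
      unfolding w_def power_mult_distrib exp_of_nat_mult[symmetric] using n by simp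
    then show ?thesis using w0 gR(3)[OF g0] by (simp add: \<rho>_def)
  qed
  moreover have "\<exists>w'. (w has_field_derivative w') (at p)" if p: "p \<in> ball p0 r" for p
  proof -
    have g: "good p" using r(2) p by auto
    note DERIV_cmult[OF DERIV_chain2[OF DERIV_exp DERIV_cdivide[OF DERIV_chain2[OF has_field_derivative_Ln[OF nn[OF p]] d\<rho>[OF g]]]]]
    then show ?thesis unfolding w_def by blast
  qed
  then obtain w' where "\<And>p. p \<in> ball p0 r \<Longrightarrow> (w has_field_derivative w' p) (at p)" by metis
  ultimately show ?thesis using r by (intro exI[of _ p0] exI[of _ r] exI[of _ w] exI[of _ w']) auto
qed

text \<open>Flatness quantifies over local decompositions, so constancy can be deduced from it only
  once a decomposition exists. Multiplying one root of \<open>R\<close> by the \<open>n\<close>-th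
  roots of unity gives all parameters \<open>t i\<close>, and solving
  \<open>\<alpha> = t i \<beta>\<close> for \<open>dq / dp\<close> gives
  \<open>q * Y i p\<close>.\<close>

lemma leg_web_exists:
  assumes l: "s0 \<noteq> 0" "fst P = vector [0, 0, s0] \<or> (\<exists>t0\<in>{0, 1}. fst P = vector [s0 * (u1 - t0 * v1), s0 * (u2 - t0 * v2), 0])"
  shows "\<exists>p0 r \<omega>. r > 0 \<and> (\<forall>p\<in>ball p0 r. good p) \<and> leg_web_on (n + 1) P (ball p0 r \<times> - {0}) \<omega>"
proof -
  obtain p0 r w w' where r: "r > 0" and good: "\<And>p. p \<in> ball p0 r \<Longrightarrow> good p"
    and w: "\<And>p. p \<in> ball p0 r \<Longrightarrow> w p ^ n = R p" and w': "\<And>p. p \<in> ball p0 r \<Longrightarrow> (w has_field_derivative w' p) (at p)"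
    using root_branch_exists by blast
  define \<zeta> where "\<zeta> i = cis (2 * pi * real i / real n)" for i
  define t where "t i p = \<zeta> i * w p" for i p
  define Y where "Y i p = (u2 - t i p * v2) / (U p - t i p * V p)" for i p
  define X where "X i z = snd z * Y i (fst z)" for i z
  define \<omega> where "\<omega> i = (if i = 0 then leg_line (fst P) else (\<lambda>z. (- X i z, 1)))" for i :: nat
  have nz: "Q1 p \<noteq> 0" "Q2 p \<noteq> 0" "R p \<noteq> 0" "R p \<noteq> 1" if "p \<in> ball p0 r" for p
  proof -
    show Q: "Q1 p \<noteq> 0" "Q2 p \<noteq> 0" "R p \<noteq> 0" using good[OF that] unfolding good_def R_def by auto
    show "R p \<noteq> 1"
    proof
      assume "R p = 1"
      then have "- Q2 p = Q1 p" using Q by (simp add: R_def field_simps)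
      then show False using good[OF that] unfolding good_def by (metis add.left_inverse)
    qed
  qed
  have \<zeta>n: "\<zeta> i ^ n = 1" for i
  proof -
    have "\<zeta> i ^ n = cis (real n * (2 * pi * real i / real n))" by (simp only: \<zeta>_def Complex.DeMoivre)
    also have "real n * (2 * pi * real i / real n) = 2 * pi * real i" using n by simp
    finally show ?thesis by simp
  qed
  \<comment> \<open>The known enumeration of the roots of unity runs from 0 to \<open>n - 1\<close>,
    the branches from 1 to \<open>n\<close>; the shift is a common factor.\<close>
  have \<zeta>inj: "\<zeta> i \<noteq> \<zeta> j" if "i \<in> {1..n}" "j \<in> {1..n}" "i \<noteq> j" for i j
  proof -
    have "inj_on (\<lambda>k. cis (2 * pi * real k / real n)) {..<n}"
      using Complex.bij_betw_roots_unity[of n] n by (auto simp: bij_betw_def)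
    moreover have "\<zeta> i = cis (2 * pi * real (i - 1) / real n) * cis (2 * pi / real n)" if "i \<in> {1..n}" for i
      unfolding \<zeta>_def cis_mult using that n by (simp add: of_nat_diff add_divide_distrib[symmetric] algebra_simps)
    ultimately show ?thesis using that inj_onD[of _ "{..<n}" "i - 1" "j - 1"] by force
  qed
  have tn: "t i p ^ n = R p" if "p \<in> ball p0 r" for i p
    unfolding t_def power_mult_distrib \<zeta>n w[OF that] by simp
  have w0: "w p \<noteq> 0" if "p \<in> ball p0 r" for p using w[OF that] nz(3)[OF that] n by (auto simp: power_0_left)
  \<comment> \<open>A zero here would make the leading coefficient of the Legendre equation vanish,
    which \<open>good\<close> excludes.\<close>
  have den: "U p - t i p * V p \<noteq> 0" if "p \<in> ball p0 r" for i p
  proof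
    assume "U p - t i p * V p = 0"
    then have "U p = t i p * V p" by simp
    then have "U p ^ n = R p * V p ^ n" by (simp add: power_mult_distrib tn[OF that])
    then have "Q1 p * U p ^ n + Q2 p * V p ^ n = 0" unfolding R_def using nz[OF that] by simp
    then show False using good[OF that] unfolding good_def by simp
  qed
  let ?W = "ball p0 r \<times> - {0::complex}"
  have t': "(t i has_field_derivative \<zeta> i * w' p) (at p)" if "p \<in> ball p0 r" for i p
    unfolding t_def using DERIV_cmult[OF w'[OF that]] .
  have "\<exists>y. (Y i has_field_derivative y) (at p)" if "p \<in> ball p0 r" for i p
    using DERIV_divide[OF DERIV_diff[OF DERIV_const DERIV_cmult_right[OF t'[OF that, of i]]]
        DERIV_diff[OF U_deriv DERIV_mult[OF t'[OF that, of i] V_deriv]] den[OF that]] unfolding Y_def by blast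
  then have Y': "(Y i has_field_derivative deriv (Y i) p) (at p)" if "p \<in> ball p0 r" for i p
    using that DERIV_imp_deriv by metis
  have diff: "u2 - t i p * v2 = Y i p * (U p - t i p * V p)" if "p \<in> ball p0 r" for i p
    unfolding Y_def using den[OF that] by simp
  have Yij: "(Y i p - Y j p) * ((U p - t i p * V p) * (U p - t j p * V p)) = - (v2 * U p - u2 * V p) * (t i p - t j p)"
    if "p \<in> ball p0 r" for i j p
    using diff[OF that, of i] diff[OF that, of j] by algebra
  have "leg_web_on (n + 1) P ?W \<omega>"
    unfolding leg_web_on_def
  proof (intro conjI exI[of _ X] ballI allI impI)
    show "open ?W" by (intro open_Times) auto
    show "\<omega> 0 = leg_line (fst P)" by (simp add: \<omega>_def)
    show "\<omega> i = (\<lambda>z. (- X i z, 1))" if "i \<in> {1..<n + 1}" for i using that by (simp add: \<omega>_def)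
    show "holomorphic2_on (X i) ?W" for i
      unfolding holomorphic2_on_def
    proof (intro ballI)
      fix z assume z: "z \<in> ?W"
      have "((\<lambda>z. Y i (fst z)) has_derivative (\<lambda>h. deriv (Y i) (fst z) * fst h)) (at z)"
        using has_derivative_compose[OF has_derivative_fst[OF has_derivative_ident], of "Y i" "(*) (deriv (Y i) (fst z))" z UNIV]
          Y'[of "fst z" i] z by (auto simp: has_field_derivative_def)
      from has_derivative_mult[OF has_derivative_snd[OF has_derivative_ident] this]
      have "(X i has_derivative (\<lambda>h. snd z * (deriv (Y i) (fst z) * fst h) + snd h * Y i (fst z))) (at z)"
        unfolding X_def .
      moreover have "(\<lambda>h. snd z * (deriv (Y i) (fst z) * fst h) + snd h * Y i (fst z))
        = (\<lambda>(h, k). (snd z * deriv (Y i) (fst z)) * h + Y i (fst z) * k)" by (auto simp: algebra_simps)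
      ultimately show "\<exists>a b. (X i has_derivative (\<lambda>(h, k). a * h + b * k)) (at z)" by metis
    qed
    show "case z of (p, q) \<Rightarrow> affA P (X i (p, q)) (p * X i (p, q) - q) + p * affB P (X i (p, q)) (p * X i (p, q) - q) = 0"
      if z: "z \<in> ?W" for z i
    proof -
      obtain p q where pq: "z = (p, q)" by (cases z)
      have p: "p \<in> ball p0 r" using z pq by auto
      have "U p * (q * Y i p) - u2 * q = t i p * (V p * (q * Y i p) - v2 * q)"
        using diff[OF p, of i] by algebra
      then have "(U p * (q * Y i p) - u2 * q) ^ n = R p * (V p * (q * Y i p) - v2 * q) ^ n"
        by (simp add: power_mult_distrib tn[OF p])
      then show ?thesis unfolding pq X_def using nz[OF p] by (simp add: leg_equation R_def)
    qed
    have line: "form_delta (\<omega> 0) (\<omega> i) z \<noteq> 0" if i: "i \<noteq> 0" and z: "z \<in> ?W" for i z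
    proof -
      obtain p q where pq: "z = (p, q)" by (cases z)
      have p: "p \<in> ball p0 r" and q: "q \<noteq> 0" using z pq by auto
      have fd: "form_delta (\<omega> 0) (\<omega> i) z = fst P $ 3 - q * fst P $ 2 + q * Y i p * (fst P $ 1 + p * fst P $ 2)"
        using i unfolding form_delta_def wedge_def \<omega>_def pq leg_line_def X_def by simp
      from l(2) show ?thesis
      proof
        assume "fst P = vector [0, 0, s0]"
        then show ?thesis unfolding fd using l(1) by simp
      next
        assume "\<exists>t0\<in>{0, 1}. fst P = vector [s0 * (u1 - t0 * v1), s0 * (u2 - t0 * v2), 0]"
        then obtain t0 where t0: "t0 = 0 \<or> t0 = 1" and P: "fst P = vector [s0 * (u1 - t0 * v1), s0 * (u2 - t0 * v2), 0]" by blast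
        have "t i p \<noteq> t0" using t0 tn[OF p, of i] nz[OF p] n by (auto simp: power_0_left)
        moreover have "form_delta (\<omega> 0) (\<omega> i) z * (U p - t i p * V p) = q * s0 * (t0 - t i p) * (v2 * U p - u2 * V p)"
        proof -
          have "form_delta (\<omega> 0) (\<omega> i) z = q * s0 * (Y i p * (U p - t0 * V p) - (u2 - t0 * v2))"
            unfolding fd P by (simp add: U_def V_def algebra_simps)
          then show ?thesis using diff[OF p, of i] by algebra
        qed
        ultimately show ?thesis using q l(1) UV_det_nz[of p] by auto
      qed
    qed
    show "form_delta (\<omega> i) (\<omega> j) z \<noteq> 0" if ij: "i < n + 1" "j < n + 1" "i \<noteq> j" and z: "z \<in> ?W" for i j z
    proof (cases "i = 0 \<or> j = 0")
      case True
      have "form_delta (\<omega> i) (\<omega> j) z = - form_delta (\<omega> j) (\<omega> i) z" by (simp add: form_delta_def wedge_def)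
      then show ?thesis using True ij line[of i z] line[of j z] z by auto
    next
      case False
      obtain p q where pq: "z = (p, q)" by (cases z)
      have p: "p \<in> ball p0 r" and q: "q \<noteq> 0" using z pq by auto
      have "t i p \<noteq> t j p" unfolding t_def using \<zeta>inj[of i j] ij False w0[OF p] by auto
      then have "Y i p \<noteq> Y j p" using Yij[OF p, of i j] UV_det_nz[of p] by auto
      then show ?thesis using False q by (simp add: form_delta_def wedge_def \<omega>_def pq X_def)
    qed
  qed
  then show ?thesis using r good by blast
qed

text \<open>The part of the argument common to all positions of the line. \<open>dm\<close>
  describes slopes at which \<open>J\<close> is differentiable; it holds at good slopes and at every
  slope lying under a web. \<open>crit K\<close> stands for the coefficient equations expressing
  \<open>J = K\<close>: they follow from infinitely many good slopes and imply the equality wherever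
  \<open>dm\<close> holds.\<close>

lemma flat_iff_constant:
  assumes l: "s0 \<noteq> 0" "fst P = vector [0, 0, s0] \<or> (\<exists>t0\<in>{0, 1}. fst P = vector [s0 * (u1 - t0 * v1), s0 * (u2 - t0 * v2), 0])"
    and \<mu>: "\<mu> \<noteq> 0"
    and dm: "\<And>p. good p \<Longrightarrow> dm p"
    and dmJ: "\<And>p. dm p \<Longrightarrow> \<exists>J'. (J has_field_derivative J') (at p)"
    and web: "\<And>W \<omega> X p q. bipower_web n P u1 u2 v1 v2 a b c d W \<omega> X \<Longrightarrow> (p, q) \<in> W \<Longrightarrow> dm p"
    and curv: "\<And>W \<omega> X p q J'. bipower_web n P u1 u2 v1 v2 a b c d W \<omega> X \<Longrightarrow> (p, q) \<in> W \<Longrightarrow>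
      (J has_field_derivative J') (at p) \<Longrightarrow> web_curvature (n + 1) \<omega> (p, q) = \<mu> * J' / q"
    and poly: "\<And>K S. infinite S \<Longrightarrow> (\<And>p. p \<in> S \<Longrightarrow> good p \<and> J p = K) \<Longrightarrow> crit K"
    and crit: "\<And>K p. crit K \<Longrightarrow> dm p \<Longrightarrow> J p = K"
  shows "leg_flat (n + 1) P \<longleftrightarrow> (\<exists>K. crit K)"
proof
  assume flat: "leg_flat (n + 1) P"
  obtain p0 r \<omega> where r: "r > 0" and good: "\<forall>p\<in>ball p0 r. good p" and web_on: "leg_web_on (n + 1) P (ball p0 r \<times> - {0}) \<omega>"
    using leg_web_exists[OF l] by blast
  obtain X where X: "bipower_web n P u1 u2 v1 v2 a b c d (ball p0 r \<times> - {0}) \<omega> X"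
    using leg_web_on_imp_bipower_web[OF web_on] by blast
  have "(J has_field_derivative 0) (at p)" if p: "p \<in> ball p0 r" for p
  proof -
    obtain J' where J': "(J has_field_derivative J') (at p)" using good p dm dmJ by blast
    have "web_curvature (n + 1) \<omega> (p, 1) = \<mu> * J' / 1" by (rule curv[OF X _ J']) (use p in auto)
    moreover have "web_curvature (n + 1) \<omega> (p, 1) = 0" using flat web_on p unfolding leg_flat_def by auto
    ultimately show ?thesis using J' \<mu> by auto
  qed
  then have "\<exists>K. \<forall>p\<in>ball p0 r. J p = K"
    by (intro has_field_derivative_zero_constant convex_ball) (auto intro: has_field_derivative_at_within)
  then obtain K where "\<forall>p\<in>ball p0 r. J p = K" by blast
  moreover have "infinite (ball p0 r)" using uncountable_ball[OF r] countable_finite by blast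
  ultimately show "\<exists>K. crit K" using poly good by blast
next
  assume "\<exists>K. crit K"
  then obtain K where K: "crit K" by blast
  show "leg_flat (n + 1) P"
    unfolding leg_flat_def
  proof (intro allI impI ballI)
    fix W \<omega> z assume web_on: "leg_web_on (n + 1) P W \<omega>" and z: "z \<in> W"
    obtain p q where pq: "z = (p, q)" by (cases z)
    obtain X where X: "bipower_web n P u1 u2 v1 v2 a b c d W \<omega> X"
      using leg_web_on_imp_bipower_web[OF web_on] by blast
    interpret bipower_web n P u1 u2 v1 v2 a b c d W \<omega> X by (rule X)
    obtain e where e: "e > 0" "\<forall>p'\<in>ball p e. (p', q) \<in> W" using open_slices z pq by blast
    have "((\<lambda>_. K) has_field_derivative 0) (at p)" by (rule DERIV_const)
    then have "(J has_field_derivative 0) (at p)"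
    proof (rule has_field_derivative_transform_within[OF _ e(1)])
      fix x assume "dist x p < e"
      then have "(x, q) \<in> W" using e(2) by (simp add: dist_commute)
      then show "K = J x" using crit[OF K web[OF X]] by simp
    qed simp
    from curv[OF X _ this, of q] show "web_curvature (n + 1) \<omega> z = 0" using z pq by simp
  qed
qed

section \<open>Comparison of coefficients in \<open>U / V\<close>\<close>

lemma J_differentiable:
  assumes "Q1 p \<noteq> 0" "Q2 p \<noteq> 0"
  shows "\<exists>J'. ((\<lambda>p. m * U p * V p / (Q1 p * Q2 p)) has_field_derivative J') (at p)"
    and "Q1 p + Q2 p \<noteq> 0 \<Longrightarrow> \<exists>J'. ((\<lambda>p. (m * U p * V p + - 3 * (U p - V p) * (Q1 p * U p - Q2 p * V p) / (Q1 p + Q2 p)) / (Q1 p * Q2 p))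
      has_field_derivative J') (at p)"
proof -
  have nz: "Q1 p * Q2 p \<noteq> 0" using assms by simp
  note UV = DERIV_mult[OF DERIV_cmult[OF U_deriv, of m] V_deriv]
  note Q = DERIV_mult[OF Q1_deriv Q2_deriv]
  show "\<exists>J'. ((\<lambda>p. m * U p * V p / (Q1 p * Q2 p)) has_field_derivative J') (at p)"
    using DERIV_divide[OF UV Q nz] by blast
  assume s: "Q1 p + Q2 p \<noteq> 0"
  note N = DERIV_mult[OF DERIV_cmult[OF DERIV_diff[OF U_deriv V_deriv], of "- 3"]
      DERIV_diff[OF DERIV_mult[OF Q1_deriv U_deriv] DERIV_mult[OF Q2_deriv V_deriv]]]
  show "\<exists>J'. ((\<lambda>p. (m * U p * V p + - 3 * (U p - V p) * (Q1 p * U p - Q2 p * V p) / (Q1 p + Q2 p)) / (Q1 p * Q2 p))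
      has_field_derivative J') (at p)"
    using DERIV_divide[OF DERIV_add[OF UV DERIV_divide[OF N DERIV_add[OF Q1_deriv Q2_deriv] s]] Q nz] by blast
qed

lemma ratio_poly_zero:
  assumes "infinite S" "\<And>p. p \<in> S \<Longrightarrow> V p \<noteq> 0 \<Longrightarrow> poly f (U p / V p) = 0"
  shows "f = 0"
proof (rule ccontr)
  assume "f \<noteq> 0"
  from finite_ratio_zero[OF this] have "finite S" by (rule finite_subset[rotated]) (use assms(2) in auto)
  then show False using assms(1) by simp
qed

text \<open>After clearing denominators both sides are quadratic forms in \<open>U\<close> and
  \<open>V\<close>; divided by \<open>V^2\<close> they become polynomials in \<open>U / V\<close>
  agreeing at infinitely many points. \<open>cubic_criterion\<close> does the same in degree 3,
  where the factor \<open>Q1 + Q2\<close> joins the denominator.\<close>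

lemma quadratic_criterion:
  assumes "infinite S" "\<And>p. p \<in> S \<Longrightarrow> good p \<and> m * U p * V p / (Q1 p * Q2 p) = K"
  shows "K * a * c = 0 \<and> K * b * d = 0 \<and> m = K * (a * d + b * c)"
proof -
  have "[:- K * b * d, m - K * (a * d + b * c), - K * a * c:] = 0"
  proof (rule ratio_poly_zero[OF assms(1)])
    fix p assume p: "p \<in> S" and V: "V p \<noteq> 0"
    define x where "x = U p / V p"
    have U: "U p = x * V p" using V unfolding x_def by simp
    have "m * U p * V p = K * (Q1 p * Q2 p)" using assms(2)[OF p] unfolding good_def by (auto simp: field_simps)
    then have "V p^2 * (m * x) = V p^2 * (K * ((c * x + d) * (a * x + b)))"
      unfolding Q1_def Q2_def U by (simp add: power2_eq_square algebra_simps)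
    then have "m * x = K * ((c * x + d) * (a * x + b))" using V by simp
    then show "poly [:- K * b * d, m - K * (a * d + b * c), - K * a * c:] (U p / V p) = 0"
      unfolding x_def[symmetric] by (simp add: algebra_simps)
  qed
  then show ?thesis by simp
qed

lemma cubic_criterion:
  assumes "infinite S" "\<And>p. p \<in> S \<Longrightarrow> good p \<and>
    (m * U p * V p + - 3 * (U p - V p) * (Q1 p * U p - Q2 p * V p) / (Q1 p + Q2 p)) / (Q1 p * Q2 p) = K"
  shows "- 3 * c = K * a * c * (a + c) \<and>
    m * (a + c) - 3 * (d - a) + 3 * c = K * (a * c * (b + d) + (a * d + b * c) * (a + c)) \<and>
    m * (b + d) + 3 * b + 3 * (d - a) = K * ((a * d + b * c) * (b + d) + b * d * (a + c)) \<and>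
    - 3 * b = K * b * d * (b + d)"
proof -
  have "[:- 3 * b - K * b * d * (b + d), m * (b + d) + 3 * b + 3 * (d - a) - K * ((a * d + b * c) * (b + d) + b * d * (a + c)),
     m * (a + c) - 3 * (d - a) + 3 * c - K * (a * c * (b + d) + (a * d + b * c) * (a + c)), - 3 * c - K * a * c * (a + c):] = 0"
    (is "?f = 0")
  proof (rule ratio_poly_zero[OF assms(1)])
    fix p assume p: "p \<in> S" and V: "V p \<noteq> 0"
    define x where "x = U p / V p"
    have U: "U p = x * V p" using V unfolding x_def by simp
    have g: "Q1 p \<noteq> 0" "Q2 p \<noteq> 0" "Q1 p + Q2 p \<noteq> 0" using assms(2)[OF p] unfolding good_def by auto
    have "m * U p * V p * (Q1 p + Q2 p) - 3 * (U p - V p) * (Q1 p * U p - Q2 p * V p) = K * (Q1 p * Q2 p) * (Q1 p + Q2 p)"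
    proof -
      have "(m * U p * V p + - 3 * (U p - V p) * (Q1 p * U p - Q2 p * V p) / (Q1 p + Q2 p)) = K * (Q1 p * Q2 p)"
        using assms(2)[OF p] g by (auto simp: nonzero_divide_eq_eq)
      moreover have "y * s - 3 * u * z = t * s" if "y + - 3 * u * z / s = t" "s \<noteq> 0" for y z s t u :: complex
        using that by (simp add: field_simps)
      ultimately show ?thesis using g(3) by blast
    qed
    then have "V p^3 * (m * x * ((c * x + d) + (a * x + b)) - 3 * (x - 1) * ((c * x + d) * x - (a * x + b)))
      = V p^3 * (K * ((c * x + d) * (a * x + b)) * ((c * x + d) + (a * x + b)))"
      unfolding Q1_def Q2_def U by (simp add: power3_eq_cube algebra_simps)
    then have "m * x * ((c * x + d) + (a * x + b)) - 3 * (x - 1) * ((c * x + d) * x - (a * x + b))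
      = K * ((c * x + d) * (a * x + b)) * ((c * x + d) + (a * x + b))" using V by simp
    then show "poly ?f (U p / V p) = 0"
      unfolding x_def[symmetric] by (simp add: algebra_simps)
  qed
  then show ?thesis by simp
qed

theorem flat_line_infinity:
  assumes "s0 \<noteq> 0" "fst P = vector [0, 0, s0]"
  shows "leg_flat (n + 1) P \<longleftrightarrow> (\<exists>K. K * a * c = 0 \<and> K * b * d = 0 \<and> of_nat n - 2 = K * (a * d + b * c))"
proof (rule flat_iff_constant[where J = "\<lambda>p. (of_nat n - 2) * U p * V p / (Q1 p * Q2 p)" and dm = "\<lambda>p. Q1 p \<noteq> 0 \<and> Q2 p \<noteq> 0"
      and \<mu> = "- (a * d - b * c) * (of_nat n - 1) / 6", OF assms(1)])
  have "of_nat n \<noteq> (1 :: complex)" using n by auto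
  then show "- (a * d - b * c) * (of_nat n - 1) / 6 \<noteq> 0" using \<Delta> by auto
next
  fix W \<omega> X p q J' assume X: "bipower_web n P u1 u2 v1 v2 a b c d W \<omega> X" and z: "(p, q) \<in> W"
  interpret bipower_web n P u1 u2 v1 v2 a b c d W \<omega> X by (rule X)
  show "Q1 p \<noteq> 0 \<and> Q2 p \<noteq> 0" using Q1_nz[OF z] Q2_nz[OF z] by simp
  assume "((\<lambda>p. (of_nat n - 2) * U p * V p / (Q1 p * Q2 p)) has_field_derivative J') (at p)"
  then show "web_curvature (n + 1) \<omega> (p, q) = - (a * d - b * c) * (of_nat n - 1) / 6 * J' / q"
    by (intro curvature_infinity[OF assms(2,1) z]) auto
next
  fix K p assume K: "K * a * c = 0 \<and> K * b * d = 0 \<and> of_nat n - 2 = K * (a * d + b * c)" and Q: "Q1 p \<noteq> 0 \<and> Q2 p \<noteq> 0"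
  have "(of_nat n - 2) * U p * V p = K * (Q1 p * Q2 p)" using K unfolding Q1_def Q2_def by algebra
  then show "(of_nat n - 2) * U p * V p / (Q1 p * Q2 p) = K" using Q by simp
next
  fix K S assume "infinite S" "\<And>p. p \<in> S \<Longrightarrow> good p \<and> (of_nat n - 2) * U p * V p / (Q1 p * Q2 p) = K"
  then show "K * a * c = 0 \<and> K * b * d = 0 \<and> of_nat n - 2 = K * (a * d + b * c)" by (rule quadratic_criterion)
qed (use assms J_differentiable(1) in \<open>auto simp: good_def\<close>)

theorem flat_critical_line:
  assumes "s0 \<noteq> 0" "fst P = vector [s0 * u1, s0 * u2, 0]"
  shows "leg_flat (n + 1) P \<longleftrightarrow> (\<exists>K. K * a * c = 0 \<and> K * b * d = 0 \<and> of_nat n + 1 = K * (a * d + b * c))"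
proof (rule flat_iff_constant[where J = "\<lambda>p. (of_nat n + 1) * U p * V p / (Q1 p * Q2 p)" and dm = "\<lambda>p. Q1 p \<noteq> 0 \<and> Q2 p \<noteq> 0"
      and \<mu> = "- (a * d - b * c) * (of_nat n - 1) / 6", OF assms(1)])
  have "of_nat n \<noteq> (1 :: complex)" using n by auto
  then show "- (a * d - b * c) * (of_nat n - 1) / 6 \<noteq> 0" using \<Delta> by auto
next
  fix W \<omega> X p q J' assume X: "bipower_web n P u1 u2 v1 v2 a b c d W \<omega> X" and z: "(p, q) \<in> W"
  interpret bipower_web n P u1 u2 v1 v2 a b c d W \<omega> X by (rule X)
  show "Q1 p \<noteq> 0 \<and> Q2 p \<noteq> 0" using Q1_nz[OF z] Q2_nz[OF z] by simp
  assume "((\<lambda>p. (of_nat n + 1) * U p * V p / (Q1 p * Q2 p)) has_field_derivative J') (at p)"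
  then show "web_curvature (n + 1) \<omega> (p, q) = - (a * d - b * c) * (of_nat n - 1) / 6 * J' / q"
    by (intro curvature_line[OF _ _ z, of s0 0]) (use assms in \<open>auto simp: algebra_simps\<close>)
next
  fix K p assume K: "K * a * c = 0 \<and> K * b * d = 0 \<and> of_nat n + 1 = K * (a * d + b * c)" and Q: "Q1 p \<noteq> 0 \<and> Q2 p \<noteq> 0"
  have "(of_nat n + 1) * U p * V p = K * (Q1 p * Q2 p)" using K unfolding Q1_def Q2_def by algebra
  then show "(of_nat n + 1) * U p * V p / (Q1 p * Q2 p) = K" using Q by simp
next
  fix K S assume "infinite S" "\<And>p. p \<in> S \<Longrightarrow> good p \<and> (of_nat n + 1) * U p * V p / (Q1 p * Q2 p) = K"
  then show "K * a * c = 0 \<and> K * b * d = 0 \<and> of_nat n + 1 = K * (a * d + b * c)" by (rule quadratic_criterion)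
qed (use assms J_differentiable(1) in \<open>auto simp: good_def\<close>)

theorem flat_general_line:
  assumes "s0 \<noteq> 0" "fst P = vector [s0 * (u1 - v1), s0 * (u2 - v2), 0]"
  shows "leg_flat (n + 1) P \<longleftrightarrow> (\<exists>K. - 3 * c = K * a * c * (a + c) \<and>
    (of_nat n - 2) * (a + c) - 3 * (d - a) + 3 * c = K * (a * c * (b + d) + (a * d + b * c) * (a + c)) \<and>
    (of_nat n - 2) * (b + d) + 3 * b + 3 * (d - a) = K * ((a * d + b * c) * (b + d) + b * d * (a + c)) \<and>
    - 3 * b = K * b * d * (b + d))"
proof (rule flat_iff_constant[where J = "\<lambda>p. ((of_nat n - 2) * U p * V p
      + - 3 * (U p - V p) * (Q1 p * U p - Q2 p * V p) / (Q1 p + Q2 p)) / (Q1 p * Q2 p)"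
      and dm = "\<lambda>p. Q1 p \<noteq> 0 \<and> Q2 p \<noteq> 0 \<and> Q1 p + Q2 p \<noteq> 0"
      and \<mu> = "- (a * d - b * c) * (of_nat n - 1) / 6", OF assms(1)])
  have "of_nat n \<noteq> (1 :: complex)" using n by auto
  then show "- (a * d - b * c) * (of_nat n - 1) / 6 \<noteq> 0" using \<Delta> by auto
  show "fst P = vector [0, 0, s0] \<or> (\<exists>t0\<in>{0, 1}. fst P = vector [s0 * (u1 - t0 * v1), s0 * (u2 - t0 * v2), 0])"
    using assms(2) by simp
next
  fix W \<omega> X p q J' assume X: "bipower_web n P u1 u2 v1 v2 a b c d W \<omega> X" and z: "(p, q) \<in> W"
  interpret bipower_web n P u1 u2 v1 v2 a b c d W \<omega> X by (rule X)
  have l: "fst P = vector [s0 * (u1 - 1 * v1), s0 * (u2 - 1 * v2), 0]" using assms by simp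
  show "Q1 p \<noteq> 0 \<and> Q2 p \<noteq> 0 \<and> Q1 p + Q2 p \<noteq> 0"
    using Q1_nz[OF z] Q2_nz[OF z] line_Q_sum_nz[OF l _ z] by simp
  assume "((\<lambda>p. ((of_nat n - 2) * U p * V p
      + - 3 * (U p - V p) * (Q1 p * U p - Q2 p * V p) / (Q1 p + Q2 p)) / (Q1 p * Q2 p)) has_field_derivative J') (at p)"
  then show "web_curvature (n + 1) \<omega> (p, q) = - (a * d - b * c) * (of_nat n - 1) / 6 * J' / q"
    by (intro curvature_line[OF l _ z]) auto
next
  fix p assume "Q1 p \<noteq> 0 \<and> Q2 p \<noteq> 0 \<and> Q1 p + Q2 p \<noteq> 0"
  then show "\<exists>J'. ((\<lambda>p. ((of_nat n - 2) * U p * V p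
      + - 3 * (U p - V p) * (Q1 p * U p - Q2 p * V p) / (Q1 p + Q2 p)) / (Q1 p * Q2 p)) has_field_derivative J') (at p)"
    by (intro J_differentiable(2)) auto
next
  fix K p assume K: "- 3 * c = K * a * c * (a + c) \<and>
    (of_nat n - 2) * (a + c) - 3 * (d - a) + 3 * c = K * (a * c * (b + d) + (a * d + b * c) * (a + c)) \<and>
    (of_nat n - 2) * (b + d) + 3 * b + 3 * (d - a) = K * ((a * d + b * c) * (b + d) + b * d * (a + c)) \<and>
    - 3 * b = K * b * d * (b + d)" and Q: "Q1 p \<noteq> 0 \<and> Q2 p \<noteq> 0 \<and> Q1 p + Q2 p \<noteq> 0"
  define m :: complex where "m = of_nat n - 2"
  have "(m * U p * V p) * (Q1 p + Q2 p) + - 3 * (U p - V p) * (Q1 p * U p - Q2 p * V p) = K * (Q1 p * Q2 p) * (Q1 p + Q2 p)"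
    using K unfolding m_def[symmetric] Q1_def Q2_def by algebra
  moreover have "y + z / s = K * t" if "y * s + z = K * t * s" "s \<noteq> 0" for y z s t :: complex
    using that by (simp add: field_simps)
  ultimately have "m * U p * V p + - 3 * (U p - V p) * (Q1 p * U p - Q2 p * V p) / (Q1 p + Q2 p) = K * (Q1 p * Q2 p)"
    using Q by blast
  then show "((of_nat n - 2) * U p * V p + - 3 * (U p - V p) * (Q1 p * U p - Q2 p * V p) / (Q1 p + Q2 p)) / (Q1 p * Q2 p) = K"
    unfolding m_def[symmetric] using Q by simp
next
  fix K S assume "infinite S" "\<And>p. p \<in> S \<Longrightarrow> good p \<and> ((of_nat n - 2) * U p * V p
      + - 3 * (U p - V p) * (Q1 p * U p - Q2 p * V p) / (Q1 p + Q2 p)) / (Q1 p * Q2 p) = K"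
  then show "- 3 * c = K * a * c * (a + c) \<and>
    (of_nat n - 2) * (a + c) - 3 * (d - a) + 3 * c = K * (a * c * (b + d) + (a * d + b * c) * (a + c)) \<and>
    (of_nat n - 2) * (b + d) + 3 * b + 3 * (d - a) = K * ((a * d + b * c) * (b + d) + b * d * (a + c)) \<and>
    - 3 * b = K * b * d * (b + d)"
    by (rule cubic_criterion)
qed (auto simp: good_def)

end

section \<open>Linear conjugation\<close>

lemma vec3_eq_iff: "v = w \<longleftrightarrow> v$1 = w$1 \<and> v$2 = w$2 \<and> v$3 = w$3" for v w :: "'a ^ 3"
  by (simp add: vec_eq_iff forall_3)

lemma pullback_pullback: "pullback g (pullback h P) = pullback (h ** g) P"
  unfolding pullback_def by (simp only: matrix_transpose_mul matrix_vector_mul_assoc fst_conv snd_conv)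

lemma pullback_id: "pullback (mat 1) P = P"
  unfolding pullback_def by (simp add: transpose_mat)

lemma same_prefoliation_refl: "same_prefoliation P P"
  unfolding same_prefoliation_def by (auto intro!: exI[of _ 1])

lemma same_prefoliation_sym:
  assumes "same_prefoliation P Q"
  shows "same_prefoliation Q P"
proof -
  from assms obtain c e where "c \<noteq> 0" "fst Q = c *s fst P" "e \<noteq> 0" "\<And>v. snd Q v = e *s snd P v"
    unfolding same_prefoliation_def by blast
  then show ?thesis unfolding same_prefoliation_def
    by (intro conjI exI[of _ "1 / c"] exI[of _ "1 / e"]) (auto simp: vector_smult_assoc)
qed

lemma same_prefoliation_trans:
  assumes "same_prefoliation P Q" "same_prefoliation Q S"
  shows "same_prefoliation P S"
proof -
  from assms obtain c e c' e' where "c \<noteq> 0" "fst Q = c *s fst P" "e \<noteq> 0" "\<And>v. snd Q v = e *s snd P v"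
    "c' \<noteq> 0" "fst S = c' *s fst Q" "e' \<noteq> 0" "\<And>v. snd S v = e' *s snd Q v"
    unfolding same_prefoliation_def by blast
  then show ?thesis unfolding same_prefoliation_def
    by (intro conjI exI[of _ "c' * c"] exI[of _ "e' * e"]) (auto simp: vector_smult_assoc)
qed

lemma same_prefoliation_pullback:
  assumes "same_prefoliation P Q"
  shows "same_prefoliation (pullback g P) (pullback g Q)"
  using assms unfolding same_prefoliation_def pullback_def by (auto simp: vector_scalar_commute simp del: transpose_matrix_vector)

lemma linearly_conjugate_sym:
  assumes "linearly_conjugate P Q"
  shows "linearly_conjugate Q P"
proof -
  obtain g where g: "invertible g" "same_prefoliation (pullback g P) Q" using assms unfolding linearly_conjugate_def by blast
  from g(1) obtain h where h: "g ** h = mat 1" "h ** g = mat 1" unfolding invertible_def by blast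
  have "same_prefoliation (pullback h (pullback g P)) (pullback h Q)" by (rule same_prefoliation_pullback[OF g(2)])
  then have "same_prefoliation (pullback h Q) P" by (simp add: pullback_pullback h pullback_id same_prefoliation_sym)
  then show ?thesis using h unfolding linearly_conjugate_def invertible_def by blast
qed

lemma linearly_conjugate_trans:
  assumes "linearly_conjugate P Q" "linearly_conjugate Q S"
  shows "linearly_conjugate P S"
proof -
  obtain g h where g: "invertible g" "same_prefoliation (pullback g P) Q" and h: "invertible h" "same_prefoliation (pullback h Q) S"
    using assms unfolding linearly_conjugate_def by blast
  have "same_prefoliation (pullback (g ** h) P) S"
    using same_prefoliation_trans[OF same_prefoliation_pullback[OF g(2), of h] h(2)] by (simp add: pullback_pullback)
  then show ?thesis using invertible_mult[OF g(1) h(1)] unfolding linearly_conjugate_def by blast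
qed

lemma linearly_conjugate_pullback:
  assumes "invertible g"
  shows "linearly_conjugate P (pullback g P)"
  using assms same_prefoliation_refl unfolding linearly_conjugate_def by blast

section \<open>Conjugations that are linear in the affine chart\<close>

definition blk :: "complex \<Rightarrow> complex \<Rightarrow> complex \<Rightarrow> complex \<Rightarrow> complex ^ 3 ^ 3" where
  "blk u1 u2 v1 v2 = vector [vector [u1, u2, 0], vector [v1, v2, 0], vector [0, 0, 1]]"

lemma blk_mult: "blk u1 u2 v1 v2 ** blk r1 r2 s1 s2 =
    blk (u1 * r1 + u2 * s1) (u1 * r2 + u2 * s2) (v1 * r1 + v2 * s1) (v1 * r2 + v2 * s2)"
  unfolding blk_def by (simp add: vec_eq_iff forall_3 matrix_matrix_mult_def sum_3)

lemma blk_id: "blk 1 0 0 1 = mat 1"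
  unfolding blk_def by (simp add: vec_eq_iff forall_3 mat_def)

lemma blk_inverse:
  assumes "u1 * v2 - u2 * v1 \<noteq> 0"
  defines "e \<equiv> u1 * v2 - u2 * v1"
  shows "blk u1 u2 v1 v2 ** blk (v2 / e) (- u2 / e) (- v1 / e) (u1 / e) = mat 1"
    "blk (v2 / e) (- u2 / e) (- v1 / e) (u1 / e) ** blk u1 u2 v1 v2 = mat 1"
    "v2 / e * (u1 / e) - (- u2 / e) * (- v1 / e) \<noteq> 0"
proof -
  have e: "e \<noteq> 0" "u1 * v2 = e + u2 * v1" using assms by auto
  then show "blk u1 u2 v1 v2 ** blk (v2 / e) (- u2 / e) (- v1 / e) (u1 / e) = mat 1"
    "blk (v2 / e) (- u2 / e) (- v1 / e) (u1 / e) ** blk u1 u2 v1 v2 = mat 1"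
    unfolding blk_mult blk_id[symmetric] by (auto simp: field_simps)
  have "v2 / e * (u1 / e) - (- u2 / e) * (- v1 / e) = e / (e * e)" using e by (simp add: field_simps)
  then show "v2 / e * (u1 / e) - (- u2 / e) * (- v1 / e) \<noteq> 0" using e by simp
qed

lemma pullback_affine_form: "pullback (blk u1 u2 v1 v2) (l, affine_form A B) =
    (vector [u1 * l$1 + v1 * l$2, u2 * l$1 + v2 * l$2, l$3],
     affine_form (\<lambda>x y. u1 * A (u1 * x + u2 * y) (v1 * x + v2 * y) + v1 * B (u1 * x + u2 * y) (v1 * x + v2 * y))
       (\<lambda>x y. u2 * A (u1 * x + u2 * y) (v1 * x + v2 * y) + v2 * B (u1 * x + u2 * y) (v1 * x + v2 * y)))"
  unfolding pullback_def blk_def affine_form_def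
  by (auto simp: fun_eq_iff vec_eq_iff forall_3 matrix_vector_mult_def transpose_def sum_3 algebra_simps)

lemma pullback_line: "fst (pullback (blk u1 u2 v1 v2) (l, \<Omega>)) =
    vector [u1 * l$1 + v1 * l$2, u2 * l$1 + v2 * l$2, l$3]"
  unfolding pullback_def blk_def
  by (auto simp: vec_eq_iff forall_3 matrix_vector_mult_def transpose_def sum_3 algebra_simps)

text \<open>Conjugation by automorphisms that fix the origin and preserve the line at infinity. They
  act linearly on \<open>(x, y)\<close>, so they only replace the linear forms \<open>u\<close>,
  \<open>v\<close> of a normal form.\<close>

definition chart_conjugate :: "prefoliation \<Rightarrow> prefoliation \<Rightarrow> bool" where
  "chart_conjugate P Q \<longleftrightarrow> (\<exists>u1 u2 v1 v2. u1 * v2 - u2 * v1 \<noteq> 0 \<and> same_prefoliation (pullback (blk u1 u2 v1 v2) P) Q)"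

lemma chart_conjugateI:
  assumes "u1 * v2 - u2 * v1 \<noteq> 0" "same_prefoliation (pullback (blk u1 u2 v1 v2) P) Q"
  shows "chart_conjugate P Q"
  using assms unfolding chart_conjugate_def by blast

lemma chart_conjugate_sym:
  assumes "chart_conjugate P Q"
  shows "chart_conjugate Q P"
proof -
  obtain u1 u2 v1 v2 where D: "u1 * v2 - u2 * v1 \<noteq> 0" and s: "same_prefoliation (pullback (blk u1 u2 v1 v2) P) Q"
    using assms unfolding chart_conjugate_def by blast
  define e where "e = u1 * v2 - u2 * v1"
  note inv = blk_inverse[OF D, folded e_def]
  have "same_prefoliation P (pullback (blk (v2 / e) (- u2 / e) (- v1 / e) (u1 / e)) Q)"
    using same_prefoliation_pullback[OF s, of "blk (v2 / e) (- u2 / e) (- v1 / e) (u1 / e)"]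
    by (simp only: pullback_pullback inv pullback_id)
  then show ?thesis using chart_conjugateI[OF inv(3)] same_prefoliation_sym by blast
qed

lemma chart_conjugate_trans:
  assumes "chart_conjugate P Q" "chart_conjugate Q S"
  shows "chart_conjugate P S"
proof -
  obtain u1 u2 v1 v2 where D: "u1 * v2 - u2 * v1 \<noteq> 0" and s: "same_prefoliation (pullback (blk u1 u2 v1 v2) P) Q"
    using assms(1) unfolding chart_conjugate_def by blast
  obtain r1 r2 s1 s2 where D': "r1 * s2 - r2 * s1 \<noteq> 0" and s': "same_prefoliation (pullback (blk r1 r2 s1 s2) Q) S"
    using assms(2) unfolding chart_conjugate_def by blast
  have "same_prefoliation (pullback (blk (u1 * r1 + u2 * s1) (u1 * r2 + u2 * s2) (v1 * r1 + v2 * s1) (v1 * r2 + v2 * s2)) P) S"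
    using same_prefoliation_trans[OF same_prefoliation_pullback[OF s, of "blk r1 r2 s1 s2"] s'] by (simp only: pullback_pullback blk_mult)
  moreover have "(u1 * r1 + u2 * s1) * (v1 * r2 + v2 * s2) - (u1 * r2 + u2 * s2) * (v1 * r1 + v2 * s1)
    = (u1 * v2 - u2 * v1) * (r1 * s2 - r2 * s1)" by algebra
  ultimately show ?thesis using D D' chart_conjugateI by (metis mult_eq_0_iff)
qed

lemma chart_conjugate_imp_linearly_conjugate:
  assumes "chart_conjugate P Q"
  shows "linearly_conjugate P Q"
proof -
  obtain u1 u2 v1 v2 where D: "u1 * v2 - u2 * v1 \<noteq> 0" and s: "same_prefoliation (pullback (blk u1 u2 v1 v2) P) Q"
    using assms unfolding chart_conjugate_def by blast
  then show ?thesis using blk_inverse[OF D] unfolding linearly_conjugate_def invertible_def by blast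
qed

lemma affine_form_smult: "affine_form (\<lambda>x y. k * A x y) (\<lambda>x y. k * B x y) v = k *s affine_form A B v"
  unfolding affine_form_def by (auto simp: vec_eq_iff forall_3 algebra_simps)

section \<open>Binary forms\<close>

definition bform :: "nat \<Rightarrow> (nat \<Rightarrow> complex) \<Rightarrow> complex \<Rightarrow> complex \<Rightarrow> complex" where
  "bform n a x y = (\<Sum>i\<le>n. a i * x ^ i * y ^ (n - i))"

lemma bform_add: "bform n a x y + bform n b x y = bform n (\<lambda>i. a i + b i) x y"
  unfolding bform_def by (simp add: sum.distrib algebra_simps)

lemma bform_smult: "k * bform n a x y = bform n (\<lambda>i. k * a i) x y"
  unfolding bform_def by (simp add: sum_distrib_left mult_ac)

lemma bform_homogeneous: "bform n a (k * x) (k * y) = k ^ n * bform n a x y"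
proof -
  have "a i * (k * x) ^ i * (k * y) ^ (n - i) = k ^ n * (a i * x ^ i * y ^ (n - i))" if "i \<le> n" for i
  proof -
    have "k ^ n = k ^ i * k ^ (n - i)" using that by (simp add: power_add[symmetric])
    then show ?thesis by (simp add: power_mult_distrib mult_ac)
  qed
  then show ?thesis unfolding bform_def sum_distrib_left by (intro sum.cong) auto
qed

lemma bform_mult_x: "x * bform n a x y = bform (Suc n) (\<lambda>i. if i = 0 then 0 else a (i - 1)) x y"
  unfolding bform_def sum.atMost_Suc_shift by (simp add: sum_distrib_left mult_ac)

lemma bform_mult_y: "y * bform n a x y = bform (Suc n) (\<lambda>i. if i = Suc n then 0 else a i) x y"
  unfolding bform_def by (auto simp: sum_distrib_left Suc_diff_le intro!: sum.cong)

text \<open>If \<open>y0 = 0\<close>, the zero means that the top coefficient vanishes, and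
  \<open>y\<close> factors out. Otherwise \<open>x0 / y0\<close> is a root of the dehomogenised
  polynomial.\<close>

lemma bform_linear_factor:
  assumes z: "bform (Suc n) a x0 y0 = 0" "(x0, y0) \<noteq> (0, 0)"
  obtains b where "\<And>x y. bform (Suc n) a x y = (y0 * x - x0 * y) * bform n b x y"
proof (cases "y0 = 0")
  case True
  then have "x0 \<noteq> 0" using z by simp
  have "bform (Suc n) a x0 0 = a (Suc n) * x0 ^ Suc n"
    unfolding bform_def by (simp add: power_0_left Suc_diff_le)
  then have an: "a (Suc n) = 0" using z True \<open>x0 \<noteq> 0\<close> by simp
  have "bform (Suc n) a x y = (y0 * x - x0 * y) * bform n (\<lambda>i. - (1 / x0) * a i) x y" for x y
  proof -
    have "(y0 * x - x0 * y) * bform n (\<lambda>i. - (1 / x0) * a i) x y = y * bform n a x y"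
      unfolding bform_smult[symmetric] using True \<open>x0 \<noteq> 0\<close> by simp
    also have "\<dots> = bform (Suc n) a x y"
      unfolding bform_mult_y unfolding bform_def using an by (intro sum.cong) auto
    finally show ?thesis ..
  qed
  then show ?thesis by (rule that)
next
  case False
  define r where "r = x0 / y0"
  define p where "p = (\<Sum>i\<le>Suc n. monom (a i) i)"
  have cp: "coeff p i = (if i \<le> Suc n then a i else 0)" for i
    unfolding p_def by (auto simp: coeff_sum coeff_monom sum.delta)
  have "y0 ^ Suc n * poly p r = bform (Suc n) a x0 y0"
  proof -
    have "y0 ^ Suc n * (a i * r ^ i) = a i * x0 ^ i * y0 ^ (Suc n - i)" if "i \<le> Suc n" for i
    proof -
      have "y0 ^ Suc n = y0 ^ i * y0 ^ (Suc n - i)" using that by (simp add: power_add[symmetric] del: power_Suc)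
      then show ?thesis unfolding r_def using False by (simp add: power_divide del: power_Suc)
    qed
    then show ?thesis unfolding p_def poly_sum poly_monom bform_def sum_distrib_left by (intro sum.cong) auto
  qed
  then have "poly p r = 0" using z False by simp
  then obtain q where q: "p = [:- r, 1:] * q" by (auto simp: poly_eq_0_iff_dvd dvd_def)
  have dq: "coeff q i = 0" if "i \<ge> Suc n" for i
  proof (cases "q = 0")
    case False
    have "degree p \<le> Suc n" unfolding degree_le cp by (simp add: degree_le cp)
    moreover have "degree p = Suc (degree q)" unfolding q using False by (subst degree_mult_eq) auto
    ultimately show ?thesis using that by (intro coeff_eq_0) simp
  qed simp
  have ca: "a i = (if i = 0 then 0 else coeff q (i - 1)) - r * coeff q i" if "i \<le> Suc n" for i
    using cp[of i] that unfolding q by (simp add: coeff_pCons split: nat.splits)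
  have "bform (Suc n) a x y = (y0 * x - x0 * y) * bform n (\<lambda>i. 1 / y0 * coeff q i) x y" for x y
  proof -
    have "(y0 * x - x0 * y) * bform n (\<lambda>i. 1 / y0 * coeff q i) x y = x * bform n (coeff q) x y + (- r) * (y * bform n (coeff q) x y)"
      unfolding bform_smult[symmetric] r_def using False by (simp add: field_simps)
    also have "\<dots> = bform (Suc n) a x y"
      unfolding bform_mult_x bform_mult_y bform_smult bform_add
      unfolding bform_def by (intro sum.cong) (auto simp: ca dq)
    finally show ?thesis ..
  qed
  then show ?thesis by (rule that)
qed

lemma bform_linear_subst:
  "\<exists>b. \<forall>s t. bform n a (s * e1 + t * f1) (s * e2 + t * f2) = bform n b s t"
proof -
  have mult: "\<exists>b. \<forall>s t. (s * p + t * q) * bform m a s t = bform (Suc m) b s t" for p q m a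
  proof -
    have "(s * p + t * q) * bform m a s t = p * (s * bform m a s t) + q * (t * bform m a s t)" for s t
      by (simp add: algebra_simps)
    then show ?thesis unfolding bform_mult_x bform_mult_y bform_smult bform_add by blast
  qed
  have pw: "\<exists>b. \<forall>s t. (s * p + t * q) ^ i * bform m a s t = bform (i + m) b s t" for p q i m a
  proof (induction i)
    case 0
    show ?case by auto
  next
    case (Suc i)
    then obtain b where b: "\<And>s t. (s * p + t * q) ^ i * bform m a s t = bform (i + m) b s t" by blast
    then have "(s * p + t * q) ^ Suc i * bform m a s t = (s * p + t * q) * bform (i + m) b s t" for s t
      by (simp only: power_Suc mult.assoc b)
    moreover obtain b' where "\<And>s t. (s * p + t * q) * bform (i + m) b s t = bform (Suc (i + m)) b' s t"
      using mult by blast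
    ultimately show ?case by (intro exI[of _ b']) (simp del: power_Suc)
  qed
  have mono: "\<exists>b. \<forall>s t. a i * (s * e1 + t * f1) ^ i * (s * e2 + t * f2) ^ (n - i) = bform n b s t" if "i \<le> n" for i
  proof -
    obtain b where b: "\<And>s t. (s * e2 + t * f2) ^ (n - i) * bform 0 (\<lambda>_. a i) s t = bform (n - i) b s t"
      using pw[of e2 f2 "n - i" 0 "\<lambda>_. a i"] by auto
    obtain b' where b': "\<And>s t. (s * e1 + t * f1) ^ i * bform (n - i) b s t = bform (i + (n - i)) b' s t"
      using pw[of e1 f1 i "n - i" b] by auto
    have "a i * (s * e1 + t * f1) ^ i * (s * e2 + t * f2) ^ (n - i) = bform n b' s t" for s t
      using b'[of s t] that unfolding b[symmetric] by (simp add: bform_def mult_ac)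
    then show ?thesis by blast
  qed
  then obtain b where b: "\<And>i s t. i \<le> n \<Longrightarrow> a i * (s * e1 + t * f1) ^ i * (s * e2 + t * f2) ^ (n - i) = bform n (b i) s t"
    by metis
  have "bform n a (s * e1 + t * f1) (s * e2 + t * f2) = bform n (\<lambda>j. \<Sum>i\<le>n. b i j) s t" for s t
  proof -
    have "bform n a (s * e1 + t * f1) (s * e2 + t * f2) = (\<Sum>i\<le>n. bform n (b i) s t)"
      unfolding bform_def[of n a] using b by (intro sum.cong) auto
    also have "\<dots> = bform n (\<lambda>j. \<Sum>i\<le>n. b i j) s t"
      unfolding bform_def sum_distrib_right by (rule sum.swap)
    finally show ?thesis .
  qed
  then show ?thesis by blast
qed

section \<open>Ternary forms sorted by powers of \<open>Z\<close>\<close>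

lemma hom_poly_bform: "hom_poly (k + n) (\<lambda>v. v$3 ^ k * bform n a (v$1) (v$2))"
  unfolding hom_poly_def
proof (intro exI allI)
  fix v :: "complex ^ 3"
  define c where "c i j = (if i + j = n then a i else 0)" for i j
  have "(\<Sum>j\<le>k + n - i. c i j * v$1 ^ i * v$2 ^ j * v$3 ^ (k + n - i - j))
    = (if i \<le> n then v$3 ^ k * (a i * v$1 ^ i * v$2 ^ (n - i)) else 0)" if "i \<le> k + n" for i
  proof (cases "i \<le> n")
    case True
    have "(\<Sum>j\<le>k + n - i. c i j * v$1 ^ i * v$2 ^ j * v$3 ^ (k + n - i - j))
      = (\<Sum>j\<in>{n - i}. c i j * v$1 ^ i * v$2 ^ j * v$3 ^ (k + n - i - j))"
      using True by (intro sum.mono_neutral_right) (auto simp: c_def)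
    then show ?thesis using True by (simp add: c_def)
  next
    case False
    then show ?thesis by (auto simp: c_def intro!: sum.neutral)
  qed
  then have "(\<Sum>i\<le>k + n. \<Sum>j\<le>k + n - i. c i j * v$1 ^ i * v$2 ^ j * v$3 ^ (k + n - i - j))
    = (\<Sum>i\<le>k + n. if i \<le> n then v$3 ^ k * (a i * v$1 ^ i * v$2 ^ (n - i)) else 0)"
    by (intro sum.cong) auto
  also have "\<dots> = (\<Sum>i\<le>n. v$3 ^ k * (a i * v$1 ^ i * v$2 ^ (n - i)))"
    by (intro sum.mono_neutral_cong_right) auto
  finally show "v$3 ^ k * bform n a (v$1) (v$2)
    = (\<Sum>i\<le>k + n. \<Sum>j\<le>k + n - i. c i j * v$1 ^ i * v$2 ^ j * v$3 ^ (k + n - i - j))"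
    unfolding bform_def sum_distrib_left by simp
qed

text \<open>Homotheties of the chart scale \<open>X\<close>, \<open>Y\<close> and fix
  \<open>Z\<close>, so the exponent of \<open>Z\<close> is what separates the weights.\<close>

lemma hom_poly_decompose:
  assumes "hom_poly m f"
  obtains A where "\<And>v. f v = (\<Sum>k\<le>m. bform (m - k) (A k) (v$1) (v$2) * v$3 ^ k)"
proof -
  obtain c where c: "\<And>v. f v = (\<Sum>i\<le>m. \<Sum>j\<le>m - i. c i j * v$1 ^ i * v$2 ^ j * v$3 ^ (m - i - j))"
    using assms unfolding hom_poly_def by blast
  have "f v = (\<Sum>k\<le>m. bform (m - k) (\<lambda>i. c i (m - k - i)) (v$1) (v$2) * v$3 ^ k)" for v
  proof -
    have "f v = (\<Sum>(i, j)\<in>(SIGMA i:{..m}. {..m - i}). c i j * v$1 ^ i * v$2 ^ j * v$3 ^ (m - i - j))"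
      unfolding c by (rule sum.Sigma) auto
    also have "\<dots> = (\<Sum>(k, i)\<in>(SIGMA k:{..m}. {..m - k}). c i (m - k - i) * v$1 ^ i * v$2 ^ (m - k - i) * v$3 ^ k)"
      by (rule sum.reindex_bij_witness[of _ "\<lambda>(k, i). (i, m - k - i)" "\<lambda>(i, j). (m - i - j, i)"]) auto
    also have "\<dots> = (\<Sum>k\<le>m. \<Sum>i\<le>m - k. c i (m - k - i) * v$1 ^ i * v$2 ^ (m - k - i) * v$3 ^ k)"
      by (rule sum.Sigma[symmetric]) auto
    finally show ?thesis unfolding bform_def sum_distrib_right .
  qed
  then show ?thesis by (rule that)
qed

section \<open>Homogeneous foliations\<close>

text \<open>Coprimality of the two binary forms, expressed by zeros since the field is algebraically
  closed.\<close>

definition no_common_zero :: "nat \<Rightarrow> (nat \<Rightarrow> complex) \<Rightarrow> (nat \<Rightarrow> complex) \<Rightarrow> bool" where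
  "no_common_zero n \<alpha> \<beta> \<longleftrightarrow> (\<forall>x y. (x, y) \<noteq> (0, 0) \<longrightarrow> bform n \<alpha> x y \<noteq> 0 \<or> bform n \<beta> x y \<noteq> 0)"

lemma hom_poly_zero: "hom_poly n (\<lambda>v. 0)"
  unfolding hom_poly_def by (intro exI[of _ "\<lambda>_ _. 0"]) simp

lemma foliation_no_factor:
  assumes "foliation m \<Omega>" "1 \<le> k" "k \<le> m + 1" "hom_poly k h" "\<And>i. hom_poly (m + 1 - k) (\<lambda>v. Q v $ i)"
  shows "\<not> (\<forall>v. \<Omega> v = h v *s Q v)"
  using assms unfolding foliation_def by blast

lemma coeff_compare:
  fixes a b :: "nat \<Rightarrow> complex"
  assumes "\<And>z. (\<Sum>k\<le>m. a k * z ^ k) = (\<Sum>k\<le>m. b k * z ^ k)" "k \<le> m"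
  shows "a k = b k"
  using assms polyfun_eq_coeffs[where c = a and d = b and n = m] by blast

text \<open>Comparing weights under the single homothety of ratio 2 leaves one power of \<open>Z\<close> in each component.\<close>

lemma homothety_weight:
  fixes A :: "nat \<Rightarrow> nat \<Rightarrow> complex"
  assumes f: "\<And>v. f v = (\<Sum>k\<le>m. bform (m - k) (A k) (v$1) (v$2) * v$3 ^ k)"
    and inv: "\<And>v. f v = \<gamma> * f (homothety 2 *v v)" and k: "k \<le> m" "\<gamma> * 2 ^ (m - k) \<noteq> 1"
  shows "bform (m - k) (A k) x y = 0"
proof -
  have h: "homothety 2 *v vector [x, y, z] = vector [2 * x, 2 * y, z]" for z
    unfolding homothety_def by (simp add: vec_eq_iff forall_3 matrix_vector_mult_def sum_3)
  have "(\<Sum>k\<le>m. bform (m - k) (A k) x y * z ^ k) = (\<Sum>k\<le>m. (\<gamma> * 2 ^ (m - k) * bform (m - k) (A k) x y) * z ^ k)" for z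
    using inv[of "vector [x, y, z]"] unfolding f h sum_distrib_left vector_3 bform_homogeneous
    by (simp add: mult_ac)
  from coeff_compare[where a = "\<lambda>k. bform (m - k) (A k) x y" and b = "\<lambda>k. \<gamma> * 2 ^ (m - k) * bform (m - k) (A k) x y", OF this k(1)]
  have "bform (m - k) (A k) x y = \<gamma> * 2 ^ (m - k) * bform (m - k) (A k) x y" .
  then have "(1 - \<gamma> * 2 ^ (m - k)) * bform (m - k) (A k) x y = 0" by (simp add: algebra_simps)
  then show ?thesis using k(2) by simp
qed

text \<open>The ratio 2 is not a root of unity, so a single homothety already tells all weights
  apart.\<close>

lemma homothety_weight_unique:
  fixes \<gamma> :: complex
  assumes "\<gamma> * 2 ^ i = 1" "\<gamma> * 2 ^ j = 1"
  shows "i = j"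
proof -
  have "\<gamma> \<noteq> 0" using assms by auto
  then have "(2 :: complex) ^ i = 2 ^ j" using assms by (metis mult_left_cancel)
  then have "(2 :: nat) ^ i = 2 ^ j" by (metis of_nat_eq_iff of_nat_numeral of_nat_power)
  then show ?thesis by simp
qed

lemma homothety_component:
  assumes hp: "hom_poly m f" and inv: "\<And>v. f v = \<gamma> * f (homothety 2 *v v)"
  shows "(\<forall>v. f v = 0) \<or> (\<exists>k a. k \<le> m \<and> \<gamma> * 2 ^ (m - k) = 1 \<and> (\<forall>v. f v = v$3 ^ k * bform (m - k) a (v$1) (v$2)))"
proof -
  obtain A where f: "\<And>v. f v = (\<Sum>k\<le>m. bform (m - k) (A k) (v$1) (v$2) * v$3 ^ k)"
    using hom_poly_decompose[OF hp] by blast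
  show ?thesis
  proof (cases "\<exists>k\<le>m. \<gamma> * 2 ^ (m - k) = 1")
    case True
    then obtain k where k: "k \<le> m" "\<gamma> * 2 ^ (m - k) = 1" by blast
    have uniq: "\<gamma> * 2 ^ (m - j) \<noteq> 1" if "j \<le> m" "j \<noteq> k" for j
    proof
      assume "\<gamma> * 2 ^ (m - j) = 1"
      then have "m - j = m - k" using k(2) by (rule homothety_weight_unique)
      then show False using that k(1) by simp
    qed
    have "f v = v$3 ^ k * bform (m - k) (A k) (v$1) (v$2)" for v
    proof -
      have "f v = (\<Sum>j\<in>{k}. bform (m - j) (A j) (v$1) (v$2) * v$3 ^ j)"
        unfolding f using k homothety_weight[OF f inv] uniq by (intro sum.mono_neutral_right) auto
      then show ?thesis by simp
    qed
    then show ?thesis using k by blast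
  next
    case False
    then have "f v = 0" for v unfolding f using homothety_weight[OF f inv] by (intro sum.neutral) auto
    then show ?thesis by blast
  qed
qed

lemma transpose_homothety: "transpose (homothety t) *v w = vector [t * w$1, t * w$2, w$3]"
  unfolding homothety_def
  by (simp add: vec3_eq_iff matrix_vector_mult_def transpose_def sum_3 del: transpose_matrix_vector)

lemma homothety_invariant_line:
  assumes "homothety_invariant P"
  shows "fst P $ 3 = 0 \<or> fst P $ 1 = 0 \<and> fst P $ 2 = 0"
proof -
  have "same_prefoliation (pullback (homothety 2) P) P" using assms unfolding homothety_invariant_def by simp
  then obtain c where "fst P = c *s (transpose (homothety 2) *v fst P)"
    unfolding same_prefoliation_def pullback_def by auto
  then have "fst P $ 1 = c * (2 * fst P $ 1)" "fst P $ 2 = c * (2 * fst P $ 2)" "fst P $ 3 = c * fst P $ 3"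
    unfolding vec3_eq_iff transpose_homothety by simp_all
  then show ?thesis by (cases "c = 1") auto
qed

text \<open>Under the homothety the first two components have multiplier \<open>2 \<gamma>\<close>,
  the third \<open>\<gamma>\<close>. Each nonzero component is a power of \<open>Z\<close> times a
  binary form, and the multipliers tie the exponents together. Excluding common factors leaves one
  possibility: \<open>Z\<close> to the first power in the nonzero ones among the first two
  components, and none in the third.\<close>

lemma homogeneous_foliation:
  assumes fol: "foliation n \<Omega>" and n: "n \<ge> 1"
    and inv: "\<And>v. \<Omega> v = \<gamma> *s (transpose (homothety 2) *v \<Omega> (homothety 2 *v v))"
  obtains \<alpha> \<beta> where "\<Omega> = affine_form (bform n \<alpha>) (bform n \<beta>)" "no_common_zero n \<alpha> \<beta>"
proof -
  have hp: "hom_poly (n + 1) (\<lambda>v. \<Omega> v $ i)" for i using fol unfolding foliation_def by blast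
  have rad: "v$1 * \<Omega> v $ 1 + v$2 * \<Omega> v $ 2 + v$3 * \<Omega> v $ 3 = 0" for v
    using fol unfolding foliation_def sum_3 by blast
  note no_factor = foliation_no_factor[OF fol]
  have inv': "\<Omega> v $ 1 = (2 * \<gamma>) * \<Omega> (homothety 2 *v v) $ 1" "\<Omega> v $ 2 = (2 * \<gamma>) * \<Omega> (homothety 2 *v v) $ 2"
    "\<Omega> v $ 3 = \<gamma> * \<Omega> (homothety 2 *v v) $ 3" for v
    using inv[of v] unfolding vec3_eq_iff transpose_homothety by (simp_all add: mult_ac)
  have z1: "hom_poly 1 (\<lambda>v. v$3)"
    using hom_poly_bform[of 1 0 "\<lambda>_. 1"] by (simp add: bform_def)
  have factor_z: False if Q: "\<And>i. hom_poly n (\<lambda>v. Q v $ i)" "\<And>v. \<Omega> v = v$3 *s Q v" for Q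
    using no_factor[of 1 "\<lambda>v. v$3" Q] z1 Q n by simp
  have comp: "(\<forall>v. \<Omega> v $ i = 0) \<or> (\<exists>k a. k \<le> n + 1 \<and> 2 * \<gamma> * 2 ^ (n + 1 - k) = 1
      \<and> (\<forall>v. \<Omega> v $ i = v$3 ^ k * bform (n + 1 - k) a (v$1) (v$2)))" if "i = 1 \<or> i = 2" for i
  proof (rule homothety_component[OF hp])
    show "\<Omega> v $ i = 2 * \<gamma> * \<Omega> (homothety 2 *v v) $ i" for v
      using that
    proof
      assume "i = 1"
      show ?thesis unfolding \<open>i = 1\<close> by (rule inv'(1))
    next
      assume "i = 2"
      show ?thesis unfolding \<open>i = 2\<close> by (rule inv'(2))
    qed
  qed
  have comp3: "(\<forall>v. \<Omega> v $ 3 = 0) \<or> (\<exists>k a. k \<le> n + 1 \<and> \<gamma> * 2 ^ (n + 1 - k) = 1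
      \<and> (\<forall>v. \<Omega> v $ 3 = v$3 ^ k * bform (n + 1 - k) a (v$1) (v$2)))"
    by (rule homothety_component[OF hp inv'(3)])
  define zdiv where "zdiv i \<longleftrightarrow> (\<exists>q. hom_poly n q \<and> (\<forall>v. \<Omega> v $ i = v$3 * q v))" for i
  have not_all_zdiv: "\<not> (zdiv 1 \<and> zdiv 2 \<and> zdiv 3)"
  proof
    assume "zdiv 1 \<and> zdiv 2 \<and> zdiv 3"
    then obtain q1 q2 q3 where q: "hom_poly n q1" "hom_poly n q2" "hom_poly n q3"
      "\<And>v. \<Omega> v $ 1 = v$3 * q1 v" "\<And>v. \<Omega> v $ 2 = v$3 * q2 v" "\<And>v. \<Omega> v $ 3 = v$3 * q3 v"
      unfolding zdiv_def by blast
    define Q :: "complex ^ 3 \<Rightarrow> complex ^ 3" where "Q v = vector [q1 v, q2 v, q3 v]" for v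
    have "\<forall>i. hom_poly n (\<lambda>v. Q v $ i)" unfolding forall_3 Q_def using q by simp
    moreover have "\<Omega> v = v$3 *s Q v" for v unfolding vec3_eq_iff Q_def using q by simp
    ultimately show False using factor_z[of Q] by blast
  qed
  have zdivI: "zdiv i" if "\<And>v. \<Omega> v $ i = v$3 ^ k * bform (n + 1 - k) a (v$1) (v$2)" "k \<le> n + 1" "k \<noteq> 0" for i k a
  proof -
    have "hom_poly n (\<lambda>v. v$3 ^ (k - 1) * bform (n + 1 - k) a (v$1) (v$2))"
      using hom_poly_bform[of "k - 1" "n + 1 - k" a] that by simp
    moreover have "v$3 ^ k = v$3 * v$3 ^ (k - 1)" for v :: "complex ^ 3"
      using that(3) by (cases k) auto
    ultimately show ?thesis unfolding zdiv_def that(1) by (auto simp: mult.assoc intro!: exI)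
  qed
  have zdiv0: "zdiv i" if "\<And>v. \<Omega> v $ i = 0" for i
    unfolding zdiv_def using that hom_poly_zero by auto
  have w12: "2 * \<gamma> * 2 ^ (n + 1) = 1 \<and> (\<exists>a. \<forall>v. \<Omega> v $ i = bform (n + 1) a (v$1) (v$2))"
    if "i = 1 \<or> i = 2" "\<not> zdiv i" for i
    using comp[OF that(1)]
  proof
    assume "\<exists>k a. k \<le> n + 1 \<and> 2 * \<gamma> * 2 ^ (n + 1 - k) = 1 \<and> (\<forall>v. \<Omega> v $ i = v$3 ^ k * bform (n + 1 - k) a (v$1) (v$2))"
    then obtain k a where k: "k \<le> n + 1" "2 * \<gamma> * 2 ^ (n + 1 - k) = 1" "\<And>v. \<Omega> v $ i = v$3 ^ k * bform (n + 1 - k) a (v$1) (v$2)"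
      by blast
    then have "k = 0" using zdivI that(2) by blast
    then show ?thesis using k by auto
  qed (use zdiv0 that in blast)
  \<comment> \<open>Otherwise the first two components contain no \<open>Z\<close>, and the third
    vanishes because its weight would have to be \<open>n + 2\<close>. The radial relation then
    makes \<open>\<Omega>\<close> a binary form of degree \<open>n\<close> times
    \<open>X dY - Y dX\<close>, which has a forbidden factor.\<close>
  have not_top: "2 * \<gamma> * 2 ^ (n + 1) \<noteq> 1"
  proof
    assume top: "2 * \<gamma> * 2 ^ (n + 1) = 1"
    then have top': "\<gamma> * 2 ^ (n + 2) = 1" by (simp add: mult_ac)
    have O3: "\<Omega> v $ 3 = 0" for v
      using comp3
    proof
      assume "\<exists>k a. k \<le> n + 1 \<and> \<gamma> * 2 ^ (n + 1 - k) = 1 \<and> (\<forall>v. \<Omega> v $ 3 = v$3 ^ k * bform (n + 1 - k) a (v$1) (v$2))"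
      then obtain k where "\<gamma> * 2 ^ (n + 1 - k) = 1" by blast
      then have "n + 1 - k = n + 2" using homothety_weight_unique top' by blast
      then show ?thesis by simp
    qed blast
    have ex: "\<exists>a. \<forall>v. \<Omega> v $ i = bform (Suc n) a (v$1) (v$2)" if i: "i = 1 \<or> i = 2" for i
      using comp[OF i]
    proof
      assume "\<exists>k a. k \<le> n + 1 \<and> 2 * \<gamma> * 2 ^ (n + 1 - k) = 1 \<and> (\<forall>v. \<Omega> v $ i = v$3 ^ k * bform (n + 1 - k) a (v$1) (v$2))"
      then obtain k a where k: "k \<le> n + 1" "2 * \<gamma> * 2 ^ (n + 1 - k) = 1" "\<And>v. \<Omega> v $ i = v$3 ^ k * bform (n + 1 - k) a (v$1) (v$2)"
        by blast
      have "n + 1 - k = n + 1" using homothety_weight_unique[OF k(2) top] .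
      then have "k = 0" by simp
      then show ?thesis using k(3) by auto
    next
      assume z: "\<forall>v. \<Omega> v $ i = 0"
      show ?thesis by (rule exI[of _ "\<lambda>_. 0"]) (simp add: z bform_def)
    qed
    obtain a1 where a1: "\<And>v. \<Omega> v $ 1 = bform (Suc n) a1 (v$1) (v$2)" using ex[of 1] by blast
    obtain a2 where a2: "\<And>v. \<Omega> v $ 2 = bform (Suc n) a2 (v$1) (v$2)" using ex[of 2] by blast
    have eq: "x * bform (Suc n) a1 x y + y * bform (Suc n) a2 x y = 0" for x y
      using rad[of "vector [x, y, 1]"] unfolding a1 a2 O3 by simp
    have "bform (Suc n) a1 1 0 = 0" "bform (Suc n) a2 0 1 = 0" using eq[of 1 0] eq[of 0 1] by simp_all
    then obtain b1 b2 where b1: "\<And>x y. bform (Suc n) a1 x y = (0 * x - 1 * y) * bform n b1 x y"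
      and b2: "\<And>x y. bform (Suc n) a2 x y = (1 * x - 0 * y) * bform n b2 x y"
      using bform_linear_factor[of n a1 1 0] bform_linear_factor[of n a2 0 1] by (metis one_neq_zero prod.inject)
    have "bform (Suc n) (\<lambda>i. if i = 0 then 0 else b2 (i - 1) + - 1 * b1 (i - 1)) x 1 = 0" for x
    proof -
      have "bform (Suc n) (\<lambda>i. if i = 0 then 0 else b2 (i - 1) + - 1 * b1 (i - 1)) x 1
        = x * (bform n b2 x 1 + - 1 * bform n b1 x 1)"
        unfolding bform_smult[of "- 1"] bform_add bform_mult_x ..
      also have "\<dots> = 0" using eq[of x 1] unfolding b1 b2 by (simp add: algebra_simps)
      finally show ?thesis .
    qed
    then have "(\<Sum>i\<le>Suc n. (if i = 0 then 0 else b2 (i - 1) + - 1 * b1 (i - 1)) * x ^ i) = (\<Sum>i\<le>Suc n. 0 * x ^ i)" for x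
      unfolding bform_def by (simp del: sum.atMost_Suc)
    from coeff_compare[OF this, of "Suc _"] have "b2 i = b1 i" if "i \<le> n" for i using that by simp
    then have b12: "bform n b2 x y = bform n b1 x y" for x y unfolding bform_def by (intro sum.cong) auto
    define Q :: "complex ^ 3 \<Rightarrow> complex ^ 3" where "Q v = vector [- (v$2), v$1, 0]" for v
    have "hom_poly 1 (\<lambda>v. - (v$2))" "hom_poly 1 (\<lambda>v. v$1)"
      using hom_poly_bform[of 0 1 "\<lambda>i. if i = 0 then - 1 else 0"] hom_poly_bform[of 0 1 "\<lambda>i. if i = 0 then 0 else 1"]
      by (simp_all add: bform_def)
    then have "\<forall>i. hom_poly 1 (\<lambda>v. Q v $ i)" unfolding forall_3 Q_def using hom_poly_zero by simp
    moreover have "\<Omega> v = bform n b1 (v$1) (v$2) *s Q v" for v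
      unfolding vec3_eq_iff Q_def a1 a2 b1 b2 O3 b12 by simp
    moreover have "hom_poly n (\<lambda>v. bform n b1 (v$1) (v$2))" using hom_poly_bform[of 0 n b1] by simp
    ultimately show False using no_factor[of n "\<lambda>v. bform n b1 (v$1) (v$2)" Q] n by auto
  qed
  then have "zdiv 1" "zdiv 2" using w12 by blast+
  then have nz3: "\<not> zdiv 3" using not_all_zdiv by blast
  obtain a3 where \<gamma>: "\<gamma> * 2 ^ (n + 1) = 1" and a3: "\<And>v. \<Omega> v $ 3 = bform (n + 1) a3 (v$1) (v$2)"
  proof -
    obtain k a where k: "k \<le> n + 1" "\<gamma> * 2 ^ (n + 1 - k) = 1" "\<And>v. \<Omega> v $ 3 = v$3 ^ k * bform (n + 1 - k) a (v$1) (v$2)"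
      using comp3 zdiv0 nz3 by blast
    then have "k = 0" using zdivI nz3 by blast
    then show ?thesis using that[of a] k by auto
  qed
  have ex: "\<exists>a. \<forall>v. \<Omega> v $ i = v$3 * bform n a (v$1) (v$2)" if i: "i = 1 \<or> i = 2" for i
    using comp[OF i]
  proof
    assume "\<exists>k a. k \<le> n + 1 \<and> 2 * \<gamma> * 2 ^ (n + 1 - k) = 1 \<and> (\<forall>v. \<Omega> v $ i = v$3 ^ k * bform (n + 1 - k) a (v$1) (v$2))"
    then obtain k a where k: "k \<le> n + 1" "2 * \<gamma> * 2 ^ (n + 1 - k) = 1" "\<And>v. \<Omega> v $ i = v$3 ^ k * bform (n + 1 - k) a (v$1) (v$2)"
      by blast
    have "\<gamma> * 2 ^ Suc (n + 1 - k) = 1" using k(2) by (simp add: mult_ac)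
    then have "Suc (n + 1 - k) = n + 1" using homothety_weight_unique \<gamma> by blast
    then have "k = 1" using k(1) n by simp
    then show ?thesis using k(3) by auto
  next
    assume z: "\<forall>v. \<Omega> v $ i = 0"
    show ?thesis by (rule exI[of _ "\<lambda>_. 0"]) (simp add: z bform_def)
  qed
  obtain \<alpha> where \<alpha>: "\<And>v. \<Omega> v $ 1 = v$3 * bform n \<alpha> (v$1) (v$2)" using ex[of 1] by blast
  obtain \<beta> where \<beta>: "\<And>v. \<Omega> v $ 2 = v$3 * bform n \<beta> (v$1) (v$2)" using ex[of 2] by blast
  have O3: "\<Omega> v $ 3 = - (v$1 * bform n \<alpha> (v$1) (v$2) + v$2 * bform n \<beta> (v$1) (v$2))" for v
  proof -
    have "bform (n + 1) a3 (v$1) (v$2) + (v$1 * bform n \<alpha> (v$1) (v$2) + v$2 * bform n \<beta> (v$1) (v$2)) = 0"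
      using rad[of "vector [v$1, v$2, 1]"] unfolding \<alpha> \<beta> a3 by (simp add: add_ac)
    then show ?thesis unfolding a3 by (simp only: eq_neg_iff_add_eq_0)
  qed
  have \<Omega>: "\<Omega> = affine_form (bform n \<alpha>) (bform n \<beta>)"
    unfolding fun_eq_iff vec3_eq_iff affine_form_def by (simp add: \<alpha> \<beta> O3)
  \<comment> \<open>A common zero would split the same linear form off both coefficients, and hence
    off all three components of \<open>\<Omega>\<close>.\<close>
  have "no_common_zero n \<alpha> \<beta>"
    unfolding no_common_zero_def
  proof (intro allI impI, rule ccontr)
    fix x0 y0 :: complex assume xy: "(x0, y0) \<noteq> (0, 0)" and "\<not> (bform n \<alpha> x0 y0 \<noteq> 0 \<or> bform n \<beta> x0 y0 \<noteq> 0)"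
    then have zero: "bform n \<alpha> x0 y0 = 0" "bform n \<beta> x0 y0 = 0" by auto
    obtain m where m: "n = Suc m" using n by (cases n) auto
    obtain a b where a: "\<And>x y. bform n \<alpha> x y = (y0 * x - x0 * y) * bform m a x y"
      and b: "\<And>x y. bform n \<beta> x y = (y0 * x - x0 * y) * bform m b x y"
      using bform_linear_factor[of m \<alpha> x0 y0] bform_linear_factor[of m \<beta> x0 y0] zero xy unfolding m by metis
    define Q :: "complex ^ 3 \<Rightarrow> complex ^ 3" where "Q v = vector [v$3 * bform m a (v$1) (v$2), v$3 * bform m b (v$1) (v$2),
      - (v$1 * bform m a (v$1) (v$2) + v$2 * bform m b (v$1) (v$2))]" for v
    have "hom_poly n (\<lambda>v. v$3 * bform m a (v$1) (v$2))" for a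
      using hom_poly_bform[of 1 m a] by (simp add: m)
    moreover have "hom_poly n (\<lambda>v. - (v$1 * bform m a (v$1) (v$2) + v$2 * bform m b (v$1) (v$2)))"
      using hom_poly_bform[of 0 n] bform_smult[of "- 1"] unfolding bform_mult_x bform_mult_y bform_add m by simp
    ultimately have "\<forall>i. hom_poly n (\<lambda>v. Q v $ i)" unfolding forall_3 Q_def by simp
    moreover have "hom_poly 1 (\<lambda>v. y0 * v$1 - x0 * v$2)"
      using hom_poly_bform[of 0 1 "\<lambda>i. if i = 0 then - x0 else y0"] by (simp add: bform_def)
    moreover have "\<Omega> v = (y0 * v$1 - x0 * v$2) *s Q v" for v
      unfolding \<Omega> vec3_eq_iff affine_form_def Q_def a b by (simp add: algebra_simps)
    ultimately show False using no_factor[of 1 "\<lambda>v. y0 * v$1 - x0 * v$2" Q] n by auto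
  qed
  with \<Omega> show ?thesis by (rule that)
qed

lemma homogeneous_prefoliation:
  assumes "prefoliation d P" "homothety_invariant P" "d \<ge> 2"
  obtains \<alpha> \<beta> where "snd P = affine_form (bform (d - 1) \<alpha>) (bform (d - 1) \<beta>)" "no_common_zero (d - 1) \<alpha> \<beta>"
proof -
  have "same_prefoliation (pullback (homothety 2) P) P" using assms(2) unfolding homothety_invariant_def by simp
  then obtain \<gamma> where "\<And>v. snd P v = \<gamma> *s (transpose (homothety 2) *v snd P (homothety 2 *v v))"
    unfolding same_prefoliation_def pullback_def by auto
  moreover have "foliation (d - 1) (snd P)" "d - 1 \<ge> 1" using assms unfolding prefoliation_def by auto
  ultimately show ?thesis using homogeneous_foliation that by metis
qed

section \<open>Self-maps of the projective line with two critical points\<close>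

text \<open>\<open>critical_at\<close> tests every direction \<open>(h, k)\<close>. Its component
  along the point itself does not change the quotient, by homogeneity; the component along
  \<open>(f1, f2)\<close> moves the parameter \<open>\<tau>\<close>, and there the Wronskian is the
  numerator of the derivative.\<close>

lemma wronskian_zero_imp_ratio_critical:
  fixes G1 G2 :: "complex \<Rightarrow> complex \<Rightarrow> complex" and p q :: "complex poly"
  assumes hom: "\<And>k x y. G1 (k * x) (k * y) = k ^ n * G1 x y" "\<And>k x y. G2 (k * x) (k * y) = k ^ n * G2 x y"
    and ef: "e1 * f2 - e2 * f1 \<noteq> 0"
    and p: "\<And>\<tau>. G1 (e1 + \<tau> * f1) (e2 + \<tau> * f2) = poly p \<tau>"
    and q: "\<And>\<tau>. G2 (e1 + \<tau> * f1) (e2 + \<tau> * f2) = poly q \<tau>"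
    and w: "poly (pderiv p) \<tau> * poly q \<tau> - poly p \<tau> * poly (pderiv q) \<tau> = 0"
    and nz: "G2 (e1 + \<tau> * f1) (e2 + \<tau> * f2) \<noteq> 0"
  shows "((\<lambda>s. G1 (e1 + \<tau> * f1 + s * h) (e2 + \<tau> * f2 + s * k) / G2 (e1 + \<tau> * f1 + s * h) (e2 + \<tau> * f2 + s * k))
    has_field_derivative 0) (at 0)"
proof -
  define D where "D = e1 * f2 - e2 * f1"
  define \<mu> where "\<mu> = (h * f2 - k * f1) / D"
  define \<nu> where "\<nu> = ((e1 + \<tau> * f1) * k - (e2 + \<tau> * f2) * h) / D"
  have D0: "D \<noteq> 0" using ef by (simp add: D_def)
  have hk: "h = \<mu> * (e1 + \<tau> * f1) + \<nu> * f1" "k = \<mu> * (e2 + \<tau> * f2) + \<nu> * f2"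
  proof -
    have "D * h = (h * f2 - k * f1) * (e1 + \<tau> * f1) + ((e1 + \<tau> * f1) * k - (e2 + \<tau> * f2) * h) * f1"
      "D * k = (h * f2 - k * f1) * (e2 + \<tau> * f2) + ((e1 + \<tau> * f1) * k - (e2 + \<tau> * f2) * h) * f2"
      unfolding D_def by algebra+
    then show "h = \<mu> * (e1 + \<tau> * f1) + \<nu> * f1" "k = \<mu> * (e2 + \<tau> * f2) + \<nu> * f2"
      unfolding \<mu>_def \<nu>_def using D0 by (simp_all add: nonzero_eq_divide_eq add_divide_distrib[symmetric] mult.commute)
  qed
  \<comment> \<open>The displaced point is \<open>1 + s \<mu>\<close> times the point with parameter
    \<open>\<phi> s\<close>; \<open>\<mu>\<close> and \<open>\<nu>\<close> are the coordinates of
    \<open>(h, k)\<close> by Cramer's rule.\<close>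
  define \<phi> where "\<phi> s = \<tau> + s * \<nu> / (1 + s * \<mu>)" for s
  have q0: "poly q (\<phi> 0) \<noteq> 0" using nz q by (simp add: \<phi>_def)
  have "(\<phi> has_field_derivative \<nu>) (at 0)"
    unfolding \<phi>_def by (auto intro!: derivative_eq_intros)
  then have "((\<lambda>s. poly p (\<phi> s) / poly q (\<phi> s)) has_field_derivative
    (poly (pderiv p) (\<phi> 0) * \<nu> * poly q (\<phi> 0) - poly p (\<phi> 0) * (poly (pderiv q) (\<phi> 0) * \<nu>)) / (poly q (\<phi> 0) * poly q (\<phi> 0))) (at 0)"
    by (intro DERIV_divide DERIV_chain2[OF poly_DERIV] q0)
  moreover have "poly (pderiv p) (\<phi> 0) * \<nu> * poly q (\<phi> 0) - poly p (\<phi> 0) * (poly (pderiv q) (\<phi> 0) * \<nu>) = 0"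
    using arg_cong[OF w, of "\<lambda>x. x * \<nu>"] by (simp add: \<phi>_def algebra_simps)
  ultimately have der: "((\<lambda>s. poly p (\<phi> s) / poly q (\<phi> s)) has_field_derivative 0) (at 0)" by simp
  show ?thesis
  proof (rule has_field_derivative_transform_within[OF der])
    show "0 < 1 / (norm \<mu> + 1)" by (simp add: add_nonneg_pos)
    fix s :: complex assume "dist s 0 < 1 / (norm \<mu> + 1)"
    then have "norm s * (norm \<mu> + 1) < 1"
      by (simp add: pos_less_divide_eq add_nonneg_pos)
    then have "norm (s * \<mu>) < 1" by (simp add: norm_mult algebra_simps) (metis add.commute add_less_cancel_left le_add_same_cancel1 norm_ge_zero order_le_less_trans)
    then have s: "1 + s * \<mu> \<noteq> 0" by (metis add_eq_0_iff norm_minus_cancel norm_one less_irrefl)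
    have "e1 + \<tau> * f1 + s * h = (1 + s * \<mu>) * (e1 + \<phi> s * f1)" "e2 + \<tau> * f2 + s * k = (1 + s * \<mu>) * (e2 + \<phi> s * f2)"
      unfolding \<phi>_def hk using s by (simp_all add: field_simps)
    then show "poly p (\<phi> s) / poly q (\<phi> s) = G1 (e1 + \<tau> * f1 + s * h) (e2 + \<tau> * f2 + s * k) / G2 (e1 + \<tau> * f1 + s * h) (e2 + \<tau> * f2 + s * k)"
      using s by (simp add: hom p q)
  qed simp
qed

text \<open>What remains after removing the zero at the origin has no root at all and is therefore
  constant.\<close>

lemma poly_no_nonzero_root:
  fixes W :: "complex poly"
  assumes "\<And>\<tau>. \<tau> \<noteq> 0 \<Longrightarrow> poly W \<tau> \<noteq> 0"
  obtains \<kappa> k where "W = monom \<kappa> k" "\<kappa> \<noteq> 0"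
proof -
  have "W \<noteq> 0" using assms[of 1] by auto
  from order_decomp[OF this, of 0] obtain W1 where W1: "W = [:- 0, 1:] ^ order 0 W * W1" "\<not> [:- 0, 1:] dvd W1" by blast
  have r: "poly W1 \<tau> \<noteq> 0" for \<tau>
  proof (cases "\<tau> = 0")
    case True
    then show ?thesis using W1(2) by (simp add: poly_eq_0_iff_dvd)
  next
    case False
    then have "poly ([:- 0, 1:] ^ order 0 W * W1) \<tau> \<noteq> 0" using assms W1(1) by metis
    then show ?thesis by auto
  qed
  then have "degree W1 = 0" using fundamental_theorem_of_algebra[of W1] constant_degree[of W1] by blast
  then obtain \<kappa> where "W1 = [:\<kappa>:]" by (rule degree_eq_zeroE)
  then have "W = monom \<kappa> (order 0 W)" "\<kappa> \<noteq> 0" using W1(1) r[of 0] by (simp_all add: monom_altdef)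
  then show ?thesis by (rule that)
qed

text \<open>The combination \<open>N\<close> vanishes at 0, and its Wronskian with \<open>q\<close>
  is \<open>coeff q 0\<close> times the given one. As \<open>q\<close> does not vanish at 0, that
  Wronskian has order exactly one less than \<open>N\<close>, whose order is at most its degree.
  Equality leaves only the top coefficient of \<open>N\<close>.\<close>

lemma wronskian_monom_order_aux:
  fixes p q :: "complex poly"
  assumes n: "n \<ge> 1" and deg: "degree p \<le> n" "degree q \<le> n" and q0: "coeff q 0 \<noteq> 0"
    and w: "pderiv p * q - p * pderiv q = monom \<kappa> k" and \<kappa>: "\<kappa> \<noteq> 0"
  shows "k \<le> n - 1 \<and> (k = n - 1 \<longrightarrow> (\<forall>i<n. coeff q 0 * coeff p i = coeff p 0 * coeff q i))"
proof -
  define N where "N = smult (coeff q 0) p - smult (coeff p 0) q"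
  have w': "pderiv N * q - N * pderiv q = monom (coeff q 0 * \<kappa>) k"
  proof -
    have "pderiv N * q - N * pderiv q = smult (coeff q 0) (pderiv p * q - p * pderiv q)"
      unfolding N_def by (simp add: pderiv_diff pderiv_smult algebra_simps smult_diff_right)
    then show ?thesis unfolding w by (simp add: smult_monom)
  qed
  have "N \<noteq> 0" using w' q0 \<kappa> by (auto simp: monom_eq_0_iff[symmetric])
  from order_decomp[OF this, of 0] obtain N1 where N1: "N = [:- 0, 1:] ^ order 0 N * N1" "\<not> [:- 0, 1:] dvd N1" by blast
  define m where "m = order 0 N"
  have N1': "N = monom 1 m * N1" using N1(1) unfolding m_def by (simp add: monom_altdef)
  have N10: "coeff N1 0 \<noteq> 0" using N1(2) unfolding poly_eq_0_iff_dvd[symmetric] by (simp add: poly_0_coeff_0)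
  have "poly N 0 = 0" unfolding N_def by (simp add: poly_0_coeff_0)
  then have "m \<noteq> 0" unfolding m_def using \<open>N \<noteq> 0\<close> by (simp add: order_root)
  then obtain m' where m': "m = Suc m'" by (cases m) auto
  have "m \<le> degree N" unfolding m_def using \<open>N \<noteq> 0\<close> order_degree by blast
  also have "\<dots> \<le> n" unfolding N_def using deg by (intro degree_diff_le) (auto intro: order_trans[OF degree_smult_le])
  finally have mn: "m \<le> n" .
  have "coeff (pderiv N * q - N * pderiv q) m' \<noteq> 0"
  proof -
    have e: "pderiv N * q - N * pderiv q
      = monom 1 m' * (smult (of_nat m) (N1 * q) + monom 1 1 * (pderiv N1 * q - N1 * pderiv q))"
    proof -
      have "pderiv (monom 1 m) = smult (of_nat m) (monom 1 m' :: complex poly)" "(monom 1 m :: complex poly) = monom 1 m' * monom 1 1"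
        unfolding m' by (simp_all add: pderiv_monom smult_monom mult_monom)
      then show ?thesis unfolding N1' pderiv_mult by (simp add: algebra_simps smult_add_right)
    qed
    show ?thesis unfolding e coeff_monom_mult using N10 q0 \<open>m \<noteq> 0\<close>
      by (simp add: coeff_mult_0 coeff_monom_mult)
  qed
  then have km: "k = m'" unfolding w' by (auto split: if_splits)
  have "\<forall>i<n. coeff q 0 * coeff p i = coeff p 0 * coeff q i" if "k = n - 1"
  proof (intro allI impI)
    fix i assume "i < n"
    have "m = n" using that km m' n by simp
    then have "coeff N i = 0" unfolding N1' coeff_monom_mult using \<open>i < n\<close> by simp
    then show "coeff q 0 * coeff p i = coeff p 0 * coeff q i" unfolding N_def by simp
  qed
  then show ?thesis using km m' mn by auto
qed

lemma wronskian_monom_order: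
  fixes p q :: "complex poly"
  assumes n: "n \<ge> 1" and deg: "degree p \<le> n" "degree q \<le> n" and nz: "coeff p 0 \<noteq> 0 \<or> coeff q 0 \<noteq> 0"
    and w: "pderiv p * q - p * pderiv q = monom \<kappa> k" and \<kappa>: "\<kappa> \<noteq> 0"
  shows "k \<le> n - 1 \<and> (k = n - 1 \<longrightarrow> (\<forall>i<n. coeff q 0 * coeff p i = coeff p 0 * coeff q i))"
proof (cases "coeff q 0 = 0")
  case False
  then show ?thesis using wronskian_monom_order_aux[OF n deg _ w \<kappa>] by simp
next
  case True
  have "pderiv q * p - q * pderiv p = - (pderiv p * q - p * pderiv q)" by (simp add: mult_ac)
  also have "\<dots> = monom (- \<kappa>) k" unfolding w by (simp add: minus_monom)
  finally show ?thesis using wronskian_monom_order_aux[OF n deg(2,1), of "- \<kappa>" k] nz True \<kappa> by auto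
qed

section \<open>The Wronskian in the two charts of the source\<close>

definition bpoly :: "nat \<Rightarrow> (nat \<Rightarrow> complex) \<Rightarrow> complex poly" where
  "bpoly n a = (\<Sum>i\<le>n. monom (a i) i)"

lemma coeff_bpoly: "coeff (bpoly n a) i = (if i \<le> n then a i else 0)"
  unfolding bpoly_def by (auto simp: coeff_sum coeff_monom sum.delta)

lemma degree_bpoly: "degree (bpoly n a) \<le> n"
  by (simp add: degree_le coeff_bpoly)

lemma poly_bpoly: "poly (bpoly n a) \<tau> = bform n a \<tau> 1"
  unfolding bpoly_def bform_def by (simp add: poly_sum poly_monom)

lemma poly_bpoly_rev: "poly (bpoly n (\<lambda>i. a (n - i))) \<tau> = bform n a 1 \<tau>"
  unfolding poly_bpoly bform_def
  by (rule sum.reindex_bij_witness[of _ "\<lambda>i. n - i" "\<lambda>i. n - i"]) auto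

text \<open>Passage to the chart \<open>1 / \<tau>\<close>: the Wronskian behaves as a binary form
  of degree \<open>2 n - 2\<close>, up to sign, so the orders at 0 and at infinity are
  complementary.\<close>

lemma wronskian_reversed:
  fixes a b :: "nat \<Rightarrow> complex" and n :: nat
  defines "p \<equiv> bpoly n (\<lambda>i. a (n - i))" and "q \<equiv> bpoly n (\<lambda>i. b (n - i))"
  assumes n: "n \<ge> 1" and w: "pderiv p * q - p * pderiv q = monom \<kappa> k" and k: "k \<le> 2 * n - 2"
  shows "pderiv (bpoly n a) * bpoly n b - bpoly n a * pderiv (bpoly n b) = monom (- \<kappa>) (2 * n - 2 - k)"
proof -
  have rev: "poly (bpoly n c) \<tau> = \<tau> ^ n * poly (bpoly n (\<lambda>i. c (n - i))) (1 / \<tau>)" if "\<tau> \<noteq> 0" for c \<tau>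
    unfolding poly_bpoly_rev poly_bpoly using bform_homogeneous[of n c \<tau> 1 "1 / \<tau>"] that by simp
  have der: "\<tau>^2 * poly (pderiv (bpoly n c)) \<tau> = \<tau> ^ n * (of_nat n * \<tau> * poly (bpoly n (\<lambda>i. c (n - i))) (1 / \<tau>)
    - poly (pderiv (bpoly n (\<lambda>i. c (n - i)))) (1 / \<tau>))" if "\<tau> \<noteq> 0" for c \<tau>
  proof -
    let ?r = "bpoly n (\<lambda>i. c (n - i))"
    have inv: "((\<lambda>\<tau>. 1 / \<tau>) has_field_derivative - (1 / \<tau>^2)) (at \<tau>)"
      using that by (auto intro!: derivative_eq_intros simp: power2_eq_square)
    have "((\<lambda>\<tau>. \<tau> ^ n * poly ?r (1 / \<tau>)) has_field_derivative
      of_nat n * \<tau> ^ (n - 1) * poly ?r (1 / \<tau>) + poly (pderiv ?r) (1 / \<tau>) * - (1 / \<tau>^2) * \<tau> ^ n) (at \<tau>)"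
      using DERIV_mult[OF DERIV_power[OF DERIV_ident, of n] DERIV_chain2[OF poly_DERIV inv], of ?r] by simp
    then have "(poly (bpoly n c) has_field_derivative
      of_nat n * \<tau> ^ (n - 1) * poly ?r (1 / \<tau>) + poly (pderiv ?r) (1 / \<tau>) * - (1 / \<tau>^2) * \<tau> ^ n) (at \<tau>)"
    proof (rule has_field_derivative_transform_within[of _ _ _ _ "norm \<tau>"])
      fix x assume "dist x \<tau> < norm \<tau>"
      then have "x \<noteq> 0" by auto
      then show "x ^ n * poly ?r (1 / x) = poly (bpoly n c) x" by (rule rev[symmetric])
    qed (use that in auto)
    then have "poly (pderiv (bpoly n c)) \<tau> = of_nat n * \<tau> ^ (n - 1) * poly ?r (1 / \<tau>) + poly (pderiv ?r) (1 / \<tau>) * - (1 / \<tau>^2) * \<tau> ^ n"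
      using poly_DERIV DERIV_unique by blast
    moreover have "\<tau> ^ n = \<tau> * \<tau> ^ (n - 1)" using n by (cases n) auto
    moreover have "\<tau>^2 * (1 / \<tau>^2) = 1" using that by simp
    moreover have "t^2 * p' = z * (m * t * r - r')" if "p' = m * y * r + r' * - i * z" "z = t * y" "t^2 * i = 1"
      for t p' m y r r' i z :: complex using that by algebra
    ultimately show ?thesis by blast
  qed
  define W where "W = pderiv (bpoly n a) * bpoly n b - bpoly n a * pderiv (bpoly n b)"
  \<comment> \<open>The extra monomial clears the negative exponents that \<open>1 / \<tau>\<close>
    would produce.\<close>
  have "monom 1 (k + 2) * W = monom (- \<kappa>) (2 * n)"
  proof -
    have "poly (monom 1 (k + 2) * W) \<tau> = poly (monom (- \<kappa>) (2 * n)) \<tau>" for \<tau>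
    proof (cases "\<tau> = 0")
      case True
      then show ?thesis using n by (simp add: poly_monom)
    next
      case False
      have "\<tau>^2 * poly W \<tau> = (\<tau>^2 * poly (pderiv (bpoly n a)) \<tau>) * poly (bpoly n b) \<tau>
        - poly (bpoly n a) \<tau> * (\<tau>^2 * poly (pderiv (bpoly n b)) \<tau>)"
        unfolding W_def by (simp add: algebra_simps)
      also have "\<dots> = - (\<tau> ^ n * \<tau> ^ n) * (poly (pderiv p) (1 / \<tau>) * poly q (1 / \<tau>) - poly p (1 / \<tau>) * poly (pderiv q) (1 / \<tau>))"
        unfolding der[OF False] rev[OF False] p_def[symmetric] q_def[symmetric] by (simp add: algebra_simps)
      also have "poly (pderiv p) (1 / \<tau>) * poly q (1 / \<tau>) - poly p (1 / \<tau>) * poly (pderiv q) (1 / \<tau>) = \<kappa> * (1 / \<tau>) ^ k"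
        using arg_cong[OF w, of "\<lambda>f. poly f (1 / \<tau>)"] by (simp add: poly_monom)
      finally have "\<tau> ^ k * (\<tau>^2 * poly W \<tau>) = - (\<tau> ^ n * \<tau> ^ n) * \<kappa>"
        using False by (simp add: power_one_over field_simps)
      then show ?thesis by (simp add: poly_monom power_add[symmetric] mult_2_right power2_eq_square mult_ac)
    qed
    then show ?thesis using poly_eq_poly_eq_iff by blast
  qed
  then have "coeff W j = coeff (monom (- \<kappa>) (2 * n)) (j + (k + 2))" for j
    using coeff_monom_mult[of 1 "k + 2" W "j + (k + 2)"] by simp
  then show ?thesis unfolding W_def[symmetric] using k n by (intro poly_eqI) auto
qed

text \<open>With the critical points at \<open>0\<close> and \<open>\<infinity>\<close> the Wronskian is \<open>\<kappa> \<tau>\<^sup>k\<close>.  Its order at \<open>0\<close> is at most \<open>n - 1\<close>, and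
  so is its order \<open>2 n - 2 - k\<close> at \<open>\<infinity>\<close>; hence both are \<open>n - 1\<close> and the map is totally ramified at both points.\<close>

lemma two_critical_points:
  assumes n: "n \<ge> 1" and nz: "no_common_zero n \<alpha> \<beta>"
    and ef: "e1 * f2 - e2 * f1 \<noteq> 0"
    and crit: "\<And>\<tau>. \<tau> \<noteq> 0 \<Longrightarrow> \<not> critical_at (\<lambda>x y. - bform n \<alpha> x y) (bform n \<beta>) (e1 + \<tau> * f1) (e2 + \<tau> * f2)"
  shows "\<exists>a0 an b0 bn. a0 * bn - an * b0 \<noteq> 0 \<and>
    (\<forall>s t. bform n \<alpha> (s * e1 + t * f1) (s * e2 + t * f2) = an * s ^ n + a0 * t ^ n) \<and>
    (\<forall>s t. bform n \<beta> (s * e1 + t * f1) (s * e2 + t * f2) = bn * s ^ n + b0 * t ^ n)"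
proof -
  obtain a b where a: "\<And>s t. bform n \<alpha> (s * e1 + t * f1) (s * e2 + t * f2) = bform n a s t"
    and b: "\<And>s t. bform n \<beta> (s * e1 + t * f1) (s * e2 + t * f2) = bform n b s t"
    using bform_linear_subst by meson
  define p q where "p = bpoly n (\<lambda>i. a (n - i))" and "q = bpoly n (\<lambda>i. b (n - i))"
  have p: "bform n \<alpha> (e1 + \<tau> * f1) (e2 + \<tau> * f2) = poly p \<tau>" and q: "bform n \<beta> (e1 + \<tau> * f1) (e2 + \<tau> * f2) = poly q \<tau>" for \<tau>
    using a[of 1 \<tau>] b[of 1 \<tau>] unfolding p_def q_def poly_bpoly_rev by simp_all
  define W where "W = pderiv p * q - p * pderiv q"
  have "poly W \<tau> \<noteq> 0" if "\<tau> \<noteq> 0" for \<tau>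
  proof
    assume "poly W \<tau> = 0"
    then have w: "poly (pderiv (- p)) \<tau> * poly q \<tau> - poly (- p) \<tau> * poly (pderiv q) \<tau> = 0"
      "poly (pderiv q) \<tau> * poly (- p) \<tau> - poly q \<tau> * poly (pderiv (- p)) \<tau> = 0"
      unfolding W_def by (simp_all add: pderiv_minus algebra_simps)
    have h: "- bform n \<alpha> (k * x) (k * y) = k ^ n * - bform n \<alpha> x y" "bform n \<beta> (k * x) (k * y) = k ^ n * bform n \<beta> x y" for k x y
      by (simp_all add: bform_homogeneous)
    have p': "- bform n \<alpha> (e1 + \<tau> * f1) (e2 + \<tau> * f2) = poly (- p) \<tau>" for \<tau> using p by simp
    have "critical_at (\<lambda>x y. - bform n \<alpha> x y) (bform n \<beta>) (e1 + \<tau> * f1) (e2 + \<tau> * f2)"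
      unfolding critical_at_def
    proof (intro allI conjI impI)
      fix h' k'
      show "((\<lambda>s. - bform n \<alpha> (e1 + \<tau> * f1 + s * h') (e2 + \<tau> * f2 + s * k') / bform n \<beta> (e1 + \<tau> * f1 + s * h') (e2 + \<tau> * f2 + s * k'))
        has_field_derivative 0) (at 0)" if "bform n \<beta> (e1 + \<tau> * f1) (e2 + \<tau> * f2) \<noteq> 0"
        by (rule wronskian_zero_imp_ratio_critical[where ?G1.0 = "\<lambda>x y. - bform n \<alpha> x y" and n = n, OF h ef p' q w(1) that])
      show "((\<lambda>s. bform n \<beta> (e1 + \<tau> * f1 + s * h') (e2 + \<tau> * f2 + s * k') / - bform n \<alpha> (e1 + \<tau> * f1 + s * h') (e2 + \<tau> * f2 + s * k'))
        has_field_derivative 0) (at 0)" if "- bform n \<alpha> (e1 + \<tau> * f1) (e2 + \<tau> * f2) \<noteq> 0"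
        by (rule wronskian_zero_imp_ratio_critical[where ?G2.0 = "\<lambda>x y. - bform n \<alpha> x y" and n = n, OF h(2,1) ef q p' w(2) that])
    qed
    then show False using crit[OF that] by simp
  qed
  then obtain \<kappa> k where W: "W = monom \<kappa> k" and \<kappa>: "\<kappa> \<noteq> 0" using poly_no_nonzero_root by blast
  have e0: "(e1, e2) \<noteq> (0, 0)" and f0: "(f1, f2) \<noteq> (0, 0)" using ef by auto
  have pn: "coeff p 0 \<noteq> 0 \<or> coeff q 0 \<noteq> 0"
    using nz[unfolded no_common_zero_def, rule_format, OF e0] p[of 0] q[of 0] by (simp add: poly_0_coeff_0)
  have pn': "coeff (bpoly n a) 0 \<noteq> 0 \<or> coeff (bpoly n b) 0 \<noteq> 0"
    using nz[unfolded no_common_zero_def, rule_format, OF f0] a[of 0 1] b[of 0 1]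
    by (simp add: poly_0_coeff_0[symmetric] poly_bpoly)
  have deg: "degree p \<le> n" "degree q \<le> n" unfolding p_def q_def by (rule degree_bpoly)+
  note o1 = wronskian_monom_order[OF n deg pn W[unfolded W_def] \<kappa>]
  have k2: "k \<le> 2 * n - 2" using o1 by linarith
  note rev = wronskian_reversed[OF n W[unfolded W_def p_def q_def] k2]
  have "- \<kappa> \<noteq> 0" using \<kappa> by simp
  note o2 = wronskian_monom_order[OF n degree_bpoly degree_bpoly pn' rev this]
  have k: "k = n - 1" using o1 o2 n by linarith
  then have k': "2 * n - 2 - k = n - 1" using n by linarith
  have r1: "b n * a j = a n * b j" if "1 \<le> j" "j \<le> n" for j
    using o1 k that unfolding p_def q_def coeff_bpoly by (auto dest!: spec[of _ "n - j"])
  have r2: "b 0 * a j = a 0 * b j" if "j < n" for j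
    using o2 k' that unfolding coeff_bpoly by auto
  \<comment> \<open>Otherwise \<open>p\<close> and \<open>q\<close> would be proportional and their
    Wronskian zero.\<close>
  have det: "a 0 * b n - a n * b 0 \<noteq> 0"
  proof
    assume d: "a 0 * b n - a n * b 0 = 0"
    have "b n * a j = a n * b j" if "j \<le> n" for j
      using r1[of j] d that by (cases "j = 0") (simp_all add: mult.commute)
    then have e: "smult (b n) p = smult (a n) q" by (intro poly_eqI) (simp add: p_def q_def coeff_bpoly)
    have "smult (b n) W = pderiv (smult (b n) p) * q - smult (b n) p * pderiv q"
      unfolding W_def pderiv_smult by (simp add: smult_diff_right)
    also have "\<dots> = 0" unfolding e pderiv_smult by (simp add: mult_ac)
    finally have "smult (b n) W = 0" .
    moreover have "smult (a n) W = pderiv p * smult (a n) q - p * pderiv (smult (a n) q)"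
      unfolding W_def pderiv_smult by (simp add: smult_diff_right)
    then have "smult (a n) W = 0" unfolding e[symmetric] pderiv_smult by (simp add: mult_ac)
    moreover have "a n \<noteq> 0 \<or> b n \<noteq> 0" using pn unfolding p_def q_def coeff_bpoly by simp
    ultimately show False using W \<kappa> by auto
  qed
  \<comment> \<open>Maximal order at one point makes \<open>(a j, b j)\<close> proportional to
    \<open>(a n, b n)\<close>, maximal order at the other to \<open>(a 0, b 0)\<close>; these two
    vectors are independent.\<close>
  have mid: "a j = 0 \<and> b j = 0" if "0 < j" "j < n" for j
  proof -
    have 1: "b n * a j = a n * b j" "b 0 * a j = a 0 * b j" using r1[of j] r2[of j] that by auto
    have "(a 0 * b n - a n * b 0) * a j = 0" "(a 0 * b n - a n * b 0) * b j = 0" using 1 by algebra+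
    then show ?thesis using det by simp
  qed
  have two: "bform n c s t = c n * s ^ n + c 0 * t ^ n" if "\<And>j. 0 < j \<Longrightarrow> j < n \<Longrightarrow> c j = 0" for c s t
  proof -
    have "bform n c s t = (\<Sum>i\<in>{0, n}. c i * s ^ i * t ^ (n - i))"
      unfolding bform_def using that by (intro sum.mono_neutral_right) (auto simp: le_less)
    then show ?thesis using n by simp
  qed
  show ?thesis
    by (intro exI[of _ "a 0"] exI[of _ "a n"] exI[of _ "b 0"] exI[of _ "b n"] conjI det allI)
      (use a b two mid in auto)
qed

section \<open>Normal forms\<close>

text \<open>The normal form with \<open>u = x\<close> and \<open>v = y\<close>. The order of the
  letters makes \<open>a, b; c, d\<close> the matrix of the Moebius map that sends \<open>P\<close>
  to \<open>- R\<close>.\<close>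

definition power_form :: "nat \<Rightarrow> complex \<Rightarrow> complex \<Rightarrow> complex \<Rightarrow> complex \<Rightarrow> complex ^ 3 \<Rightarrow> complex ^ 3" where
  "power_form n a b c d = affine_form (\<lambda>x y. c * x ^ n + a * y ^ n) (\<lambda>x y. d * x ^ n + b * y ^ n)"

lemma power_form_smult: "power_form n (k * a) (k * b) (k * c) (k * d) v = k *s power_form n a b c d v"
  unfolding power_form_def affine_form_smult[symmetric] by (simp add: algebra_simps)

lemma same_prefoliation_power_form:
  assumes "s \<noteq> 0" "k \<noteq> 0"
  shows "same_prefoliation (l, power_form n a b c d) (s *s l, power_form n (k * a) (k * b) (k * c) (k * d))"
  using assms unfolding same_prefoliation_def by (auto simp: power_form_smult)

lemma proj_point_eq:
  assumes "(x, y) \<noteq> (0, 0)" "(x', y') \<noteq> (0, 0)" "x * y' = y * x'"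
  shows "proj_point x y = proj_point x' y'"
proof -
  obtain c where c: "c \<noteq> 0" "x' = c * x" "y' = c * y"
  proof (cases "x = 0")
    case True
    then have "y \<noteq> 0" using assms by auto
    then show ?thesis using True assms by (intro that[of "y' / y"]) (auto simp: field_simps)
  next
    case False
    then show ?thesis using assms by (intro that[of "x' / x"]) (auto simp: field_simps)
  qed
  have "\<exists>e'. (e * x, e * y) = (e' * x', e' * y') \<and> e' \<noteq> 0" if "e \<noteq> 0" for e
    using that c by (intro exI[of _ "e / c"]) auto
  moreover have "\<exists>e'. (e * x', e * y') = (e' * x, e' * y) \<and> e' \<noteq> 0" if "e \<noteq> 0" for e
    using that c by (intro exI[of _ "e * c"]) auto
  ultimately show ?thesis unfolding proj_point_def by fast
qed

text \<open>The two critical points become the columns of the coordinate change. No other point is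
  critical, so \<open>two_critical_points\<close> applies with parameter 0 at the first and infinity
  at the second.\<close>

lemma type_degree_two_power_form:
  assumes n: "n \<ge> 1" and P: "snd P = affine_form (bform n \<alpha>) (bform n \<beta>)" and nz: "no_common_zero n \<alpha> \<beta>"
    and type: "type_degree P = 2"
  obtains u1 u2 v1 v2 a b c d where "u1 * v2 - u2 * v1 \<noteq> 0" "a * d - b * c \<noteq> 0"
    "snd (pullback (blk u1 u2 v1 v2) P) = power_form n a b c d"
proof -
  define crit where "crit x y \<longleftrightarrow> (x, y) \<noteq> (0, 0) \<and> critical_at (\<lambda>x y. - bform n \<alpha> x y) (bform n \<beta>) x y" for x y
  have "affA P = bform n \<alpha>" "affB P = bform n \<beta>"
    unfolding affA_def affB_def P affine_form_def by (simp_all add: fun_eq_iff)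
  then have pts: "gauss_critical_points P = {proj_point x y | x y. crit x y}"
    unfolding gauss_critical_points_def crit_def by simp
  obtain S1 S2 where S: "gauss_critical_points P = {S1, S2}" "S1 \<noteq> S2"
    using type unfolding type_degree_def by (meson card_2_iff)
  have "S1 \<in> gauss_critical_points P" "S2 \<in> gauss_critical_points P" using S(1) by simp_all
  then obtain e1 e2 f1 f2 where e: "S1 = proj_point e1 e2" "crit e1 e2" and f: "S2 = proj_point f1 f2" "crit f1 f2"
    unfolding pts by blast
  have ef: "e1 * f2 - e2 * f1 \<noteq> 0"
    using proj_point_eq[of e1 e2 f1 f2] e f S(2) unfolding crit_def by auto
  have "\<not> critical_at (\<lambda>x y. - bform n \<alpha> x y) (bform n \<beta>) (e1 + \<tau> * f1) (e2 + \<tau> * f2)" if "\<tau> \<noteq> 0" for \<tau>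
  proof
    let ?x = "e1 + \<tau> * f1" and ?y = "e2 + \<tau> * f2"
    assume c: "critical_at (\<lambda>x y. - bform n \<alpha> x y) (bform n \<beta>) ?x ?y"
    have ind: "?x * f2 - ?y * f1 = e1 * f2 - e2 * f1" "e1 * ?y - e2 * ?x = \<tau> * (e1 * f2 - e2 * f1)" by algebra+
    have "(?x, ?y) \<noteq> (0, 0)" using ind(1) ef by auto
    then have "proj_point ?x ?y \<in> {S1, S2}" unfolding S(1)[symmetric] pts using c unfolding crit_def by blast
    moreover have "(?x, ?y) \<in> proj_point ?x ?y" unfolding proj_point_def by (auto intro!: exI[of _ 1])
    ultimately have "(?x, ?y) \<in> S1 \<union> S2" by blast
    then obtain k where "(?x = k * e1 \<and> ?y = k * e2) \<or> (?x = k * f1 \<and> ?y = k * f2)"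
      unfolding e(1) f(1) proj_point_def by blast
    then show False
    proof
      assume "?x = k * e1 \<and> ?y = k * e2"
      then have "e1 * ?y - e2 * ?x = 0" by simp
      then show False unfolding ind(2) using that ef by simp
    next
      assume "?x = k * f1 \<and> ?y = k * f2"
      then have "?x * f2 - ?y * f1 = 0" by simp
      then show False unfolding ind(1) using ef by simp
    qed
  qed
  from two_critical_points[OF n nz ef this] obtain a0 an b0 bn where det: "a0 * bn - an * b0 \<noteq> 0"
    and A: "\<And>s t. bform n \<alpha> (s * e1 + t * f1) (s * e2 + t * f2) = an * s ^ n + a0 * t ^ n"
    and B: "\<And>s t. bform n \<beta> (s * e1 + t * f1) (s * e2 + t * f2) = bn * s ^ n + b0 * t ^ n" by blast
  have "snd (pullback (blk e1 f1 e2 f2) P) = power_form n (e1 * a0 + e2 * b0) (f1 * a0 + f2 * b0) (e1 * an + e2 * bn) (f1 * an + f2 * bn)"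
  proof -
    have A': "bform n \<alpha> (e1 * x + f1 * y) (e2 * x + f2 * y) = an * x ^ n + a0 * y ^ n"
      and B': "bform n \<beta> (e1 * x + f1 * y) (e2 * x + f2 * y) = bn * x ^ n + b0 * y ^ n" for x y
      using A[of x y] B[of x y] by (simp_all only: mult.commute)
    have "P = (fst P, affine_form (bform n \<alpha>) (bform n \<beta>))" using P by (metis prod.collapse)
    then have "snd (pullback (blk e1 f1 e2 f2) P) = snd (pullback (blk e1 f1 e2 f2) (fst P, affine_form (bform n \<alpha>) (bform n \<beta>)))" by simp
    also have "\<dots> = power_form n (e1 * a0 + e2 * b0) (f1 * a0 + f2 * b0) (e1 * an + e2 * bn) (f1 * an + f2 * bn)"
      unfolding pullback_affine_form snd_conv power_form_def A' B' by (simp add: algebra_simps)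
    finally show ?thesis .
  qed
  moreover have "(e1 * a0 + e2 * b0) * (f1 * an + f2 * bn) - (f1 * a0 + f2 * b0) * (e1 * an + e2 * bn)
    = (e1 * f2 - e2 * f1) * (a0 * bn - an * b0)" by algebra
  ultimately show ?thesis using ef det by (intro that[of e1 f2 f1 e2]) (auto simp: mult.commute)
qed

section \<open>Diagonal scalings and the exchange of the axes\<close>

lemma pullback_power_form_scale: "pullback (blk r 0 0 s) (l, power_form n a b c d) =
    (vector [r * l$1, s * l$2, l$3], power_form n (r * s ^ n * a) (s ^ (n + 1) * b) (r ^ (n + 1) * c) (s * r ^ n * d))"
  unfolding power_form_def pullback_affine_form by (simp add: power_mult_distrib algebra_simps)

lemma pullback_power_form_swap: "pullback (blk 0 1 1 0) (l, power_form n a b c d) =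
    (vector [l$2, l$1, l$3], power_form n d c b a)"
  unfolding power_form_def pullback_affine_form by (simp add: add.commute)

lemma chart_conjugate_scale:
  assumes "r \<noteq> 0" "s \<noteq> 0" "t \<noteq> 0" "k \<noteq> 0"
    and "l' = vector [t * (r * l$1), t * (s * l$2), t * l$3]"
    and "a' = k * (r * s ^ n * a)" "b' = k * (s ^ (n + 1) * b)" "c' = k * (r ^ (n + 1) * c)" "d' = k * (s * r ^ n * d)"
  shows "chart_conjugate (l, power_form n a b c d) (l', power_form n a' b' c' d')"
proof (rule chart_conjugateI)
  show "r * s - 0 * 0 \<noteq> 0" using assms by simp
  have "l' = t *s vector [r * l$1, s * l$2, l$3]" unfolding assms by (simp add: vec3_eq_iff)
  then show "same_prefoliation (pullback (blk r 0 0 s) (l, power_form n a b c d)) (l', power_form n a' b' c' d')"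
    unfolding pullback_power_form_scale assms(6-9) by (simp only:) (rule same_prefoliation_power_form[OF assms(3,4)])
qed

lemma chart_conjugate_swap:
  "chart_conjugate (l, power_form n a b c d) (vector [l$2, l$1, l$3], power_form n d c b a)"
  by (rule chart_conjugateI[of 0 0 1 1]) (simp_all add: pullback_power_form_swap same_prefoliation_refl)

lemma power_form_nonzero:
  fixes a b c d x y :: complex
  assumes n: "n \<ge> 1" and \<Delta>: "a * d - b * c \<noteq> 0" and z: "c * x ^ n + a * y ^ n = 0" "d * x ^ n + b * y ^ n = 0"
  shows "x = 0 \<and> y = 0"
proof -
  have "(a * d - b * c) * X = 0 \<and> (a * d - b * c) * Y = 0" if "c * X + a * Y = 0" "d * X + b * Y = 0" for X Y
    using that by algebra
  from this[OF z] show ?thesis using \<Delta> by simp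
qed

lemma binomial_form_zero:
  assumes n: "n \<ge> 1"
  obtains x y :: complex where "(x, y) \<noteq> (0, 0)" "\<gamma> * x ^ n + \<delta> * y ^ n = 0"
proof (cases "\<gamma> = 0")
  case True
  then show ?thesis using n by (intro that[of 1 0]) auto
next
  case False
  obtain x where "x ^ n = - \<delta> / \<gamma>"
  proof (cases "\<delta> = 0")
    case True
    then show ?thesis using n by (intro that[of 0]) auto
  next
    case \<delta>: False
    have "card {z. z ^ n = - \<delta> / \<gamma>} = n" using n False \<delta> by (intro card_nth_roots) auto
    then have "{z. z ^ n = - \<delta> / \<gamma>} \<noteq> {}" using n by (metis card.empty not_one_le_zero)
    then show ?thesis using that by blast
  qed
  then show ?thesis using False by (intro that[of x 1]) auto
qed

text \<open>A conjugation between two homogeneous foliations fixes the origin, the only point where the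
  form vanishes to order \<open>n\<close>, and then the line at infinity.\<close>

lemma linearly_conjugate_imp_chart_conjugate:
  assumes n: "n \<ge> 2" and M: "M = (l, power_form n a b c d)" and \<Delta>: "a * d - b * c \<noteq> 0"
    and l: "l$3 = 0 \<or> l$1 = 0 \<and> l$2 = 0"
    and P: "snd P = affine_form (bform n \<alpha>) (bform n \<beta>)"
    and conj: "linearly_conjugate M P"
  shows "chart_conjugate M P"
proof -
  obtain g where g: "invertible g" and same: "same_prefoliation (pullback g M) P"
    using conj unfolding linearly_conjugate_def by blast
  obtain s \<kappa> where s: "s \<noteq> 0" "fst P = s *s (transpose g *v l)" and \<kappa>: "\<kappa> \<noteq> 0"
    "\<And>v. snd P v = \<kappa> *s (transpose g *v power_form n a b c d (g *v v))"
    using same unfolding same_prefoliation_def pullback_def M by auto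
  obtain h where gh: "g ** h = mat 1" "h ** g = mat 1" using g unfolding invertible_def by blast
  have inv_t: "transpose h *v (transpose g *v v) = v" for v
    using gh by (metis matrix_transpose_mul matrix_vector_mul_assoc matrix_vector_mul_lid transpose_mat)
  define A B where "A x y = c * x ^ n + a * y ^ n" and "B x y = d * x ^ n + b * y ^ n" for x y :: complex
  define e3 :: "complex ^ 3" where "e3 = vector [0, 0, 1]"
  define x0 where "x0 = g *v e3"
  define w where "w = h *v e3"
  have gw: "g *v w = e3" unfolding w_def matrix_vector_mul_assoc gh by simp
  \<comment> \<open>The two forms are compared along the line \<open>e3 + t w\<close> through the
    origin, where \<open>w\<close> is chosen so that its image moves only the third coordinate. On
    the side of \<open>M\<close> the first two entries are then affine in \<open>t\<close>, while
    the side of \<open>P\<close> is divisible by \<open>t^n\<close>.\<close>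
  have key: "\<kappa> *s vector [(x0$3 + t) * A (x0$1) (x0$2), (x0$3 + t) * B (x0$1) (x0$2), - (x0$1 * A (x0$1) (x0$2) + x0$2 * B (x0$1) (x0$2))]
    = t ^ n *s (transpose h *v vector [(1 + t * w$3) * bform n \<alpha> (w$1) (w$2), (1 + t * w$3) * bform n \<beta> (w$1) (w$2),
        - t * (w$1 * bform n \<alpha> (w$1) (w$2) + w$2 * bform n \<beta> (w$1) (w$2))])" for t
  proof -
    have "g *v (e3 + t *s w) = x0 + t *s e3"
      by (simp add: matrix_vector_right_distrib vector_scalar_commute gw x0_def)
    then have "\<kappa> *s power_form n a b c d (x0 + t *s e3) = transpose h *v snd P (e3 + t *s w)"
      unfolding \<kappa>(2) by (simp add: vector_scalar_commute inv_t del: transpose_matrix_vector)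
    moreover have "power_form n a b c d (x0 + t *s e3) = vector [(x0$3 + t) * A (x0$1) (x0$2), (x0$3 + t) * B (x0$1) (x0$2),
      - (x0$1 * A (x0$1) (x0$2) + x0$2 * B (x0$1) (x0$2))]"
      unfolding power_form_def affine_form_def A_def B_def e3_def by simp
    moreover have "snd P (e3 + t *s w) = t ^ n *s vector [(1 + t * w$3) * bform n \<alpha> (w$1) (w$2), (1 + t * w$3) * bform n \<beta> (w$1) (w$2),
        - t * (w$1 * bform n \<alpha> (w$1) (w$2) + w$2 * bform n \<beta> (w$1) (w$2))]"
      unfolding P affine_form_def e3_def by (simp add: vec3_eq_iff bform_homogeneous algebra_simps)
    ultimately show ?thesis by (simp add: vector_scalar_commute del: transpose_matrix_vector)
  qed
  \<comment> \<open>Coefficient of \<open>t\<close>: the right-hand side has none because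
    \<open>n \<ge> 2\<close>.\<close>
  have van: "y = 0" if yt: "\<And>t. \<kappa> * ((x0$3 + t) * y) = t ^ n * (p + t * q)" for y p q
  proof -
    have "poly [:\<kappa> * x0$3 * y, \<kappa> * y:] t = poly (monom 1 n * [:p, q:]) t" for t
      using yt[of t] by (simp add: poly_monom algebra_simps)
    then have "[:\<kappa> * x0$3 * y, \<kappa> * y:] = monom 1 n * [:p, q:]" using poly_eq_poly_eq_iff by blast
    from arg_cong[OF this, of "\<lambda>f. coeff f 1"] have "\<kappa> * y = 0" using n by (simp add: coeff_monom_mult)
    then show ?thesis using \<kappa>(1) by simp
  qed
  have "A (x0$1) (x0$2) = 0"
    by (rule van[of _ "transpose h $ 1 $ 1 * bform n \<alpha> (w$1) (w$2) + transpose h $ 1 $ 2 * bform n \<beta> (w$1) (w$2)"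
          "transpose h $ 1 $ 1 * w$3 * bform n \<alpha> (w$1) (w$2) + transpose h $ 1 $ 2 * w$3 * bform n \<beta> (w$1) (w$2)
           - transpose h $ 1 $ 3 * (w$1 * bform n \<alpha> (w$1) (w$2) + w$2 * bform n \<beta> (w$1) (w$2))"])
      (use key in \<open>simp add: vec3_eq_iff matrix_vector_mult_def sum_3 algebra_simps del: transpose_matrix_vector\<close>)
  moreover have "B (x0$1) (x0$2) = 0"
    by (rule van[of _ "transpose h $ 2 $ 1 * bform n \<alpha> (w$1) (w$2) + transpose h $ 2 $ 2 * bform n \<beta> (w$1) (w$2)"
          "transpose h $ 2 $ 1 * w$3 * bform n \<alpha> (w$1) (w$2) + transpose h $ 2 $ 2 * w$3 * bform n \<beta> (w$1) (w$2)
           - transpose h $ 2 $ 3 * (w$1 * bform n \<alpha> (w$1) (w$2) + w$2 * bform n \<beta> (w$1) (w$2))"])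
      (use key in \<open>simp add: vec3_eq_iff matrix_vector_mult_def sum_3 algebra_simps del: transpose_matrix_vector\<close>)
  ultimately have x00: "x0$1 = 0" "x0$2 = 0"
    using power_form_nonzero[of n a d b c "x0$1" "x0$2"] n \<Delta> unfolding A_def B_def by auto
  then have col: "g$1$3 = 0" "g$2$3 = 0"
    unfolding x0_def e3_def by (simp_all add: matrix_vector_mult_def sum_3)
  define u1 u2 v1 v2 w1 w2 z0 where "u1 = g$1$1" "u2 = g$1$2" "v1 = g$2$1" "v2 = g$2$2" "w1 = g$3$1" "w2 = g$3$2" "z0 = g$3$3"
  note gdefs = this
  have D: "u1 * v2 - u2 * v1 \<noteq> 0" and z0: "z0 \<noteq> 0"
  proof -
    have "det g = z0 * (u1 * v2 - u2 * v1)" unfolding det_3 gdefs col by (simp add: algebra_simps)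
    then show "u1 * v2 - u2 * v1 \<noteq> 0" "z0 \<noteq> 0" using g by (auto simp: invertible_det_nz)
  qed
  have gv: "g *v v = vector [u1 * v$1 + u2 * v$2, v1 * v$1 + v2 * v$2, w1 * v$1 + w2 * v$2 + z0 * v$3]" for v
    unfolding gdefs by (simp add: vec3_eq_iff matrix_vector_mult_def sum_3 col)
  have gt: "transpose g *v v = vector [u1 * v$1 + v1 * v$2 + w1 * v$3, u2 * v$1 + v2 * v$2 + w2 * v$3, z0 * v$3]" for v
    unfolding gdefs by (simp add: vec3_eq_iff matrix_vector_mult_def transpose_def sum_3 col del: transpose_matrix_vector)
  \<comment> \<open>On the line at infinity the first two components of \<open>snd P\<close> vanish.
    Eliminating the radial term from the two resulting relations leaves this
    proportionality.\<close>
  have inf: "w2 * (u1 * A X Y + v1 * B X Y) = w1 * (u2 * A X Y + v2 * B X Y)"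
    if XY: "X = u1 * x + u2 * y" "Y = v1 * x + v2 * y" and xy: "(x, y) \<noteq> (0, 0)" for x y X Y
  proof -
    have "snd P (vector [x, y, 0]) $ 1 = 0" "snd P (vector [x, y, 0]) $ 2 = 0"
      unfolding P affine_form_def by simp_all
    moreover have gx: "g *v vector [x, y, 0] = vector [X, Y, w1 * x + w2 * y]" unfolding gv XY by simp
    moreover have "power_form n a b c d (vector [X, Y, w1 * x + w2 * y]) =
      vector [(w1 * x + w2 * y) * A X Y, (w1 * x + w2 * y) * B X Y, - (X * A X Y + Y * B X Y)]"
      unfolding power_form_def affine_form_def A_def B_def by simp
    ultimately have "\<kappa> * (u1 * ((w1 * x + w2 * y) * A X Y) + v1 * ((w1 * x + w2 * y) * B X Y) + w1 * - (X * A X Y + Y * B X Y)) = 0"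
      "\<kappa> * (u2 * ((w1 * x + w2 * y) * A X Y) + v2 * ((w1 * x + w2 * y) * B X Y) + w2 * - (X * A X Y + Y * B X Y)) = 0"
      unfolding \<kappa>(2) gt by (simp_all only: vector_smult_component vector_3)
    then have "u1 * ((w1 * x + w2 * y) * A X Y) + v1 * ((w1 * x + w2 * y) * B X Y) + w1 * - (X * A X Y + Y * B X Y) = 0"
      "u2 * ((w1 * x + w2 * y) * A X Y) + v2 * ((w1 * x + w2 * y) * B X Y) + w2 * - (X * A X Y + Y * B X Y) = 0"
      using \<kappa>(1) by (simp_all only: mult_eq_0_iff simp_thms)
    moreover have "y * (w2 * (u1 * p + v1 * q) - w1 * (u2 * p + v2 * q)) = 0 \<and>
      x * (w2 * (u1 * p + v1 * q) - w1 * (u2 * p + v2 * q)) = 0"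
      if "u1 * ((w1 * x + w2 * y) * p) + v1 * ((w1 * x + w2 * y) * q) + w1 * - ((u1 * x + u2 * y) * p + (v1 * x + v2 * y) * q) = 0"
        "u2 * ((w1 * x + w2 * y) * p) + v2 * ((w1 * x + w2 * y) * q) + w2 * - ((u1 * x + u2 * y) * p + (v1 * x + v2 * y) * q) = 0" for p q
      using that by algebra
    ultimately have "y * (w2 * (u1 * A X Y + v1 * B X Y) - w1 * (u2 * A X Y + v2 * B X Y)) = 0"
      "x * (w2 * (u1 * A X Y + v1 * B X Y) - w1 * (u2 * A X Y + v2 * B X Y)) = 0"
      unfolding XY by blast+
    then show ?thesis using xy by auto
  qed
  \<comment> \<open>If one of \<open>w1\<close>, \<open>w2\<close> is nonzero, choose a point where
    the combination of \<open>A\<close> and \<open>B\<close> multiplied by the other one vanishes.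
    Then \<open>inf\<close> kills the second combination too, and \<open>A\<close>, \<open>B\<close>
    would have a common zero.\<close>
  have w0: "w1 = 0 \<and> w2 = 0"
  proof (rule ccontr)
    assume w: "\<not> (w1 = 0 \<and> w2 = 0)"
    define r1 r2 where "r1 = (if w1 = 0 then u2 else u1)" and "r2 = (if w1 = 0 then v2 else v1)"
    obtain X Y where XY: "(X, Y) \<noteq> (0, 0)" "(r1 * c + r2 * d) * X ^ n + (r1 * a + r2 * b) * Y ^ n = 0"
      using binomial_form_zero[of n] n by (metis One_nat_def Suc_1 Suc_leD)
    define e x y where "e = u1 * v2 - u2 * v1" and "x = (v2 * X - u2 * Y) / e" and "y = (u1 * Y - v1 * X) / e"
    have X: "X = u1 * x + u2 * y" "Y = v1 * x + v2 * y"
    proof -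
      have "e * X = u1 * (v2 * X - u2 * Y) + u2 * (u1 * Y - v1 * X)" "e * Y = v1 * (v2 * X - u2 * Y) + v2 * (u1 * Y - v1 * X)"
        unfolding e_def by algebra+
      moreover have "e \<noteq> 0" using D by (simp add: e_def)
      moreover have "z = p * (q / e) + r * (t / e)" if "e * z = p * q + r * t" "e \<noteq> 0" for z p q r t
        using that by (simp add: add_divide_distrib[symmetric] nonzero_eq_divide_eq mult.commute)
      ultimately show "X = u1 * x + u2 * y" "Y = v1 * x + v2 * y"
        unfolding x_def y_def by blast+
    qed
    have xy: "(x, y) \<noteq> (0, 0)" using X XY(1) by auto
    have z: "r1 * A X Y + r2 * B X Y = 0" using XY(2) unfolding A_def B_def by (simp add: algebra_simps)
    have "u1 * A X Y + v1 * B X Y = 0 \<and> u2 * A X Y + v2 * B X Y = 0"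
      using inf[OF X xy] z w unfolding r1_def r2_def by (cases "w1 = 0") auto
    then have "(u1 * v2 - u2 * v1) * A X Y = 0" "(u1 * v2 - u2 * v1) * B X Y = 0" by algebra+
    then have "A X Y = 0" "B X Y = 0" using D by auto
    then show False using power_form_nonzero[of n a d b c X Y] n \<Delta> XY(1) unfolding A_def B_def by auto
  qed
  show ?thesis
  proof (rule chart_conjugateI[OF D])
    have "snd P v = (\<kappa> * z0) *s snd (pullback (blk u1 u2 v1 v2) M) v" for v
      unfolding \<kappa>(2) M power_form_def pullback_affine_form snd_conv gv gt affine_form_def
      using w0 by (simp add: vec3_eq_iff algebra_simps)
    moreover have "\<exists>s'. s' \<noteq> 0 \<and> fst P = s' *s fst (pullback (blk u1 u2 v1 v2) M)"
    proof (cases "l$3 = 0")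
      case True
      then show ?thesis unfolding s(2) M pullback_line gt using w0 s(1) by (intro exI[of _ s]) (simp add: vec3_eq_iff)
    next
      case False
      then show ?thesis unfolding s(2) M pullback_line gt using w0 s(1) l z0 by (intro exI[of _ "s * z0"]) (simp add: vec3_eq_iff)
    qed
    ultimately show "same_prefoliation (pullback (blk u1 u2 v1 v2) M) P"
      unfolding same_prefoliation_def using \<kappa>(1) z0 by (metis mult_eq_0_iff)
  qed
qed

text \<open>Every chart conjugate of a normal form is an instance of the locale, with
  \<open>u\<close> and \<open>v\<close> the rows of the coordinate change. Hence one criterion
  decides flatness for the whole class.\<close>

lemma chart_conjugate_bipower_form:
  assumes n: "n \<ge> 2" and \<Delta>: "a * d - b * c \<noteq> 0" and conj: "chart_conjugate (l, power_form n a b c d) Q"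
  obtains u1 u2 v1 v2 \<kappa> s where "\<kappa> \<noteq> 0" "s \<noteq> 0" "bipower_form n Q u1 u2 v1 v2 (\<kappa> * a) (\<kappa> * b) (\<kappa> * c) (\<kappa> * d)"
    "fst Q = vector [s * (u1 * l$1 + v1 * l$2), s * (u2 * l$1 + v2 * l$2), s * l$3]"
proof -
  obtain u1 u2 v1 v2 where D: "u1 * v2 - u2 * v1 \<noteq> 0" and same: "same_prefoliation (pullback (blk u1 u2 v1 v2) (l, power_form n a b c d)) Q"
    using conj unfolding chart_conjugate_def by blast
  obtain s \<kappa> where s: "s \<noteq> 0" "fst Q = s *s vector [u1 * l$1 + v1 * l$2, u2 * l$1 + v2 * l$2, l$3]"
    and \<kappa>: "\<kappa> \<noteq> 0" "\<And>v. snd Q v = \<kappa> *s snd (pullback (blk u1 u2 v1 v2) (l, power_form n a b c d)) v"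
    using same unfolding same_prefoliation_def pullback_line by auto
  have "bipower_form n Q u1 u2 v1 v2 (\<kappa> * a) (\<kappa> * b) (\<kappa> * c) (\<kappa> * d)"
  proof
    have "\<kappa> * a * (\<kappa> * d) - \<kappa> * b * (\<kappa> * c) = \<kappa> * \<kappa> * (a * d - b * c)" by algebra
    then show "\<kappa> * a * (\<kappa> * d) - \<kappa> * b * (\<kappa> * c) \<noteq> 0" using \<kappa>(1) \<Delta> by simp
    show "affA Q x y = (\<kappa> * c * u1 + \<kappa> * d * v1) * (u1 * x + u2 * y) ^ n + (\<kappa> * a * u1 + \<kappa> * b * v1) * (v1 * x + v2 * y) ^ n" for x y
      unfolding affA_def \<kappa>(2) power_form_def pullback_affine_form by (simp add: affine_form_def algebra_simps)
    show "affB Q x y = (\<kappa> * c * u2 + \<kappa> * d * v2) * (u1 * x + u2 * y) ^ n + (\<kappa> * a * u2 + \<kappa> * b * v2) * (v1 * x + v2 * y) ^ n" for x y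
      unfolding affB_def \<kappa>(2) power_form_def pullback_affine_form by (simp add: affine_form_def algebra_simps)
  qed (use n D in auto)
  moreover have "fst Q = vector [s * (u1 * l$1 + v1 * l$2), s * (u2 * l$1 + v2 * l$2), s * l$3]"
    unfolding s(2) by (simp add: vec3_eq_iff)
  ultimately show ?thesis using that \<kappa>(1) s(1) by blast
qed

text \<open>\<open>K = 0\<close> forces \<open>m = 0\<close>. Otherwise
  \<open>a c = b d = 0\<close>, and the nonzero determinant leaves only diagonal or antidiagonal
  matrices; the factor \<open>\<kappa>\<close> is absorbed by \<open>K\<close>.\<close>

lemma quadratic_criterion_iff:
  fixes \<kappa> :: complex
  assumes \<kappa>: "\<kappa> \<noteq> 0" and \<Delta>: "a * d - b * c \<noteq> 0"
  shows "(\<exists>K. K * (\<kappa> * a) * (\<kappa> * c) = 0 \<and> K * (\<kappa> * b) * (\<kappa> * d) = 0 \<and> m = K * ((\<kappa> * a) * (\<kappa> * d) + (\<kappa> * b) * (\<kappa> * c)))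
    \<longleftrightarrow> m = 0 \<or> (a = 0 \<and> d = 0) \<or> (b = 0 \<and> c = 0)" (is "?L \<longleftrightarrow> ?R")
proof
  assume ?L
  then obtain K where K: "K * (\<kappa> * a) * (\<kappa> * c) = 0" "K * (\<kappa> * b) * (\<kappa> * d) = 0" "m = K * ((\<kappa> * a) * (\<kappa> * d) + (\<kappa> * b) * (\<kappa> * c))" by blast
  show ?R
  proof (cases "K = 0")
    case False
    then have "a = 0 \<or> c = 0" "b = 0 \<or> d = 0" using K \<kappa> by auto
    then show ?thesis using \<Delta> by auto
  qed (use K in simp)
next
  assume R: ?R
  show ?L
  proof (cases "m = 0")
    case True
    then show ?thesis by (intro exI[of _ 0]) simp
  next
    case False
    then have R': "(a = 0 \<and> d = 0) \<or> (b = 0 \<and> c = 0)" using R by simp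
    then have s: "a * d + b * c \<noteq> 0" using \<Delta> by auto
    moreover have "(\<kappa> * a) * (\<kappa> * d) + (\<kappa> * b) * (\<kappa> * c) = \<kappa>^2 * (a * d + b * c)" by algebra
    ultimately have "m = m / (\<kappa>^2 * (a * d + b * c)) * ((\<kappa> * a) * (\<kappa> * d) + (\<kappa> * b) * (\<kappa> * c))"
      using \<kappa> by simp
    then show ?thesis using R' by (intro exI[of _ "m / (\<kappa>^2 * (a * d + b * c))"]) auto
  qed
qed

text \<open>For \<open>n = 2\<close> the multiplier \<open>n - 2\<close> vanishes and the web is
  always flat; this is the origin of the continuous families in degree 3.\<close>

lemma flat_line_infinity_iff:
  assumes n: "n \<ge> 2" and \<Delta>: "a * d - b * c \<noteq> 0" and Q: "chart_conjugate (vector [0, 0, 1], power_form n a b c d) Q"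
  shows "leg_flat (n + 1) Q \<longleftrightarrow> n = 2 \<or> (a = 0 \<and> d = 0) \<or> (b = 0 \<and> c = 0)"
proof -
  obtain u1 u2 v1 v2 \<kappa> s where \<kappa>: "\<kappa> \<noteq> 0" and s: "s \<noteq> 0" and bf: "bipower_form n Q u1 u2 v1 v2 (\<kappa> * a) (\<kappa> * b) (\<kappa> * c) (\<kappa> * d)"
    and l: "fst Q = vector [0, 0, s]" using chart_conjugate_bipower_form[OF n \<Delta> Q] by simp metis
  have "of_nat n - 2 = (0 :: complex) \<longleftrightarrow> n = 2"
    using of_nat_eq_iff[where 'a = complex, of n 2] by simp
  then show ?thesis
    unfolding bipower_form.flat_line_infinity[OF bf s l] quadratic_criterion_iff[OF \<kappa> \<Delta>] by simp
qed

lemma flat_critical_line_iff: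
  assumes n: "n \<ge> 2" and \<Delta>: "a * d - b * c \<noteq> 0" and Q: "chart_conjugate (vector [1, 0, 0], power_form n a b c d) Q"
  shows "leg_flat (n + 1) Q \<longleftrightarrow> (a = 0 \<and> d = 0) \<or> (b = 0 \<and> c = 0)"
proof -
  obtain u1 u2 v1 v2 \<kappa> s where \<kappa>: "\<kappa> \<noteq> 0" and s: "s \<noteq> 0" and bf: "bipower_form n Q u1 u2 v1 v2 (\<kappa> * a) (\<kappa> * b) (\<kappa> * c) (\<kappa> * d)"
    and l: "fst Q = vector [s * u1, s * u2, 0]" using chart_conjugate_bipower_form[OF n \<Delta> Q] by simp metis
  have "of_nat n + 1 \<noteq> (0 :: complex)" by (metis of_nat_Suc of_nat_eq_0_iff add.commute nat.distinct(1))
  then show ?thesis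
    unfolding bipower_form.flat_critical_line[OF bf s l] quadratic_criterion_iff[OF \<kappa> \<Delta>] by simp
qed

text \<open>The coefficients of the cubic identity \<open>J = K\<close> in \<open>U / V\<close>,
  from degree 3 down to 0, with \<open>n - 2\<close> replaced by a free number
  \<open>m\<close>.\<close>

definition cubic_crit :: "complex \<Rightarrow> complex \<Rightarrow> complex \<Rightarrow> complex \<Rightarrow> complex \<Rightarrow> complex \<Rightarrow> bool" where
  "cubic_crit m K a b c d \<longleftrightarrow> - 3 * c = K * a * c * (a + c) \<and>
    m * (a + c) - 3 * (d - a) + 3 * c = K * (a * c * (b + d) + (a * d + b * c) * (a + c)) \<and>
    m * (b + d) + 3 * b + 3 * (d - a) = K * ((a * d + b * c) * (b + d) + b * d * (a + c)) \<and>
    - 3 * b = K * b * d * (b + d)"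

text \<open>The left-hand sides are linear in the coefficients and the right-hand sides cubic, so
  \<open>K\<close> scales by the inverse square.\<close>

lemma cubic_crit_scale:
  assumes "k \<noteq> 0"
  shows "cubic_crit m (K / k^2) (k * a) (k * b) (k * c) (k * d) \<longleftrightarrow> cubic_crit m K a b c d"
proof -
  define r where "r = 1 / k^2"
  have r: "r * k^2 = 1" using assms unfolding r_def by simp
  have K: "K / k^2 = K * r" unfolding r_def by simp
  have "(k * x = K * r * (k^3 * y)) \<longleftrightarrow> x = K * y" for x y
  proof -
    have e: "K * r * (k^3 * y) = k * (K * y)" using r by algebra
    show ?thesis unfolding e using assms by simp
  qed
  from this[of "- 3 * c" "a * c * (a + c)"] this[of "m * (a + c) - 3 * (d - a) + 3 * c" "a * c * (b + d) + (a * d + b * c) * (a + c)"]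
    this[of "m * (b + d) + 3 * b + 3 * (d - a)" "(a * d + b * c) * (b + d) + b * d * (a + c)"] this[of "- 3 * b" "b * d * (b + d)"]
  show ?thesis unfolding cubic_crit_def K by (simp add: algebra_simps power3_eq_cube)
qed

lemma flat_general_line_iff:
  assumes n: "n \<ge> 2" and \<Delta>: "a * d - b * c \<noteq> 0" and Q: "chart_conjugate (vector [1, - 1, 0], power_form n a b c d) Q"
  shows "leg_flat (n + 1) Q \<longleftrightarrow> (\<exists>K. cubic_crit (of_nat n - 2) K a b c d)"
proof -
  obtain u1 u2 v1 v2 \<kappa> s where \<kappa>: "\<kappa> \<noteq> 0" and s: "s \<noteq> 0" and bf: "bipower_form n Q u1 u2 v1 v2 (\<kappa> * a) (\<kappa> * b) (\<kappa> * c) (\<kappa> * d)"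
    and l: "fst Q = vector [s * (u1 - v1), s * (u2 - v2), 0]" using chart_conjugate_bipower_form[OF n \<Delta> Q] by simp metis
  have "(\<exists>K. cubic_crit (of_nat n - 2) K (\<kappa> * a) (\<kappa> * b) (\<kappa> * c) (\<kappa> * d)) \<longleftrightarrow> (\<exists>K. cubic_crit (of_nat n - 2) K a b c d)"
  proof
    assume "\<exists>K. cubic_crit (of_nat n - 2) K (\<kappa> * a) (\<kappa> * b) (\<kappa> * c) (\<kappa> * d)"
    then obtain K where "cubic_crit (of_nat n - 2) K (\<kappa> * a) (\<kappa> * b) (\<kappa> * c) (\<kappa> * d)" by blast
    then have "cubic_crit (of_nat n - 2) (K * \<kappa>^2 / \<kappa>^2) (\<kappa> * a) (\<kappa> * b) (\<kappa> * c) (\<kappa> * d)" using \<kappa> by simp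
    then show "\<exists>K. cubic_crit (of_nat n - 2) K a b c d" unfolding cubic_crit_scale[OF \<kappa>] by blast
  next
    assume "\<exists>K. cubic_crit (of_nat n - 2) K a b c d"
    then show "\<exists>K. cubic_crit (of_nat n - 2) K (\<kappa> * a) (\<kappa> * b) (\<kappa> * c) (\<kappa> * d)" using cubic_crit_scale[OF \<kappa>] by blast
  qed
  then show ?thesis unfolding bipower_form.flat_general_line[OF bf s l] cubic_crit_def .
qed

section \<open>Pull-back of foliations\<close>

lemma hom_poly_add:
  assumes "hom_poly n f" "hom_poly n g"
  shows "hom_poly n (\<lambda>v. f v + g v)"
proof -
  obtain c e where "\<And>v. f v = (\<Sum>i\<le>n. \<Sum>j\<le>n - i. c i j * v$1 ^ i * v$2 ^ j * v$3 ^ (n - i - j))"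
    "\<And>v. g v = (\<Sum>i\<le>n. \<Sum>j\<le>n - i. e i j * v$1 ^ i * v$2 ^ j * v$3 ^ (n - i - j))"
    using assms unfolding hom_poly_def by blast
  then show ?thesis unfolding hom_poly_def
    by (intro exI[of _ "\<lambda>i j. c i j + e i j"]) (simp add: sum.distrib algebra_simps)
qed

lemma hom_poly_smult:
  assumes "hom_poly n f"
  shows "hom_poly n (\<lambda>v. k * f v)"
proof -
  obtain c where "\<And>v. f v = (\<Sum>i\<le>n. \<Sum>j\<le>n - i. c i j * v$1 ^ i * v$2 ^ j * v$3 ^ (n - i - j))"
    using assms unfolding hom_poly_def by blast
  then show ?thesis unfolding hom_poly_def
    by (intro exI[of _ "\<lambda>i j. k * c i j"]) (simp add: sum_distrib_left mult_ac)
qed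

lemma hom_poly_sum:
  assumes "finite I" "\<And>i. i \<in> I \<Longrightarrow> hom_poly n (f i)"
  shows "hom_poly n (\<lambda>v. \<Sum>i\<in>I. f i v)"
  using assms by (induction I) (auto simp: hom_poly_zero hom_poly_add)

lemma hom_poly_mult_component:
  assumes "hom_poly n f"
  shows "hom_poly (Suc n) (\<lambda>v. v$i * f v)"
proof -
  obtain A where f: "\<And>v. f v = (\<Sum>k\<le>n. bform (n - k) (A k) (v$1) (v$2) * v$3 ^ k)"
    using hom_poly_decompose[OF assms] by blast
  have "hom_poly (Suc n) (\<lambda>v. v$i * (bform (n - k) (A k) (v$1) (v$2) * v$3 ^ k))" if "k \<le> n" for k
  proof -
    have 1: "hom_poly (Suc n) (\<lambda>v. v$3 ^ k * bform (Suc (n - k)) a (v$1) (v$2))" for a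
      using hom_poly_bform[of k "Suc (n - k)" a] that by simp
    have 3: "hom_poly (Suc n) (\<lambda>v. v$3 ^ Suc k * bform (n - k) a (v$1) (v$2))" for a
      using hom_poly_bform[of "Suc k" "n - k" a] that by simp
    consider "i = 1" | "i = 2" | "i = 3" using exhaust_3 by blast
    then show ?thesis
    proof cases
      case 1
      have "v$1 * (bform (n - k) (A k) (v$1) (v$2) * v$3 ^ k) = v$3 ^ k * (v$1 * bform (n - k) (A k) (v$1) (v$2))" for v :: "complex ^ 3"
        by (simp add: mult_ac)
      then show ?thesis unfolding 1 using \<open>\<And>a. hom_poly (Suc n) (\<lambda>v. v$3 ^ k * bform (Suc (n - k)) a (v$1) (v$2))\<close>
        by (simp only: bform_mult_x)
    next
      case 2
      have "v$2 * (bform (n - k) (A k) (v$1) (v$2) * v$3 ^ k) = v$3 ^ k * (v$2 * bform (n - k) (A k) (v$1) (v$2))" for v :: "complex ^ 3"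
        by (simp add: mult_ac)
      then show ?thesis unfolding 2 using 1 by (simp only: bform_mult_y)
    next
      case 3
      have "v$3 * (bform (n - k) (A k) (v$1) (v$2) * v$3 ^ k) = v$3 ^ Suc k * bform (n - k) (A k) (v$1) (v$2)" for v :: "complex ^ 3"
        by (simp add: mult_ac)
      then show ?thesis unfolding 3 using \<open>\<And>a. hom_poly (Suc n) (\<lambda>v. v$3 ^ Suc k * bform (n - k) a (v$1) (v$2))\<close> by (simp only:)
    qed
  qed
  then show ?thesis unfolding f sum_distrib_left by (intro hom_poly_sum) auto
qed

lemma hom_poly_mult_linear_power:
  assumes "hom_poly n f"
  shows "hom_poly (k + n) (\<lambda>v. (g *v v) $ r ^ k * f v)"
proof (induction k)
  case 0
  then show ?case using assms by simp
next
  case (Suc k)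
  have e: "(g *v v) $ r ^ Suc k * f v = (\<Sum>s\<in>UNIV. g$r$s * (v$s * ((g *v v) $ r ^ k * f v)))" for v
  proof -
    have "(g *v v) $ r * x = (\<Sum>s\<in>UNIV. g$r$s * (v$s * x))" for x
      unfolding matrix_vector_mult_def by (simp add: sum_distrib_right mult.assoc)
    from this[of "(g *v v) $ r ^ k * f v"] show ?thesis by (simp add: mult.assoc)
  qed
  have "hom_poly (Suc (k + n)) (\<lambda>v. \<Sum>s\<in>UNIV. g$r$s * (v$s * ((g *v v) $ r ^ k * f v)))"
    by (intro hom_poly_sum hom_poly_smult hom_poly_mult_component Suc finite)
  then show ?case by (simp only: e add_Suc)
qed

lemma hom_poly_linear_subst:
  assumes "hom_poly n f"
  shows "hom_poly n (\<lambda>v. f (g *v v))"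
proof -
  obtain c where f: "\<And>v. f v = (\<Sum>i\<le>n. \<Sum>j\<le>n - i. c i j * v$1 ^ i * v$2 ^ j * v$3 ^ (n - i - j))"
    using assms unfolding hom_poly_def by blast
  have one: "hom_poly 0 (\<lambda>v. 1)" using hom_poly_bform[of 0 0 "\<lambda>_. 1"] by (simp add: bform_def)
  have "hom_poly n (\<lambda>v. c i j * (g *v v)$1 ^ i * (g *v v)$2 ^ j * (g *v v)$3 ^ (n - i - j))" if "i \<le> n" "j \<le> n - i" for i j
  proof -
    have "hom_poly (i + (j + ((n - i - j) + 0))) (\<lambda>v. (g *v v)$1 ^ i * ((g *v v)$2 ^ j * ((g *v v)$3 ^ (n - i - j) * 1)))"
      by (intro hom_poly_mult_linear_power one)
    moreover have "i + (j + ((n - i - j) + 0)) = n" using that by simp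
    ultimately have "hom_poly n (\<lambda>v. c i j * ((g *v v)$1 ^ i * ((g *v v)$2 ^ j * ((g *v v)$3 ^ (n - i - j) * 1))))"
      using hom_poly_smult by simp
    then show ?thesis by (simp add: mult.assoc)
  qed
  then show ?thesis unfolding f by (intro hom_poly_sum) auto
qed

lemma hom_poly_matrix_combination:
  assumes "\<And>i. hom_poly n (\<lambda>v. F v $ i)"
  shows "hom_poly n (\<lambda>v. (h *v F (g *v v)) $ i)"
  unfolding matrix_vector_mult_def[of h] vec_lambda_beta
  by (intro hom_poly_sum hom_poly_smult) (use hom_poly_linear_subst[OF assms] in auto)

text \<open>A common factor of the pulled-back form would, transported by the inverse matrix, be one
  of \<open>\<Omega>\<close>. This carries the foliation over to the chart \<open>g\<close>, where
  homogeneity is assumed.\<close>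

lemma foliation_pullback:
  assumes fol: "foliation m \<Omega>" and g: "invertible g"
  shows "foliation m (\<lambda>v. transpose g *v \<Omega> (g *v v))"
proof -
  obtain h where gh: "g ** h = mat 1" "h ** g = mat 1" using g unfolding invertible_def by blast
  have inv_t: "transpose h *v (transpose g *v v) = v" for v
    using gh by (metis matrix_transpose_mul matrix_vector_mul_assoc matrix_vector_mul_lid transpose_mat)
  have hp: "\<And>i. hom_poly (m + 1) (\<lambda>v. \<Omega> v $ i)" and rad: "\<And>v. (\<Sum>i\<in>UNIV. v$i * \<Omega> v $ i) = 0"
    using fol unfolding foliation_def by blast+
  show ?thesis
    unfolding foliation_def
  proof (intro conjI allI notI)
    show "hom_poly (m + 1) (\<lambda>v. (transpose g *v \<Omega> (g *v v)) $ i)" for i by (rule hom_poly_matrix_combination[OF hp])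
    show "(\<Sum>i\<in>UNIV. v$i * (transpose g *v \<Omega> (g *v v)) $ i) = 0" for v
    proof -
      have "(\<Sum>i\<in>UNIV. v$i * (transpose g *v \<Omega> (g *v v)) $ i) = (\<Sum>i\<in>UNIV. (g *v v) $ i * \<Omega> (g *v v) $ i)"
        by (simp add: sum_3 matrix_vector_mult_def transpose_def algebra_simps del: transpose_matrix_vector)
      then show ?thesis using rad by simp
    qed
    assume "\<exists>k f Q. 1 \<le> k \<and> k \<le> m + 1 \<and> hom_poly k f \<and> (\<forall>i. hom_poly (m + 1 - k) (\<lambda>v. Q v $ i)) \<and>
      (\<forall>v. transpose g *v \<Omega> (g *v v) = f v *s Q v)"
    then obtain k f Q where k: "1 \<le> k" "k \<le> m + 1" and f: "hom_poly k f" and Q: "\<And>i. hom_poly (m + 1 - k) (\<lambda>v. Q v $ i)"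
      and e: "\<And>v. transpose g *v \<Omega> (g *v v) = f v *s Q v" by blast
    have "\<Omega> v = f (h *v v) *s (transpose h *v Q (h *v v))" for v
    proof -
      have "g *v (h *v v) = v" by (simp add: matrix_vector_mul_assoc gh)
      then have "transpose g *v \<Omega> v = f (h *v v) *s Q (h *v v)" using e[of "h *v v"] by simp
      then show ?thesis using inv_t[of "\<Omega> v"] by (simp add: vector_scalar_commute del: transpose_matrix_vector)
    qed
    then show False
      using foliation_no_factor[OF fol k hom_poly_linear_subst[OF f] hom_poly_matrix_combination[OF Q]] by blast
  qed
qed

lemma prefoliation_pullback:
  assumes "prefoliation d P" "invertible g"
  shows "prefoliation d (pullback g P)"
proof -
  have "transpose g *v fst P \<noteq> 0"
  proof
    assume *: "transpose g *v fst P = 0"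
    obtain h where "g ** h = mat 1" "h ** g = mat 1" using assms(2) unfolding invertible_def by blast
    then have "transpose h *v (transpose g *v fst P) = fst P"
      by (metis matrix_transpose_mul matrix_vector_mul_assoc matrix_vector_mul_lid transpose_mat)
    then show False using * assms(1) unfolding prefoliation_def by (simp del: transpose_matrix_vector)
  qed
  then show ?thesis using assms foliation_pullback unfolding prefoliation_def pullback_def by simp
qed

section \<open>Solutions of the flatness equations\<close>

lemma cubic_crit_swap: "cubic_crit m K d c b a \<longleftrightarrow> cubic_crit m K a b c d"
  unfolding cubic_crit_def by (auto simp: algebra_simps)

text \<open>For \<open>b = 0\<close> two equations remain, and eliminating \<open>K\<close> gives
  \<open>d^2 = a^2\<close>. For \<open>b \<noteq> 0\<close> everything is expressed through
  \<open>K a d\<close>, which is forced to be 3 or -3.\<close>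

lemma cubic_crit_axis:
  fixes a b d m K :: complex
  assumes crit: "cubic_crit m K a b 0 d" and ad: "a \<noteq> 0" "d \<noteq> 0"
  shows "b = 0 \<and> (d = a \<or> d = - a) \<or> 3 * b = - (m + 3) * a \<and> (3 * d = m * a \<or> 3 * d = (m + 6) * a)"
proof (cases "b = 0")
  case True
  have 1: "m * a - 3 * (d - a) = K * (a * d * a)" "m * d + 3 * (d - a) = K * (a * d * d)"
    using crit True unfolding cubic_crit_def by (simp_all add: mult.assoc)
  then have "(d - a) * (d + a) = 0" by algebra
  then show ?thesis using True by (auto simp: eq_neg_iff_add_eq_0)
next
  case False
  define \<kappa> where "\<kappa> = K * a * d"
  have "- 3 * b = K * b * d * (b + d)" using crit unfolding cubic_crit_def by blast
  then have "b * (K * d * (b + d) + 3) = 0" by algebra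
  then have 4: "- 3 = K * d * (b + d)" using False by (simp add: eq_neg_iff_add_eq_0 neg_eq_iff_add_eq_0 add.commute)
  have e4: "- 3 * a = \<kappa> * (b + d)" using 4 unfolding \<kappa>_def by algebra
  have e2: "(m + 3 - \<kappa>) * a = 3 * d" using crit unfolding cubic_crit_def \<kappa>_def by (simp add: algebra_simps)
  have e3: "(m + 3) * (b + d) - 3 * a = \<kappa> * (2 * b + d)" using crit unfolding cubic_crit_def \<kappa>_def by (simp add: algebra_simps)
  have b: "\<kappa>^2 * b = - 3 * a * (m + 3)" using e4 e3 by algebra
  \<comment> \<open>Result of eliminating \<open>b\<close> and \<open>d\<close>; the last factor
    cannot vanish, since \<open>e2\<close> would give \<open>d = 0\<close>.\<close>
  have "a * ((\<kappa> - 3) * (\<kappa> + 3) * (m + 3 - \<kappa>)) = 0" using b e4 e2 by algebra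
  then have "\<kappa> = 3 \<or> \<kappa> = - 3 \<or> m + 3 - \<kappa> = 0" using ad by (auto simp: eq_neg_iff_add_eq_0)
  moreover have "m + 3 - \<kappa> \<noteq> 0" using e2 ad by auto
  ultimately show ?thesis
  proof (elim disjE)
    assume "\<kappa> = 3"
    then have "3 * d = m * a" "9 * b = - 3 * a * (m + 3)" using e2 b by (simp_all add: algebra_simps)
    moreover from this have "3 * b = - (m + 3) * a" by algebra
    ultimately show ?thesis by blast
  next
    assume "\<kappa> = - 3"
    then have "3 * d = (m + 6) * a" "9 * b = - 3 * a * (m + 3)" using e2 b by (simp_all add: algebra_simps)
    moreover from this have "3 * b = - (m + 3) * a" by algebra
    ultimately show ?thesis by blast
  qed simp
qed

text \<open>The alternatives lead, in this order, to models 4 and 3, to models 7 and 6 with the axes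
  exchanged, to models 7 and 6, to model 10 and to model 9.\<close>

lemma cubic_crit_solutions:
  fixes a b c d m K :: complex
  assumes crit: "cubic_crit m K a b c d" and \<Delta>: "a * d - b * c \<noteq> 0"
  shows "b = 0 \<and> c = 0 \<and> (d = a \<or> d = - a) \<or>
    c = 0 \<and> 3 * b = - (m + 3) * a \<and> (3 * d = m * a \<or> 3 * d = (m + 6) * a) \<or>
    b = 0 \<and> 3 * c = - (m + 3) * d \<and> (3 * a = m * d \<or> 3 * a = (m + 6) * d) \<or>
    d = a \<and> b = c \<and> 3 * c = - (m + 3) * a \<or>
    d = - a \<and> b = - c \<and> 3 * c = (m + 3) * a"
proof -
  consider "c = 0" | "b = 0" | "b \<noteq> 0" "c \<noteq> 0" by blast
  then show ?thesis
  proof cases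
    case 1
    then show ?thesis using cubic_crit_axis[of m K a b d] crit \<Delta> by auto
  next
    case 2
    then have "cubic_crit m K d c 0 a" using crit cubic_crit_swap by metis
    moreover have "a \<noteq> 0" "d \<noteq> 0" using \<Delta> 2 by auto
    ultimately have "c = 0 \<and> (a = d \<or> a = - d) \<or> 3 * c = - (m + 3) * d \<and> (3 * a = m * d \<or> 3 * a = (m + 6) * d)"
      using cubic_crit_axis by blast
    then show ?thesis using 2 by auto
  next
    case 3
    have 1: "K * a * (a + c) = - 3" "K * d * (b + d) = - 3"
    proof -
      have "- 3 * c = K * a * c * (a + c)" "- 3 * b = K * b * d * (b + d)" using crit unfolding cubic_crit_def by blast+
      then have "c * (K * a * (a + c) + 3) = 0" "b * (K * d * (b + d) + 3) = 0" by algebra+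
      then show "K * a * (a + c) = - 3" "K * d * (b + d) = - 3" using \<open>b \<noteq> 0\<close> \<open>c \<noteq> 0\<close> by (simp_all add: eq_neg_iff_add_eq_0)
    qed
    then have nz: "K \<noteq> 0" "a \<noteq> 0" "d \<noteq> 0" "a + c \<noteq> 0" "b + d \<noteq> 0" by auto
    have "K * (a * (a + c)) = K * (d * (b + d))" using 1 by (simp add: mult.assoc)
    then have ac: "a * (a + c) = d * (b + d)" using nz by simp
    have 2: "m * (a + c) - 3 * (d - a) + 3 * c = K * (a * c * (b + d) + (a * d + b * c) * (a + c))"
      and 3: "m * (b + d) + 3 * b + 3 * (d - a) = K * ((a * d + b * c) * (b + d) + b * d * (a + c))"
      using crit unfolding cubic_crit_def by auto
    have e2: "a * d * ((m + 3) * (a + c)) = - 3 * c * (a^2 + b * d)"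
      using 2 1 ac by algebra
    have e3: "a * d * ((m + 3) * (b + d)) = - 3 * b * (d^2 + a * c)"
      using 3 1 ac by algebra
    have "c * (a^2 + b * d) * a = b * (d^2 + a * c) * d"
    proof -
      have "(a * d * ((m + 3) * (a + c))) * a = (a * d * ((m + 3) * (b + d))) * d" using ac by algebra
      then have "- 3 * (c * (a^2 + b * d) * a) = - 3 * (b * (d^2 + a * c) * d)" unfolding e2 e3 by (simp add: mult.assoc)
      then show ?thesis by simp
    qed
    \<comment> \<open>Consequence of the two middle equations after eliminating \<open>K\<close> and
      \<open>m\<close>. With \<open>ac\<close>, vanishing of the last factor would give
      \<open>a d = b c\<close>.\<close>
    then have "(a - d) * (a + d) * (a^2 - b * d) = 0" using ac by algebra
    moreover have "a^2 - b * d \<noteq> 0"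
    proof
      assume z: "a^2 - b * d = 0"
      then have "a * c = d^2" using ac by algebra
      then have "a * d * (a * d - b * c) = 0" using z by algebra
      then show False using nz \<Delta> by simp
    qed
    ultimately have "d = a \<or> d = - a" by (auto simp: eq_neg_iff_add_eq_0 add.commute)
    then show ?thesis
    proof
      assume d: "d = a"
      then have "b = c" using ac nz by (simp add: algebra_simps)
      moreover have "a^2 * (a + c) * ((m + 3) * a + 3 * c) = 0" using e2 d \<open>b = c\<close> by algebra
      then have "(m + 3) * a + 3 * c = 0" using nz by simp
      then have "3 * c = - (m + 3) * a" by algebra
      ultimately show ?thesis using d by blast
    next
      assume d: "d = - a"
      then have "a * (c + b) = 0" using ac by algebra
      then have b: "b = - c" using nz by (simp add: eq_neg_iff_add_eq_0 add.commute)
      have "a * (a + c) * ((m + 3) * a - 3 * c) * a = 0" using e2 d b by algebra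
      then have "3 * c = (m + 3) * a" using nz by simp
      then show ?thesis using d b by blast
    qed
  qed
qed

section \<open>The models\<close>

lemma H1_power_form: "H1 n = power_form n 1 0 0 (- 1)"
  unfolding H1_def power_form_def by simp

lemma H2_power_form: "H2 n lam mu = power_form n lam (- 1) 1 mu"
  unfolding H2_def power_form_def by simp

lemma H3_power_form: "H3 n lam = power_form n lam 0 1 1"
  unfolding H3_def power_form_def by simp

lemmas model_defs = model1_def model2_def model3_def model4_def model5_def model6_def model7_def model8_def
  model9_def model10_def cubic_model7_def cubic_model8_def H1_power_form H2_power_form H3_power_form
  line_inf_def line0_def

lemma complex_root_exists:
  fixes w :: complex
  assumes "n \<ge> 1" "w \<noteq> 0"
  shows "\<exists>z. z ^ n = w \<and> z \<noteq> 0"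
proof -
  have "card {z. z ^ n = w} = n" using assms by (intro card_nth_roots) auto
  then obtain z where "z ^ n = w" using assms(1) by (metis (mono_tags, lifting) card.empty empty_Collect_eq not_one_le_zero)
  then show ?thesis using assms by (intro exI[of _ z]) auto
qed

lemma xi_power: "n \<ge> 2 \<Longrightarrow> xi (n + 1) ^ (n - 1) = - 1"
proof -
  assume n: "n \<ge> 2"
  have "xi (n + 1) ^ (n - 1) = exp (of_nat (n - 1) * (\<i> * of_real pi / (of_nat (n + 1) - 2)))"
    unfolding xi_def exp_of_nat_mult ..
  also have "of_nat (n + 1) - 2 = (of_nat (n - 1) :: complex)" using n by (simp add: of_nat_diff)
  also have "of_nat (n - 1) * (\<i> * of_real pi / of_nat (n - 1)) = \<i> * of_real pi" using n by simp
  finally show ?thesis using exp_pi_i by (simp add: mult.commute)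
qed

lemma xi'_power: "xi' (n + 1) ^ (n + 1) = - 1"
proof -
  have "xi' (n + 1) ^ (n + 1) = exp (of_nat (n + 1) * (\<i> * of_real pi / of_nat (n + 1)))"
    unfolding xi'_def exp_of_nat_mult ..
  also have "of_nat (n + 1) * (\<i> * of_real pi / of_nat (n + 1)) = \<i> * of_real pi" by (simp del: of_nat_Suc of_nat_add)
  finally show ?thesis using exp_pi_i by (simp add: mult.commute)
qed

lemma xi_nonzero: "xi d \<noteq> 0" "xi' d \<noteq> 0"
  unfolding xi_def xi'_def by simp_all

text \<open>Scaling \<open>x\<close> by \<open>r\<close> multiplies \<open>d / a\<close> by
  \<open>r^(n - 1)\<close>, which has to become \<open>- 1\<close>; for the antidiagonal forms
  below, \<open>c / b\<close> is multiplied by \<open>r^(n + 1)\<close> instead.\<close>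

lemma to_H1_through_origin_or_infinity:
  assumes n: "n \<ge> 2" and a: "a \<noteq> 0" "d \<noteq> 0"
  shows "chart_conjugate (vector [0, 0, 1], power_form n a 0 0 d) (model1 (n + 1))"
    and "chart_conjugate (vector [1, 0, 0], power_form n a 0 0 d) (model2 (n + 1))"
proof -
  obtain r where r: "r ^ (n - 1) = - a / d" "r \<noteq> 0" using complex_root_exists[of "n - 1" "- a / d"] n a by force
  have rn: "r ^ n = r * (- a / d)" using r(1) n by (metis One_nat_def Suc_1 Suc_le_D diff_Suc_1 power_Suc)
  show "chart_conjugate (vector [0, 0, 1], power_form n a 0 0 d) (model1 (n + 1))"
    unfolding model_defs add_diff_cancel_right'
    by (rule chart_conjugate_scale[of r 1 1 "1 / (r * a)"]) (use r a rn in simp_all)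
  show "chart_conjugate (vector [1, 0, 0], power_form n a 0 0 d) (model2 (n + 1))"
    unfolding model_defs add_diff_cancel_right'
    by (rule chart_conjugate_scale[of r 1 "1 / r" "1 / (r * a)"]) (use r a rn in simp_all)
qed

lemma to_H2_through_origin_or_infinity:
  assumes n: "n \<ge> 2" and b: "b \<noteq> 0" "c \<noteq> 0"
  shows "chart_conjugate (vector [0, 0, 1], power_form n 0 b c 0) (model8 (n + 1))"
    and "chart_conjugate (vector [1, 0, 0], power_form n 0 b c 0) (model5 (n + 1))"
proof -
  obtain r where r: "r ^ (n + 1) = - b / c" "r \<noteq> 0" using complex_root_exists[of "n + 1" "- b / c"] b by force
  show "chart_conjugate (vector [0, 0, 1], power_form n 0 b c 0) (model8 (n + 1))"
    unfolding model_defs add_diff_cancel_right'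
    by (rule chart_conjugate_scale[of r 1 1 "- 1 / b"]) (use r(2) b in \<open>simp_all add: r(1)[simplified]\<close>)
  show "chart_conjugate (vector [1, 0, 0], power_form n 0 b c 0) (model5 (n + 1))"
    unfolding model_defs add_diff_cancel_right'
    by (rule chart_conjugate_scale[of r 1 "1 / r" "- 1 / b"]) (use r(2) b in \<open>simp_all add: r(1)[simplified]\<close>)
qed

lemma to_model3:
  assumes "a \<noteq> 0"
  shows "chart_conjugate (vector [1, - 1, 0], power_form n a 0 0 (- a)) (model3 (n + 1))"
  unfolding model_defs add_diff_cancel_right'
  by (rule chart_conjugate_scale[of 1 1 "- 1" "1 / a"]) (use assms in simp_all)

text \<open>The solution \<open>d = a\<close> needs its sign changed by a scaling \<open>r\<close>
  with \<open>r^(n - 1) = - 1\<close>. \<open>xi\<close> is such a number, and the scaling turns the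
  line \<open>y = x\<close> into \<open>y = xi x\<close>.\<close>

lemma to_model4:
  assumes n: "n \<ge> 2" and a: "a \<noteq> 0"
  shows "chart_conjugate (vector [1, - 1, 0], power_form n a 0 0 a) (model4 (n + 1))"
proof -
  have xn: "xi (n + 1) ^ n = - xi (n + 1)"
    using xi_power[OF n] n by (metis One_nat_def Suc_1 Suc_le_D diff_Suc_1 mult_minus1_right power_Suc)
  show ?thesis unfolding model_defs add_diff_cancel_right'
    by (rule chart_conjugate_scale[of "xi (n + 1)" 1 "- 1" "1 / (xi (n + 1) * a)"])
      (use a xi_nonzero xn in simp_all)
qed

text \<open>The scaling by \<open>3\<close> and \<open>- N\<close> sends the line
  \<open>x = y\<close> to \<open>3 x + N y = 0\<close>, and \<open>3 c = - N d\<close> makes the two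
  coefficients of \<open>x^n\<close> equal. The power of \<open>- N\<close> on \<open>a\<close>
  produces the sign and the powers in \<open>lambda0\<close> and \<open>lambda1\<close>; the factor
  \<open>3 a / d\<close> is \<open>N + 3\<close> or \<open>N - 3\<close>.\<close>

lemma to_H3_line:
  fixes N :: complex
  assumes N: "N = of_nat (n + 1)" and d: "d \<noteq> 0" and c: "3 * c = - N * d" and n: "n \<ge> 1"
    and lam: "lam = (- 1) ^ (n + 1) * (3 * a / d) * N ^ (n - 1) / 3 ^ n"
  shows "chart_conjugate (vector [1, - 1, 0], power_form n a 0 c d) (line0 3 N, H3 n lam)"
  unfolding H3_power_form line0_def
proof (rule chart_conjugate_scale[of 3 "- N" 1 "- 1 / (N * 3 ^ n * d)"])
  have N0: "N \<noteq> 0" unfolding N by (metis Suc_eq_plus1 nat.distinct(1) of_nat_eq_0_iff)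
  then show "- N \<noteq> 0" "- 1 / (N * 3 ^ n * d) \<noteq> 0" using d by auto
  have "(- N) ^ n = (- 1) ^ n * (N * N ^ (n - 1))"
    using n by (cases n) (auto simp: power_minus[of N])
  then show "lam = - 1 / (N * 3 ^ n * d) * (3 * (- N) ^ n * a)"
    unfolding lam using N0 d by (simp add: field_simps)
  have "3 ^ (n + 1) * c = - N * d * 3 ^ n" using c by (simp add: mult.assoc[symmetric] mult.commute)
  then show "1 = - 1 / (N * 3 ^ n * d) * (3 ^ (n + 1) * c)" using N0 d by simp
  show "1 = - 1 / (N * 3 ^ n * d) * (- N * 3 ^ n * d)" using N0 d by simp
qed simp_all

lemma to_model6:
  assumes d: "d \<noteq> 0" and c: "3 * c = - of_nat (n + 1) * d" and a: "3 * a = (of_nat (n + 1) + 3) * d" and n: "n \<ge> 1"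
  shows "chart_conjugate (vector [1, - 1, 0], power_form n a 0 c d) (model6 (n + 1))"
proof -
  have "3 * a / d = of_nat (n + 1) + 3" using a d by simp
  then have "lambda0 (n + 1) = (- 1) ^ (n + 1) * (3 * a / d) * of_nat (n + 1) ^ (n - 1) / 3 ^ n"
    unfolding lambda0_def by (simp only: add_diff_cancel_right' diff_add_inverse2) (simp add: numeral_2_eq_2)
  then show ?thesis unfolding model6_def using to_H3_line[OF refl d c n] by simp
qed

lemma to_model7:
  assumes d: "d \<noteq> 0" and c: "3 * c = - of_nat (n + 1) * d" and a: "3 * a = (of_nat (n + 1) - 3) * d" and n: "n \<ge> 1"
  shows "chart_conjugate (vector [1, - 1, 0], power_form n a 0 c d) (model7 (n + 1))"
proof -
  have "3 * a / d = of_nat (n + 1) - 3" using a d by simp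
  then have "lambda1 (n + 1) = (- 1) ^ (n + 1) * (3 * a / d) * of_nat (n + 1) ^ (n - 1) / 3 ^ n"
    unfolding lambda1_def by (simp only: add_diff_cancel_right' diff_add_inverse2) (simp add: numeral_2_eq_2)
  then show ?thesis unfolding model7_def using to_H3_line[OF refl d c n] by simp
qed

lemma to_model9:
  assumes c: "c \<noteq> 0" "3 * c = of_nat (n + 1) * a"
  shows "chart_conjugate (vector [1, - 1, 0], power_form n a (- c) c (- a)) (model9 (n + 1))"
proof -
  have "of_nat (n + 1) \<noteq> (0 :: complex)" by (metis Suc_eq_plus1 nat.distinct(1) of_nat_eq_0_iff)
  then have a: "3 / of_nat (n + 1) = a / c" using c by (simp add: field_simps del: of_nat_add of_nat_Suc)
  then have a': "- 3 / of_nat (n + 1) = - a / c" by (metis divide_minus_left minus_divide_left)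
  show ?thesis unfolding model_defs a a' add_diff_cancel_right'
    by (rule chart_conjugate_scale[of 1 1 "- 1" "1 / c"]) (use c in simp_all)
qed

text \<open>Scaling \<open>x\<close> by \<open>r\<close> multiplies \<open>c / b\<close> by
  \<open>r^(n + 1)\<close>; the solution \<open>b = c\<close> needs the value \<open>- 1\<close>
  there, which \<open>xi'\<close> supplies.\<close>

lemma to_model10:
  assumes c: "c \<noteq> 0" "3 * c = - of_nat (n + 1) * a"
  shows "chart_conjugate (vector [1, - 1, 0], power_form n a c c a) (model10 (n + 1))"
proof -
  have N: "of_nat (n + 1) \<noteq> (0 :: complex)" by (metis Suc_eq_plus1 nat.distinct(1) of_nat_eq_0_iff)
  define x where "x = xi' (n + 1)"
  have x0: "x \<noteq> 0" unfolding x_def by (rule xi_nonzero)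
  have xn: "x ^ n = - 1 / x" using xi'_power[of n] x0 unfolding x_def[symmetric] by (simp add: field_simps)
  have a: "3 * x / of_nat (n + 1) = - x * a / c" "- 3 / (of_nat (n + 1) * x) = a / (c * x)"
  proof -
    have "3 * x * c = - x * a * of_nat (n + 1)" "- 3 * (c * x) = a * (of_nat (n + 1) * x)" using c(2) by algebra+
    then show "3 * x / of_nat (n + 1) = - x * a / c" "- 3 / (of_nat (n + 1) * x) = a / (c * x)"
      using c(1) N x0 by (simp_all only: frac_eq_eq mult_eq_0_iff simp_thms)
  qed
  show ?thesis unfolding model_defs x_def[symmetric] a add_diff_cancel_right'
    by (rule chart_conjugate_scale[of x 1 "- 1" "- 1 / c"]) (use c x0 xn in \<open>simp_all add: field_simps\<close>)
qed

section \<open>The classification\<close>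

lemma chart_conjugate_refl: "chart_conjugate P P"
  by (rule chart_conjugateI[of 1 1 0 0]) (simp_all add: blk_id pullback_id same_prefoliation_refl)

lemma chart_conjugate_flip:
  "chart_conjugate (vector [1, - 1, 0], power_form n a b c d) (vector [1, - 1, 0], power_form n d c b a)"
proof -
  have "chart_conjugate (vector [1, - 1, 0], power_form n a b c d) (vector [- 1, 1, 0], power_form n d c b a)"
    using chart_conjugate_swap[of "vector [1, - 1, 0]" n a b c d] by simp
  moreover have "chart_conjugate (vector [- 1, 1, 0], power_form n d c b a) (vector [1, - 1, 0], power_form n d c b a)"
    by (rule chart_conjugate_scale[of 1 1 "- 1" 1]) simp_all
  ultimately show ?thesis by (rule chart_conjugate_trans)
qed

text \<open>Diagonal scalings and the exchange of the axes preserve the shape of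
  \<open>power_form\<close>, and they act transitively on the lines through the origin other than
  the axes.\<close>

lemma normalize_line:
  fixes l :: "complex ^ 3"
  assumes l: "l \<noteq> 0" "l$3 = 0 \<or> l$1 = 0 \<and> l$2 = 0" and \<Delta>: "a * d - b * c \<noteq> 0"
  shows "\<exists>l0 a' b' c' d'. l0 \<in> {vector [0, 0, 1], vector [1, 0, 0], vector [1, - 1, 0]} \<and> a' * d' - b' * c' \<noteq> 0 \<and>
    chart_conjugate (l, power_form n a b c d) (l0, power_form n a' b' c' d')"
proof -
  have l0: "l$1 \<noteq> 0 \<or> l$2 \<noteq> 0 \<or> l$3 \<noteq> 0" using l(1) unfolding vec3_eq_iff by simp
  consider "l$3 \<noteq> 0" | "l$3 = 0" "l$2 = 0" "l$1 \<noteq> 0" | "l$3 = 0" "l$1 = 0" "l$2 \<noteq> 0" | "l$3 = 0" "l$1 \<noteq> 0" "l$2 \<noteq> 0"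
    using l0 by blast
  then show ?thesis
  proof cases
    case 1
    then have "chart_conjugate (l, power_form n a b c d) (vector [0, 0, 1], power_form n a b c d)"
      using l(2) by (intro chart_conjugate_scale[of 1 1 "1 / l$3" 1]) auto
    then show ?thesis using \<Delta> by blast
  next
    case 2
    then have "chart_conjugate (l, power_form n a b c d) (vector [1, 0, 0], power_form n a b c d)"
      by (intro chart_conjugate_scale[of 1 1 "1 / l$1" 1]) auto
    then show ?thesis using \<Delta> by blast
  next
    case 3
    have "chart_conjugate (l, power_form n a b c d) (vector [l$2, 0, 0], power_form n d c b a)"
      using chart_conjugate_swap[of l n a b c d] 3 by simp
    moreover have "chart_conjugate (vector [l$2, 0, 0], power_form n d c b a) (vector [1, 0, 0], power_form n d c b a)"
      using 3 by (intro chart_conjugate_scale[of 1 1 "1 / l$2" 1]) auto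
    moreover have "d * a - c * b \<noteq> 0" using \<Delta> by (simp add: mult.commute)
    ultimately show ?thesis using chart_conjugate_trans by blast
  next
    case 4
    define r s where "r = l$2" and "s = - l$1"
    have rs: "r \<noteq> 0" "s \<noteq> 0" using 4 by (auto simp: r_def s_def)
    have "chart_conjugate (l, power_form n a b c d) (vector [1, - 1, 0],
      power_form n (1 * (r * s ^ n * a)) (1 * (s ^ (n + 1) * b)) (1 * (r ^ (n + 1) * c)) (1 * (s * r ^ n * d)))"
      by (rule chart_conjugate_scale[of r s "- 1 / (r * s)" 1]) (use 4 rs in \<open>auto simp: r_def s_def\<close>)
    moreover have "1 * (r * s ^ n * a) * (1 * (s * r ^ n * d)) - 1 * (s ^ (n + 1) * b) * (1 * (r ^ (n + 1) * c))
      = (r * s) ^ (n + 1) * (a * d - b * c)" by (simp add: power_mult_distrib algebra_simps)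
    ultimately show ?thesis using rs \<Delta> by (metis insertI1 insertI2 mult_eq_0_iff power_not_zero)
  qed
qed

text \<open>Both halves of the classification in one predicate. For \<open>n = 2\<close> model 7
  degenerates because \<open>lambda1\<close> is zero, models 9 and 10 because
  \<open>lam * mu = - 1\<close>, and model 8 belongs to the family
  \<open>cubic_model8\<close>.\<close>

definition flat_model :: "nat \<Rightarrow> prefoliation \<Rightarrow> bool" where
  "flat_model n M \<longleftrightarrow>
     M \<in> {model1 (n + 1), model2 (n + 1), model3 (n + 1), model4 (n + 1), model5 (n + 1), model6 (n + 1)} \<or>
     n \<ge> 3 \<and> M \<in> {model7 (n + 1), model8 (n + 1), model9 (n + 1), model10 (n + 1)} \<or>
     n = 2 \<and> ((\<exists>lam. lam \<noteq> 0 \<and> M = cubic_model7 lam) \<or> (\<exists>lam mu. lam * mu \<noteq> - 1 \<and> M = cubic_model8 lam mu))"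

text \<open>Every foliation is admissible here, so each pattern of vanishing of \<open>b\<close> and
  \<open>c\<close> has to be matched: both zero gives model 1, one zero the family
  \<open>H3\<close>, none the family \<open>H2\<close>.\<close>

lemma cubic_pencil_at_infinity:
  assumes \<Delta>: "a * d - b * c \<noteq> 0"
  shows "\<exists>M. flat_model 2 M \<and> chart_conjugate (vector [0, 0, 1], power_form 2 a b c d) M"
proof -
  have three: "(2 :: nat) + 1 = 3" by simp
  have H3: "\<exists>M. flat_model 2 M \<and> chart_conjugate (vector [0, 0, 1], power_form 2 a 0 c d) M"
    if c: "c \<noteq> 0" and ad: "a * d \<noteq> 0" for a c d
  proof -
    have "chart_conjugate (vector [0, 0, 1], power_form 2 a 0 c d) (cubic_model7 (1 / c * (1 * (c / d) ^ 2 * a)))"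
      unfolding model_defs
      by (rule chart_conjugate_scale[of 1 "c / d" 1 "1 / c"]) (use c ad in simp_all)
    moreover have "1 / c * (1 * (c / d) ^ 2 * a) \<noteq> 0" using c ad by simp
    ultimately show ?thesis unfolding flat_model_def by blast
  qed
  consider "b = 0" "c = 0" | "b = 0" "c \<noteq> 0" | "b \<noteq> 0" "c = 0" | "b \<noteq> 0" "c \<noteq> 0" by blast
  then show ?thesis
  proof cases
    case 1
    then have "chart_conjugate (vector [0, 0, 1], power_form 2 a b c d) (model1 (2 + 1))"
      using to_H1_through_origin_or_infinity(1)[of 2 a d] \<Delta> by auto
    then show ?thesis unfolding flat_model_def by blast
  next
    case 2
    then show ?thesis using H3[of c a d] \<Delta> by simp
  next
    case 3
    then obtain M where "flat_model 2 M" "chart_conjugate (vector [0, 0, 1], power_form 2 d 0 b a) M"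
      using H3[of b d a] \<Delta> by (auto simp: mult.commute)
    moreover have "chart_conjugate (vector [0, 0, 1], power_form 2 a b c d) (vector [0, 0, 1], power_form 2 d 0 b a)"
      using chart_conjugate_swap[of "vector [0, 0, 1]" 2 a b c d] 3 by simp
    ultimately show ?thesis using chart_conjugate_trans by blast
  next
    case 4
    \<comment> \<open>Scaling \<open>y\<close> by \<open>s\<close> multiplies \<open>b / c\<close>
      by \<open>s^3\<close>, which must become \<open>- 1\<close>; \<open>lam\<close> and
      \<open>mu\<close> are then what remains of \<open>a\<close> and \<open>d\<close>.\<close>
    obtain s where s: "s ^ 3 = - c / b" "s \<noteq> 0" using complex_root_exists[of 3 "- c / b"] 4 by force
    define lam mu where "lam = 1 / c * (1 * s ^ 2 * a)" and "mu = 1 / c * (s * 1 ^ 2 * d)"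
    have "chart_conjugate (vector [0, 0, 1], power_form 2 a b c d) (cubic_model8 lam mu)"
      unfolding model_defs
      by (rule chart_conjugate_scale[of 1 s 1 "1 / c"]) (use s 4 in \<open>simp_all add: lam_def mu_def\<close>)
    moreover have "lam * mu \<noteq> - 1"
    proof
      assume "lam * mu = - 1"
      moreover have "lam * mu = s ^ 3 * (a * d) / (c * c)" unfolding lam_def mu_def by (simp add: power2_eq_square power3_eq_cube)
      ultimately have "a * d = b * c" using 4 unfolding s(1) by (simp add: field_simps)
      then show False using \<Delta> by simp
    qed
    ultimately show ?thesis unfolding flat_model_def by blast
  qed
qed

lemma general_line_model:
  assumes n: "n \<ge> 2" and \<Delta>: "a * d - b * c \<noteq> 0" and crit: "cubic_crit (of_nat n - 2) K a b c d"
  shows "\<exists>M. flat_model n M \<and> chart_conjugate (vector [1, - 1, 0], power_form n a b c d) M"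
proof -
  define m where "m = (of_nat n - 2 :: complex)"
  have N: "m + 3 = of_nat (n + 1)" "m + 6 = of_nat (n + 1) + 3" "m = of_nat (n + 1) - 3" by (simp_all add: m_def)
  have N0: "of_nat (n + 1) \<noteq> (0 :: complex)" by (metis Suc_eq_plus1 nat.distinct(1) of_nat_eq_0_iff)
  have n3: "n \<ge> 3" if "n \<noteq> 2" using that n by simp
  have H3: "\<exists>M. flat_model n M \<and> chart_conjugate (vector [1, - 1, 0], power_form n a 0 c d) M"
    if ad: "a * d \<noteq> 0" and c: "3 * c = - of_nat (n + 1) * d"
      and a: "3 * a = (of_nat (n + 1) - 3) * d \<or> 3 * a = (of_nat (n + 1) + 3) * d" for a c d
    using a
  proof
    assume a: "3 * a = (of_nat (n + 1) - 3) * d"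
    have "n \<noteq> 2" using a ad by auto
    moreover have "chart_conjugate (vector [1, - 1, 0], power_form n a 0 c d) (model7 (n + 1))"
      using to_model7[OF _ c a] ad n by auto
    ultimately show ?thesis using n3 unfolding flat_model_def by blast
  next
    assume a: "3 * a = (of_nat (n + 1) + 3) * d"
    have "chart_conjugate (vector [1, - 1, 0], power_form n a 0 c d) (model6 (n + 1))"
      using to_model6[OF _ c a] ad n by auto
    then show ?thesis unfolding flat_model_def by blast
  qed
  from cubic_crit_solutions[OF crit[folded m_def] \<Delta>, unfolded N(1,2), unfolded N(3)] show ?thesis
  proof (elim disjE)
    assume s: "b = 0 \<and> c = 0 \<and> (d = a \<or> d = - a)"
    then have "a \<noteq> 0" using \<Delta> by auto
    then have "chart_conjugate (vector [1, - 1, 0], power_form n a b c d) (model4 (n + 1)) \<or>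
      chart_conjugate (vector [1, - 1, 0], power_form n a b c d) (model3 (n + 1))"
      using to_model4[OF n] to_model3 s by auto
    then show ?thesis unfolding flat_model_def by blast
  next
    assume s: "c = 0 \<and> 3 * b = - of_nat (n + 1) * a \<and> (3 * d = (of_nat (n + 1) - 3) * a \<or> 3 * d = (of_nat (n + 1) + 3) * a)"
    then obtain M where "flat_model n M" "chart_conjugate (vector [1, - 1, 0], power_form n d 0 b a) M"
      using H3[of d a b] \<Delta> by (auto simp: mult.commute)
    then show ?thesis using chart_conjugate_trans[OF chart_conjugate_flip] s by blast
  next
    assume s: "b = 0 \<and> 3 * c = - of_nat (n + 1) * d \<and> (3 * a = (of_nat (n + 1) - 3) * d \<or> 3 * a = (of_nat (n + 1) + 3) * d)"
    then show ?thesis using H3[of a d c] \<Delta> by auto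
  next
    assume s: "d = a \<and> b = c \<and> 3 * c = - of_nat (n + 1) * a"
    have "c \<noteq> 0"
    proof
      assume "c = 0"
      then have "- of_nat (n + 1) * a = 0" using s by (metis mult_zero_right)
      then have "a = 0" using N0 by (metis mult_eq_0_iff neg_equal_0_iff_equal)
      then show False using s \<open>c = 0\<close> \<Delta> by simp
    qed
    have "n \<noteq> 2"
    proof
      assume "n = 2"
      then have "c = - a" using s by simp
      then show False using s \<Delta> by simp
    qed
    then show ?thesis using to_model10[OF \<open>c \<noteq> 0\<close>] s n3 unfolding flat_model_def by blast
  next
    assume s: "d = - a \<and> b = - c \<and> 3 * c = of_nat (n + 1) * a"
    have "c \<noteq> 0"
    proof
      assume "c = 0"
      then have "of_nat (n + 1) * a = 0" using s by (metis mult_zero_right)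
      then have "a = 0" using N0 by (metis mult_eq_0_iff neg_equal_0_iff_equal)
      then show False using s \<open>c = 0\<close> \<Delta> by simp
    qed
    have "n \<noteq> 2"
    proof
      assume "n = 2"
      then have "c = a" using s by simp
      then show False using s \<Delta> by simp
    qed
    then show ?thesis using to_model9[OF \<open>c \<noteq> 0\<close>] s n3 unfolding flat_model_def by blast
  qed
qed

lemma flat_imp_model:
  assumes n: "n \<ge> 2" and l0: "l0 \<in> {vector [0, 0, 1], vector [1, 0, 0], vector [1, - 1, 0]}" and \<Delta>: "a * d - b * c \<noteq> 0"
    and Q: "chart_conjugate (l0, power_form n a b c d) Q" and flat: "leg_flat (n + 1) Q"
  shows "\<exists>M. flat_model n M \<and> chart_conjugate (l0, power_form n a b c d) M"
proof -
  consider "l0 = vector [0, 0, 1]" | "l0 = vector [1, 0, 0]" | "l0 = vector [1, - 1, 0]" using l0 by blast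
  then show ?thesis
  proof cases
    case 1
    have f: "n = 2 \<or> (a = 0 \<and> d = 0) \<or> (b = 0 \<and> c = 0)"
      using flat_line_infinity_iff[OF n \<Delta> Q[unfolded 1]] flat by simp
    show ?thesis
    proof (cases "n = 2")
      case True
      then show ?thesis using cubic_pencil_at_infinity[OF \<Delta>] 1 by simp
    next
      case False
      then have n3: "n \<ge> 3" using n by simp
      from f False show ?thesis
      proof (elim disjE)
        assume s: "a = 0 \<and> d = 0"
        then have "chart_conjugate (l0, power_form n a b c d) (model8 (n + 1))"
          using to_H2_through_origin_or_infinity(1)[OF n, of b c] \<Delta> 1 by auto
        then show ?thesis using n3 unfolding flat_model_def by blast
      next
        assume s: "b = 0 \<and> c = 0"
        then have "chart_conjugate (l0, power_form n a b c d) (model1 (n + 1))"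
          using to_H1_through_origin_or_infinity(1)[OF n, of a d] \<Delta> 1 by auto
        then show ?thesis unfolding flat_model_def by blast
      qed simp
    qed
  next
    case 2
    have "(a = 0 \<and> d = 0) \<or> (b = 0 \<and> c = 0)"
      using flat_critical_line_iff[OF n \<Delta> Q[unfolded 2]] flat by simp
    then show ?thesis
    proof
      assume s: "a = 0 \<and> d = 0"
      then have "chart_conjugate (l0, power_form n a b c d) (model5 (n + 1))"
        using to_H2_through_origin_or_infinity(2)[OF n, of b c] \<Delta> 2 by auto
      then show ?thesis unfolding flat_model_def by blast
    next
      assume s: "b = 0 \<and> c = 0"
      then have "chart_conjugate (l0, power_form n a b c d) (model2 (n + 1))"
        using to_H1_through_origin_or_infinity(2)[OF n, of a d] \<Delta> 2 by auto
      then show ?thesis unfolding flat_model_def by blast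
    qed
  next
    case 3
    obtain K where "cubic_crit (of_nat n - 2) K a b c d"
      using flat_general_line_iff[OF n \<Delta> Q[unfolded 3]] flat by blast
    then show ?thesis unfolding 3 by (rule general_line_model[OF n \<Delta>])
  qed
qed

text \<open>Flatness is asked of the whole class of chart conjugates, because this is what the
  criteria decide and what is later applied to a conjugate of a model.\<close>

definition flat_normal_form :: "nat \<Rightarrow> complex ^ 3 \<Rightarrow> complex \<Rightarrow> complex \<Rightarrow> complex \<Rightarrow> complex \<Rightarrow> bool" where
  "flat_normal_form n l0 a b c d \<longleftrightarrow> a * d - b * c \<noteq> 0 \<and> (l0$3 = 0 \<or> l0$1 = 0 \<and> l0$2 = 0) \<and>
     (\<forall>Q. chart_conjugate (l0, power_form n a b c d) Q \<longrightarrow> leg_flat (n + 1) Q)"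

lemma flat_normal_form_infinity:
  assumes "n \<ge> 2" "a * d - b * c \<noteq> 0" "n = 2 \<or> (a = 0 \<and> d = 0) \<or> (b = 0 \<and> c = 0)"
  shows "flat_normal_form n (vector [0, 0, 1]) a b c d"
  using assms flat_line_infinity_iff[OF assms(1,2)] unfolding flat_normal_form_def by simp

lemma flat_normal_form_critical:
  assumes "n \<ge> 2" "a * d - b * c \<noteq> 0" "(a = 0 \<and> d = 0) \<or> (b = 0 \<and> c = 0)"
  shows "flat_normal_form n (vector [1, 0, 0]) a b c d"
  using assms flat_critical_line_iff[OF assms(1,2)] unfolding flat_normal_form_def by simp

lemma flat_normal_form_general:
  assumes "n \<ge> 2" "a * d - b * c \<noteq> 0" "cubic_crit (of_nat n - 2) K a b c d"
  shows "flat_normal_form n (vector [1, - 1, 0]) a b c d"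
  using assms flat_general_line_iff[OF assms(1,2)] unfolding flat_normal_form_def by auto

text \<open>The values of \<open>K\<close> in this and the next three lemmas are those found when
  solving: \<open>K a d\<close> is -3 or 3 for the triangular solutions, and
  \<open>K a (a + c) = - 3\<close> when \<open>b\<close> and \<open>c\<close> are both
  nonzero.\<close>

lemma cubic_crit_unit_sum:
  fixes a c m K :: complex
  assumes "3 * c = - (m + 3)" "3 * a = m + 6" "K * a = - 3"
  shows "cubic_crit m K a 0 c 1"
  unfolding cubic_crit_def by (intro conjI) (use assms in \<open>algebra | simp\<close>)+

lemma cubic_crit_minus_unit_sum:
  fixes a c m K :: complex
  assumes "3 * c = - (m + 3)" "3 * a = m" "K * a = 3"
  shows "cubic_crit m K a 0 c 1"
  unfolding cubic_crit_def by (intro conjI) (use assms in \<open>algebra | simp\<close>)+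

lemma cubic_crit_antisymmetric:
  fixes a c m K :: complex
  assumes "(m + 3) * a = 3 * c" "K * a * (a + c) = - 3"
  shows "cubic_crit m K a (- c) c (- a)"
  unfolding cubic_crit_def by (intro conjI) (use assms in \<open>algebra | simp\<close>)+

lemma cubic_crit_symmetric:
  fixes a c m K :: complex
  assumes "(m + 3) * a = - 3 * c" "K * a * (a + c) = - 3"
  shows "cubic_crit m K a c c a"
  unfolding cubic_crit_def by (intro conjI) (use assms in \<open>algebra | simp\<close>)+

text \<open>The solutions of the flatness equations are revisited with one coefficient set to 1 and
  an explicit \<open>K\<close>. For models 7, 9 and 10 the determinant is nonzero because
  \<open>N \<noteq> 3\<close>, that is \<open>n \<ge> 3\<close>.\<close>

lemma flat_model_normal_form:
  assumes n: "n \<ge> 2" and M: "flat_model n M"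
  shows "\<exists>l0 a b c d. flat_normal_form n l0 a b c d \<and> chart_conjugate (l0, power_form n a b c d) M"
proof -
  define N where "N = (of_nat (n + 1) :: complex)"
  have N0: "N \<noteq> 0" unfolding N_def by (metis Suc_eq_plus1 nat.distinct(1) of_nat_eq_0_iff)
  have m: "of_nat n - 2 = N - 3" unfolding N_def by simp
  have N3: "N + 3 \<noteq> 0"
  proof -
    have "N + 3 = of_nat (n + 4)" unfolding N_def by simp
    then show ?thesis by (metis add_is_0 of_nat_eq_0_iff zero_neq_numeral)
  qed
  have N3': "N - 3 \<noteq> 0" if "n \<ge> 3"
  proof -
    have "N - 3 = of_nat (n - 2)" unfolding N_def using n by (simp add: of_nat_diff)
    moreover have "n - 2 \<noteq> 0" using that by simp
    ultimately show ?thesis by (metis of_nat_eq_0_iff)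
  qed
  have normal: ?thesis if "flat_normal_form n l0 a b c d" "chart_conjugate (l0, power_form n a b c d) M" for l0 a b c d
    using that by blast
  consider "M = model1 (n + 1)" | "M = model2 (n + 1)" | "M = model3 (n + 1)" | "M = model4 (n + 1)" | "M = model5 (n + 1)"
    | "M = model6 (n + 1)" | "n \<ge> 3" "M = model7 (n + 1)" | "n \<ge> 3" "M = model8 (n + 1)" | "n \<ge> 3" "M = model9 (n + 1)"
    | "n \<ge> 3" "M = model10 (n + 1)" | lam where "n = 2" "lam \<noteq> 0" "M = cubic_model7 lam"
    | lam mu where "n = 2" "lam * mu \<noteq> - 1" "M = cubic_model8 lam mu"
    using M unfolding flat_model_def by blast
  then show ?thesis
  proof cases
    case 1
    show ?thesis
      by (rule normal[OF flat_normal_form_infinity[OF n] to_H1_through_origin_or_infinity(1)[OF n, of 1 "- 1", folded 1]]) simp_all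
  next
    case 2
    show ?thesis
      by (rule normal[OF flat_normal_form_critical[OF n] to_H1_through_origin_or_infinity(2)[OF n, of 1 "- 1", folded 2]]) simp_all
  next
    case 3
    \<comment> \<open>With \<open>b = c = 0\<close> and \<open>a = 1\<close>, \<open>d = - 1\<close>
      the equation \<open>m a - 3 (d - a) = K a^2 d\<close> gives \<open>K = - (m + 6)\<close>,
      where \<open>m = N - 3\<close>.\<close>
    have "cubic_crit (of_nat n - 2) (- (N + 3)) 1 0 0 (- 1)" unfolding cubic_crit_def m by simp
    then show ?thesis
      by (intro normal[OF flat_normal_form_general[OF n] to_model3[of 1 n, folded 3]]) simp_all
  next
    case 4
    have "cubic_crit (of_nat n - 2) (N - 3) 1 0 0 1" unfolding cubic_crit_def m by simp
    then show ?thesis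
      by (intro normal[OF flat_normal_form_general[OF n] to_model4[OF n, of 1, folded 4]]) simp_all
  next
    case 5
    show ?thesis
      by (rule normal[OF flat_normal_form_critical[OF n] to_H2_through_origin_or_infinity(2)[OF n, of "- 1" 1, folded 5]]) simp_all
  next
    case 6
    have "cubic_crit (of_nat n - 2) (- 9 / (N + 3)) ((N + 3) / 3) 0 (- N / 3) 1"
      unfolding m
    proof (rule cubic_crit_unit_sum)
      have "- 9 / x * (x / 3) = - 3" if "x \<noteq> 0" for x :: complex using that by simp
      then show "- 9 / (N + 3) * ((N + 3) / 3) = - 3" using N3 by blast
    qed simp_all
    then have "flat_normal_form n (vector [1, - 1, 0]) ((N + 3) / 3) 0 (- N / 3) 1"
      using N3 by (intro flat_normal_form_general[OF n]) auto
    moreover have "chart_conjugate (vector [1, - 1, 0], power_form n ((N + 3) / 3) 0 (- N / 3) 1) M"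
      unfolding 6 by (rule to_model6) (use n in \<open>simp_all add: N_def\<close>)
    ultimately show ?thesis by blast
  next
    case 7
    have "cubic_crit (of_nat n - 2) (9 / (N - 3)) ((N - 3) / 3) 0 (- N / 3) 1"
      unfolding m
    proof (rule cubic_crit_minus_unit_sum)
      have "9 / x * (x / 3) = 3" if "x \<noteq> 0" for x :: complex using that by simp
      then show "9 / (N - 3) * ((N - 3) / 3) = 3" using N3' 7 by blast
    qed simp_all
    then have "flat_normal_form n (vector [1, - 1, 0]) ((N - 3) / 3) 0 (- N / 3) 1"
      using N3' 7 by (intro flat_normal_form_general[OF n]) auto
    moreover have "chart_conjugate (vector [1, - 1, 0], power_form n ((N - 3) / 3) 0 (- N / 3) 1) M"
      unfolding 7 by (rule to_model7) (use n in \<open>simp_all add: N_def\<close>)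
    ultimately show ?thesis by blast
  next
    case 8
    show ?thesis
      by (rule normal[OF flat_normal_form_infinity[OF n] to_H2_through_origin_or_infinity(1)[OF n, of "- 1" 1, folded 8(2)]]) simp_all
  next
    case 9
    define a where "a = 3 / N"
    have aN: "N * a = 3" unfolding a_def using N0 by simp
    have a0: "a \<noteq> 0" using aN by auto
    have "N * (a + 1) = N + 3" "N * (1 - a) = N - 3" using aN by (simp_all add: algebra_simps)
    then have a1: "a + 1 \<noteq> 0" "1 - a \<noteq> 0" using N3 N3' 9 by auto
    have "cubic_crit (of_nat n - 2) (- 3 / (a * (a + 1))) a (- 1) 1 (- a)"
      unfolding m
    proof (rule cubic_crit_antisymmetric)
      have "- 3 / (x * y) * x * y = - 3" if "x \<noteq> 0" "y \<noteq> 0" for x y :: complex using that by simp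
      then show "- 3 / (a * (a + 1)) * a * (a + 1) = - 3" using a0 a1 by blast
    qed (use aN in simp)
    moreover have "a * (- a) - (- 1) * 1 = (a + 1) * (1 - a)" by algebra
    ultimately have "flat_normal_form n (vector [1, - 1, 0]) a (- 1) 1 (- a)"
      using a1 by (intro flat_normal_form_general[OF n]) auto
    moreover have "chart_conjugate (vector [1, - 1, 0], power_form n a (- 1) 1 (- a)) M"
      unfolding 9 by (rule to_model9) (use aN in \<open>simp_all add: N_def\<close>)
    ultimately show ?thesis by blast
  next
    case 10
    define a where "a = - 3 / N"
    have aN: "N * a = - 3" unfolding a_def using N0 by simp
    have a0: "a \<noteq> 0" using aN by auto
    have "N * (a + 1) = N - 3" "N * (a - 1) = - (N + 3)" using aN by (simp_all add: algebra_simps)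
    then have a1: "a + 1 \<noteq> 0" "a - 1 \<noteq> 0" using N3 N3' 10 by auto
    have "cubic_crit (of_nat n - 2) (- 3 / (a * (a + 1))) a 1 1 a"
      unfolding m
    proof (rule cubic_crit_symmetric)
      have "- 3 / (x * y) * x * y = - 3" if "x \<noteq> 0" "y \<noteq> 0" for x y :: complex using that by simp
      then show "- 3 / (a * (a + 1)) * a * (a + 1) = - 3" using a0 a1 by blast
    qed (use aN in simp)
    moreover have "a * a - 1 * 1 = (a + 1) * (a - 1)" by algebra
    ultimately have "flat_normal_form n (vector [1, - 1, 0]) a 1 1 a"
      using a1 by (intro flat_normal_form_general[OF n]) auto
    moreover have "chart_conjugate (vector [1, - 1, 0], power_form n a 1 1 a) M"
    proof -
      have "3 * 1 = - N * a" using aN by simp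
      then show ?thesis unfolding 10 by (intro to_model10) (simp_all only: N_def one_neq_zero not_False_eq_True)
    qed
    ultimately show ?thesis by blast
  next
    case (11 lam)
    show ?thesis
      by (rule normal[OF flat_normal_form_infinity[OF n, of lam 1 0 1]])
        (use 11 in \<open>simp_all add: model_defs chart_conjugate_refl\<close>)
  next
    case (12 lam mu)
    have "lam * mu - - 1 * 1 \<noteq> 0" using 12(2) by (metis diff_eq_eq add_0 mult_1_right)
    then have "flat_normal_form n (vector [0, 0, 1]) lam (- 1) 1 mu"
      using 12(1) by (intro flat_normal_form_infinity[OF n]) simp_all
    then show ?thesis
      by (rule normal) (simp add: 12 model_defs chart_conjugate_refl)
  qed
qed

text \<open>The pulled-back pre-foliation is brought to a normal form by conjugations linear in the
  chart, and a flat one continues to a model in the same way. A conjugation with a model given in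
  advance is arbitrary, so for the converse it must first be recognised as chart linear.\<close>

lemma flat_iff_model:
  assumes n: "n \<ge> 2" and P: "prefoliation (n + 1) P" and g: "homogeneous_in_chart g P"
    and type: "type_degree (pullback g P) = 2"
  shows "leg_flat (n + 1) (pullback g P) \<longleftrightarrow> (\<exists>M. flat_model n M \<and> linearly_conjugate P M)"
proof -
  define P' where "P' = pullback g P"
  have inv: "invertible g" "homothety_invariant P'" using g unfolding homogeneous_in_chart_def P'_def by auto
  have pre: "prefoliation (n + 1) P'" unfolding P'_def by (rule prefoliation_pullback[OF P inv(1)])
  obtain \<alpha> \<beta> where form: "snd P' = affine_form (bform n \<alpha>) (bform n \<beta>)" and nz: "no_common_zero n \<alpha> \<beta>"
    using homogeneous_prefoliation[OF pre inv(2)] n by auto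
  have conj: "linearly_conjugate P P'" unfolding P'_def by (rule linearly_conjugate_pullback[OF inv(1)])
  have n1: "n \<ge> 1" using n by simp
  obtain u1 u2 v1 v2 a b c d where D: "u1 * v2 - u2 * v1 \<noteq> 0" and \<Delta>: "a * d - b * c \<noteq> 0"
    and pf: "snd (pullback (blk u1 u2 v1 v2) P') = power_form n a b c d"
    using type_degree_two_power_form[OF n1 form nz] type unfolding P'_def by metis
  define l where "l = fst (pullback (blk u1 u2 v1 v2) P')"
  have pb: "pullback (blk u1 u2 v1 v2) P' = (l, power_form n a b c d)" using pf unfolding l_def by (metis prod.collapse)
  have c1: "chart_conjugate P' (l, power_form n a b c d)"
    by (rule chart_conjugateI[OF D]) (simp add: pb same_prefoliation_refl)
  have l: "l \<noteq> 0" "l$3 = 0 \<or> l$1 = 0 \<and> l$2 = 0"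
  proof -
    have "invertible (blk u1 u2 v1 v2)" using blk_inverse[OF D] unfolding invertible_def by blast
    then have "prefoliation (n + 1) (l, power_form n a b c d)" using prefoliation_pullback[OF pre] pb by metis
    then show "l \<noteq> 0" unfolding prefoliation_def by simp
    have "l = vector [u1 * fst P' $ 1 + v1 * fst P' $ 2, u2 * fst P' $ 1 + v2 * fst P' $ 2, fst P' $ 3]"
      unfolding l_def using pullback_line[of u1 u2 v1 v2 "fst P'" "snd P'"] by simp
    then show "l$3 = 0 \<or> l$1 = 0 \<and> l$2 = 0" using homothety_invariant_line[OF inv(2)] by auto
  qed
  obtain l0 a' b' c' d' where l0: "l0 \<in> {vector [0, 0, 1], vector [1, 0, 0], vector [1, - 1, 0]}"
    and \<Delta>': "a' * d' - b' * c' \<noteq> 0" and c2: "chart_conjugate (l, power_form n a b c d) (l0, power_form n a' b' c' d')"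
    using normalize_line[OF l \<Delta>] by blast
  have c3: "chart_conjugate P' (l0, power_form n a' b' c' d')" by (rule chart_conjugate_trans[OF c1 c2])
  show ?thesis
    unfolding P'_def[symmetric]
  proof
    assume "leg_flat (n + 1) P'"
    then obtain M where M: "flat_model n M" "chart_conjugate (l0, power_form n a' b' c' d') M"
      using flat_imp_model[OF n l0 \<Delta>' chart_conjugate_sym[OF c3]] by blast
    have "linearly_conjugate P' M"
      by (rule chart_conjugate_imp_linearly_conjugate[OF chart_conjugate_trans[OF c3 M(2)]])
    then show "\<exists>M. flat_model n M \<and> linearly_conjugate P M" using M(1) linearly_conjugate_trans[OF conj] by blast
  next
    assume "\<exists>M. flat_model n M \<and> linearly_conjugate P M"
    then obtain M where M: "flat_model n M" "linearly_conjugate P M" by blast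
    obtain l1 a b c d where nf: "flat_normal_form n l1 a b c d" and cM: "chart_conjugate (l1, power_form n a b c d) M"
      using flat_model_normal_form[OF n M(1)] by blast
    \<comment> \<open>Normal form, model, \<open>P\<close> and \<open>P'\<close> are chained
      together; since both ends are homogeneous in the standard chart, the composite is chart
      linear.\<close>
    have "linearly_conjugate (l1, power_form n a b c d) P'"
      using linearly_conjugate_trans[OF chart_conjugate_imp_linearly_conjugate[OF cM]
          linearly_conjugate_trans[OF linearly_conjugate_sym[OF M(2)] conj]] .
    then have "chart_conjugate (l1, power_form n a b c d) P'"
      using nf unfolding flat_normal_form_def
      by (intro linearly_conjugate_imp_chart_conjugate[OF n refl _ _ form]) auto
    then show "leg_flat (n + 1) P'" using nf unfolding flat_normal_form_def by blast
  qed
qed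

theorem proposition4p4:
  fixes d :: nat and P :: prefoliation and g :: "complex ^ 3 ^ 3"
  assumes "d \<ge> 3"
    and "prefoliation d P"
    and "homogeneous_in_chart g P"
    and "type_degree (pullback g P) = 2"
  shows "(d \<ge> 4 \<longrightarrow>
            (leg_flat d (pullback g P) \<longleftrightarrow>
               (\<exists>M \<in> {model1 d, model2 d, model3 d, model4 d, model5 d,
                       model6 d, model7 d, model8 d, model9 d, model10 d}.
                  linearly_conjugate P M))) \<and>
         (d = 3 \<longrightarrow>
            (leg_flat d (pullback g P) \<longleftrightarrow>
               (\<exists>M \<in> {model1 3, model2 3, model3 3, model4 3, model5 3, model6 3}.
                  linearly_conjugate P M) \<or>
               (\<exists>lam. lam \<noteq> 0 \<and> linearly_conjugate P (cubic_model7 lam)) \<or>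
               (\<exists>lam mu. lam * mu \<noteq> -1 \<and> linearly_conjugate P (cubic_model8 lam mu))))"
proof -
  define n where "n = d - 1"
  have d: "d = n + 1" and n: "n \<ge> 2" using assms(1) by (auto simp: n_def)
  note main = flat_iff_model[OF n assms(2-4)[unfolded d]]
  show ?thesis
  proof (intro conjI impI)
    assume "d \<ge> 4"
    then have "n \<ge> 3" "n \<noteq> 2" using d by auto
    then show "leg_flat d (pullback g P) \<longleftrightarrow>
               (\<exists>M \<in> {model1 d, model2 d, model3 d, model4 d, model5 d,
                       model6 d, model7 d, model8 d, model9 d, model10 d}.
                  linearly_conjugate P M)"
      unfolding d main flat_model_def by blast
  next
    assume "d = 3"
    then have n2: "n = 2" using d by simp
    have fm: "flat_model n M \<longleftrightarrow> M \<in> {model1 3, model2 3, model3 3, model4 3, model5 3, model6 3} \<or>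
      (\<exists>lam. lam \<noteq> 0 \<and> M = cubic_model7 lam) \<or> (\<exists>lam mu. lam * mu \<noteq> - 1 \<and> M = cubic_model8 lam mu)" for M
      unfolding flat_model_def n2 by simp
    then show "leg_flat d (pullback g P) \<longleftrightarrow>
               (\<exists>M \<in> {model1 3, model2 3, model3 3, model4 3, model5 3, model6 3}.
                  linearly_conjugate P M) \<or>
               (\<exists>lam. lam \<noteq> 0 \<and> linearly_conjugate P (cubic_model7 lam)) \<or>
               (\<exists>lam mu. lam * mu \<noteq> -1 \<and> linearly_conjugate P (cubic_model8 lam mu))"
      unfolding d main fm by blast
  qed
qed

end
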